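(* Let $\mu$, $\lambda$, $C_\lambda$, $\alpha$, $(s_t)_{t>0}$ and $(\theta_t)_{t>0}$ be as in the context. Assume that there exist a function $b \in L^{\infty}(\mu)$ and constants $c_0>0$, $C_0<\infty$ such that, for every cube $Q \subset \mathbb{R}^n$, $$\Big| \int_Q b(x)\,d\mu(x) \Big| \ge c_0\, \mu(Q)$$ and $$\iint_{\widehat Q} |\theta_t b(x)|^2\,d\mu(x)\,\frac{dt}{t} \le C_0\, \mu(3Q).$$ Then there is a constant $C<\infty$ such that $$\iint_{\mathbb{R}^{n+1}_+} |\theta_t f(x)|^2\,d\mu(x)\,\frac{dt}{t} \le C\, \|f\|_{L^2(\mu)}^2 \qquad \text{for all } f \in L^2(\mu).$$
   Context: $\mathbb{R}^n$ is equipped with the $\ell^\infty$ metric, $|x-y|=\max_i|x_i-y_i|$; $B(x,r)$ denotes the corresponding ball, and $\mathbb{R}^{n+1}_+=\mathbb{R}^n\times(0,\infty)$. Cubes have sides parallel to the coordinate axes; $\ell(Q)$ is the sidelength of a cube $Q$, $3Q$ is the cube concentric with $Q$ of sidelength $3\ell(Q)$, and $\widehat Q = Q\times(0,\ell(Q))$ is the Carleson box associated with $Q$. $\mu$ is a Borel measure on $\mathbb{R}^n$ and $\lambda:\mathbb{R}^n\times(0,\infty)\to(0,\infty)$ is a function such that $r\mapsto\lambda(x,r)$ is non-decreasing for each $x$, $\lambda(x,2r)\le C_\lambda\lambda(x,r)$ and $\mu(B(x,r))\le\lambda(x,r)$ for all $x\in\mathbb{R}^n$, $r>0$, where $C_\lambda$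 is a constant. For $t>0$, $$\theta_t f(x)=\int_{\mathbb{R}^n}s_t(x,y)f(y)\,d\mu(y),\qquad x\in\mathbb{R}^n,$$ where the kernel $(x,y,t)\mapsto s_t(x,y)$ is measurable and, for some $\alpha>0$ and some constant $C_1$, satisfies for all $x,y\in\mathbb{R}^n$ and $t>0$ $$|s_t(x,y)|\le C_1\frac{t^\alpha}{t^\alpha\lambda(x,t)+|x-y|^\alpha\lambda(x,|x-y|)}$$ and $$|s_t(x,y)-s_t(x,z)|\le C_1\frac{|y-z|^\alpha}{t^\alpha\lambda(x,t)+|x-y|^\alpha\lambda(x,|x-y|)}\quad\text{whenever }|y-z|<t/2.$$ The term $|x-y|^\alpha\lambda(x,|x-y|)$ is interpreted as $0$ when $x=y$. *)

theory Defs
  imports "HOL-Analysis.Analysis"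
begin

definition linf_ball :: "real ^ 'n \<Rightarrow> real \<Rightarrow> (real ^ 'n) set" where
  "linf_ball x r = {y. infnorm (x - y) < r}"

(* Half-open cube with centre c and sidelength l.  In this parametrisation 3Q is cube c (3 * l). *)
definition cube :: "real ^ 'n \<Rightarrow> real \<Rightarrow> (real ^ 'n) set" where
  "cube c l = {x. \<forall>i. c $ i - l / 2 \<le> x $ i \<and> x $ i < c $ i + l / 2}"

definition carleson_box :: "real ^ 'n \<Rightarrow> real \<Rightarrow> ((real ^ 'n) \<times> real) set" where
  "carleson_box c l = cube c l \<times> {0<..<l}"

definition upper_half_space :: "((real ^ 'n) \<times> real) set" where
  "upper_half_space = UNIV \<times> {0<..}"

(* Only the values lam x r with r > 0 are constrained. *)
definition upper_doubling ::
    "(real ^ 'n) measure \<Rightarrow> (real ^ 'n \<Rightarrow> real \<Rightarrow> real) \<Rightarrow> real \<Rightarrow> bool" where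
  "upper_doubling \<mu> lam C_lam \<longleftrightarrow>
     (\<forall>x. \<forall>r>0. lam x r > 0) \<and>
     (\<forall>x r r'. 0 < r \<and> r \<le> r' \<longrightarrow> lam x r \<le> lam x r') \<and>
     (\<forall>x. \<forall>r>0. lam x (2 * r) \<le> C_lam * lam x r) \<and>
     (\<forall>x. \<forall>r>0. emeasure \<mu> (linf_ball x r) \<le> ennreal (lam x r))"

(* For x = y the second summand is 0 whatever lam x 0 is, because 0 powr \<alpha> = 0. *)
definition kernel_denom ::
    "(real ^ 'n \<Rightarrow> real \<Rightarrow> real) \<Rightarrow> real \<Rightarrow> real \<Rightarrow> real ^ 'n \<Rightarrow> real ^ 'n \<Rightarrow> real" where
  "kernel_denom lam \<alpha> t x y =
     t powr \<alpha> * lam x t + infnorm (x - y) powr \<alpha> * lam x (infnorm (x - y))"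

definition square_function_kernel ::
    "(real ^ 'n \<Rightarrow> real \<Rightarrow> real) \<Rightarrow> real \<Rightarrow> real \<Rightarrow>
     (real \<Rightarrow> real ^ 'n \<Rightarrow> real ^ 'n \<Rightarrow> complex) \<Rightarrow> bool" where
  "square_function_kernel lam \<alpha> C\<^sub>1 s \<longleftrightarrow>
     (\<lambda>(x, y, t). s t x y)
       \<in> borel_measurable (borel \<Otimes>\<^sub>M borel \<Otimes>\<^sub>M restrict_space borel {0<..}) \<and>
     (\<forall>t>0. \<forall>x y. norm (s t x y) \<le> C\<^sub>1 * (t powr \<alpha> / kernel_denom lam \<alpha> t x y)) \<and>
     (\<forall>t>0. \<forall>x y z. infnorm (y - z) < t / 2 \<longrightarrow>
        norm (s t x y - s t x z) \<le> C\<^sub>1 * (infnorm (y - z) powr \<alpha> / kernel_denom lam \<alpha> t x y))"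

definition theta ::
    "(real ^ 'n) measure \<Rightarrow> (real \<Rightarrow> real ^ 'n \<Rightarrow> real ^ 'n \<Rightarrow> complex) \<Rightarrow>
     real \<Rightarrow> (real ^ 'n \<Rightarrow> complex) \<Rightarrow> real ^ 'n \<Rightarrow> complex" where
  "theta \<mu> s t f x = (\<integral>y. s t x y * f y \<partial>\<mu>)"

(* The integral of |theta_t f(x)|^2 over A with respect to d\<mu>(x) dt/t. *)
definition square_integral ::
    "(real ^ 'n) measure \<Rightarrow> (real \<Rightarrow> real ^ 'n \<Rightarrow> real ^ 'n \<Rightarrow> complex) \<Rightarrow>
     (real ^ 'n \<Rightarrow> complex) \<Rightarrow> ((real ^ 'n) \<times> real) set \<Rightarrow> ennreal" where
  "square_integral \<mu> s f A =
     (\<integral>\<^sup>+ p \<in> A. ennreal ((norm (theta \<mu> s (snd p) f (fst p)))\<^sup>2 / snd p) \<partial>(\<mu> \<Otimes>\<^sub>M lborel))"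

(* L^p spaces are represented by sets of functions, not by classes modulo a.e. equality. *)
definition L_infinity :: "'a measure \<Rightarrow> ('a \<Rightarrow> complex) set" where
  "L_infinity \<mu> = {f \<in> borel_measurable \<mu>. \<exists>M. AE x in \<mu>. norm (f x) \<le> M}"

definition L2_norm_sq :: "'a measure \<Rightarrow> ('a \<Rightarrow> complex) \<Rightarrow> ennreal" where
  "L2_norm_sq \<mu> f = (\<integral>\<^sup>+ x. ennreal ((norm (f x))\<^sup>2) \<partial>\<mu>)"

definition L_two :: "'a measure \<Rightarrow> ('a \<Rightarrow> complex) set" where
  "L_two \<mu> = {f \<in> borel_measurable \<mu>. L2_norm_sq \<mu> f < \<infinity>}"

end

theory Submission
  imports Defs
begin

text \<open>
The measure need not be doubling, and the testing condition controls the Carleson box of a cube \<open>Q\<close>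
only by the measure of \<open>3Q\<close>.  The proof compares \<open>\<theta>\<^sub>t f(x)\<close>, for \<open>t\<close> comparable to the side
\<open>\<ell>\<^sub>k\<close> of the cells of generation \<open>k\<close> of a 4-adic grid, with \<open>a\<^sub>k(x) \<theta>\<^sub>t b(x)\<close>, where
\<open>a\<^sub>k(x) = \<integral>\<^bsub>Q\<^esub> f d\<mu> / \<integral>\<^bsub>Q\<^esub> b d\<mu>\<close> and \<open>Q = Q\<^sub>k(x)\<close> is the cell of generation \<open>k\<close> that contains \<open>x\<close>.
Let \<open>d\<^sub>j = a\<^sub>j - a\<^bsub>j+1\<^esub>\<close>.  Three facts make the comparison work.

\<^item> \<^emph>\<open>Orthogonality.\<close>  \<open>\<Sum>\<^sub>j \<parallel>d\<^sub>j\<parallel>\<^sup>2 \<lesssim> \<parallel>f\<parallel>\<^sup>2\<close> (\<open>adapted_square_function\<close>).  Since \<open>b\<close> is accretive, \<open>d\<^sub>j\<close> is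
  controlled by the martingale differences of \<open>f\<close> and by those of \<open>b\<close> weighted with averages of
  \<open>\<bar>f\<bar>\<close>; the first are handled by Pythagoras and the second by the Carleson embedding theorem,
  which is proved with a Bellman function (\<open>carleson_bellman\<close>).

\<^item> \<^emph>\<open>Decay.\<close>  The difference \<open>\<theta>\<^sub>t f - a\<^sub>k \<theta>\<^sub>t b\<close> splits into one piece for each \<open>d\<^sub>j\<close> and
  one for the part of \<open>f\<close> below the finest generation
  (\<open>theta_decomposition\<close>).  For \<open>j < k\<close> the function \<open>d\<^sub>j b\<close> has mean zero on cells smaller than \<open>t\<close>,
  and the smoothness of the kernel gains a factor \<open>2\<^bsup>-\<alpha>(k-j)\<^esup>\<close>.  For \<open>j \<ge> k\<close> only those \<open>y\<close> contribute
  that lie in a cell of generation \<open>j\<close> other than that of \<open>x\<close>.  If \<open>x\<close> is good, that is, at distance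
  \<open>\<gtrsim> 2\<^bsup>k-j\<^esup> \<ell>\<^sub>j\<close> from the boundary of \<open>Q\<^sub>j(x)\<close> for all \<open>j \<ge> k\<close>, then \<open>\<bar>x - y\<bar> \<gtrsim> 2\<^bsup>j-k\<^esup> t\<close> for such \<open>y\<close>, and
  the size of the kernel gains \<open>2\<^bsup>-\<alpha>(j-k)\<^esup>\<close>.  Schur's test turns these gains into \<open>L\<^sup>2\<close> bounds
  (\<open>rem_term_L2\<close>), which are summed over \<open>j\<close> and \<open>k\<close>.

\<^item> \<^emph>\<open>Packing.\<close>  The main term \<open>a\<^sub>k \<theta>\<^sub>t b\<close> falls under the Carleson embedding theorem once the measure
  \<open>\<bar>\<theta>\<^sub>t b\<bar>\<^sup>2 d\<mu> dt/t\<close>, restricted to good points over a cell \<open>P\<close>, has mass \<open>\<lesssim> \<mu>(P)\<close>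
  (\<open>carleson_density_packing\<close>).  A good point over \<open>P\<close> either has \<open>t\<close> comparable to the side of \<open>P\<close>,
  where the trivial bound for \<open>\<theta>\<^sub>t b\<close> suffices, or satisfies \<open>4 t \<le> dist(x, \<partial>P)\<close>.  The second region
  is covered by Whitney cubes \<open>H\<close> with \<open>3H \<subseteq> P\<close>, and there the testing condition with \<open>3H\<close> on the
  right does no harm (\<open>whitney_packing\<close>).

Goodness depends on the grid but \<open>\<theta>\<^sub>t f(x)\<close> does not.  Every point is good for at least half of a
finite family of shifts of the grid (\<open>few_bad_shifts\<close>), so averaging the estimate over the shifts removes
the restriction to good points.  All estimates are made for finitely many generations with constants
that do not depend on their number or on the smallest side; the smallest side then tends to
zero and the largest one to infinity.
\<close>

abbreviation sqnorm :: "'a::real_normed_vector \<Rightarrow> ennreal" where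
  "sqnorm z \<equiv> ennreal ((norm z)\<^sup>2)"

abbreviation sqint :: "'a measure \<Rightarrow> ('a \<Rightarrow> 'b::real_normed_vector) \<Rightarrow> ennreal" where
  "sqint \<mu> f \<equiv> (\<integral>\<^sup>+x. sqnorm (f x) \<partial>\<mu>)"

section \<open>The dominating function and the size of the kernel\<close>

lemma borel_measurable_infnorm [measurable (raw)]:
  fixes f :: "'a \<Rightarrow> 'b::euclidean_space"
  assumes "f \<in> borel_measurable M"
  shows "(\<lambda>x. infnorm (f x)) \<in> borel_measurable M"
proof -
  have "(infnorm :: 'b \<Rightarrow> real) \<in> borel_measurable borel"
    by (intro borel_measurable_continuous_onI continuous_intros)
  from measurable_compose[OF assms this] show ?thesis .
qed

text \<open>The hypotheses say nothing about how \<open>lam x r\<close> varies with \<open>x\<close>.  The function below is a minorant of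
\<open>lam\<close> that varies slowly in \<open>x\<close>.  It still dominates the measure of balls, because the ball of radius \<open>r\<close> about \<open>x\<close>
lies in the ball of radius \<open>r + \<bar>x - z\<bar>\<close> about \<open>z\<close>, and replacing \<open>lam\<close> by a smaller function only weakens the
kernel bounds.\<close>

definition reg_lam ::
    "(real ^ 'n \<Rightarrow> real \<Rightarrow> real) \<Rightarrow> real ^ 'n \<Rightarrow> real \<Rightarrow> real" where
  "reg_lam lam x r = (INF z. lam z (r + infnorm (x - z)))"

lemma UN_linf_ball:
  fixes x :: "real ^ 'n"
  shows "r > 0 \<Longrightarrow> (\<Union>n. linf_ball x (2 ^ n * r)) = UNIV"
proof (intro set_eqI iffI UNIV_I)
  fix y :: "real ^ 'n" assume r: "r > 0"
  obtain n :: nat where "infnorm (x - y) / r < 2 ^ n"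
    using real_arch_pow[of 2 "infnorm (x - y) / r"] by auto
  then show "y \<in> (\<Union>n. linf_ball x (2 ^ n * r))"
    using r by (auto simp: linf_ball_def divide_less_eq)
qed

context
  fixes \<mu> :: "(real ^ 'n) measure" and lam C_lam
  assumes borel: "sets \<mu> = sets borel" and ud: "upper_doubling \<mu> lam C_lam"
begin

lemma upper_doubling_pos: "r > 0 \<Longrightarrow> lam x r > 0"
  and upper_doubling_mono: "0 < r \<Longrightarrow> r \<le> r' \<Longrightarrow> lam x r \<le> lam x r'"
  and upper_doubling_double: "0 < r \<Longrightarrow> lam x (2 * r) \<le> C_lam * lam x r"
  and upper_doubling_ball: "0 < r \<Longrightarrow> emeasure \<mu> (linf_ball x r) \<le> ennreal (lam x r)"
  using ud unfolding upper_doubling_def by blast+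

lemma upper_doubling_const: "C_lam \<ge> 1"
proof -
  have "1 * lam 0 1 \<le> C_lam * lam 0 1"
    using upper_doubling_mono[of 1 2 0] upper_doubling_double[of 1 0] by simp
  then show ?thesis using upper_doubling_pos[of 1 0] by (simp only: mult_le_cancel_right)
qed

lemma linf_ball_in_sets: "linf_ball x r \<in> sets \<mu>"
proof -
  have "{y \<in> space borel. infnorm (x - y) < r} \<in> sets borel" by measurable
  then show ?thesis by (simp add: borel linf_ball_def)
qed

lemma reg_lam_bdd: "r > 0 \<Longrightarrow> bdd_below (range (\<lambda>z. lam z (r + infnorm (x - z))))"
  by (intro bdd_belowI[of _ 0]) (auto intro!: less_imp_le upper_doubling_pos add_pos_nonneg infnorm_pos_le)

lemma reg_lam_le: "r > 0 \<Longrightarrow> reg_lam lam x r \<le> lam x r"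
  unfolding reg_lam_def using cINF_lower[OF reg_lam_bdd, of r x x] by (simp add: infnorm_0)

lemma reg_lam_shift: 
  assumes "r > 0" shows "reg_lam lam x r \<le> reg_lam lam y (r + infnorm (x - y))"
  unfolding reg_lam_def
proof (rule cINF_mono)
  fix z
  have "infnorm (x - z) \<le> infnorm (x - y) + infnorm (y - z)"
    using infnorm_triangle[of "x-y" "y-z"] by simp
  then show "\<exists>n\<in>UNIV. lam n (r + infnorm (x - n)) \<le> lam z (r + infnorm (x - y) + infnorm (y - z))"
    by (intro bexI[of _ z] upper_doubling_mono) (use assms in \<open>auto intro: add_pos_nonneg infnorm_pos_le\<close>)
qed (use assms reg_lam_bdd in auto)

lemma reg_lam_mono: 
  assumes "r > 0" "r \<le> r'" shows "reg_lam lam x r \<le> reg_lam lam x r'"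
  unfolding reg_lam_def
proof (rule cINF_mono)
  fix z show "\<exists>n\<in>UNIV. lam n (r + infnorm (x - n)) \<le> lam z (r' + infnorm (x - z))"
    by (intro bexI[of _ z] upper_doubling_mono) (use assms in \<open>auto intro: add_pos_nonneg infnorm_pos_le\<close>)
qed (use assms reg_lam_bdd in auto)

lemma reg_lam_double:
  assumes "r > 0" shows "reg_lam lam x (2 * r) \<le> C_lam * reg_lam lam x r"
proof -
  have C: "C_lam > 0" using upper_doubling_const by linarith
  have "reg_lam lam x (2 * r) / C_lam \<le> reg_lam lam x r"
    unfolding reg_lam_def[of lam x r]
  proof (rule cINF_greatest)
    fix z
    have i: "infnorm (x - z) \<ge> 0" by (rule infnorm_pos_le)
    have "reg_lam lam x (2 * r) \<le> lam z (2 * r + infnorm (x - z))"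
      unfolding reg_lam_def using assms by (intro cINF_lower reg_lam_bdd) auto
    also have "\<dots> \<le> lam z (2 * (r + infnorm (x - z)))"
      using assms i by (intro upper_doubling_mono) auto
    also have "\<dots> \<le> C_lam * lam z (r + infnorm (x - z))"
      using assms i by (intro upper_doubling_double) auto
    finally show "reg_lam lam x (2 * r) / C_lam \<le> lam z (r + infnorm (x - z))"
      using C by (simp add: divide_le_eq mult.commute)
  qed auto
  then show ?thesis using C by (simp add: divide_le_eq mult.commute)
qed

lemma reg_lam_ball:
  assumes "r > 0" shows "emeasure \<mu> (linf_ball x r) \<le> ennreal (reg_lam lam x r)"
proof -
  have le: "emeasure \<mu> (linf_ball x r) \<le> ennreal (lam z (r + infnorm (x - z)))" for z
  proof -
    have "linf_ball x r \<subseteq> linf_ball z (r + infnorm (x - z))"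
    proof
      fix y assume "y \<in> linf_ball x r"
      moreover have "infnorm (z - y) \<le> infnorm (x - z) + infnorm (x - y)"
        using infnorm_triangle[of "z-x" "x-y"] by (simp add: infnorm_sub[of z x])
      ultimately show "y \<in> linf_ball z (r + infnorm (x - z))" by (simp add: linf_ball_def)
    qed
    then have "emeasure \<mu> (linf_ball x r) \<le> emeasure \<mu> (linf_ball z (r + infnorm (x - z)))"
      by (intro emeasure_mono linf_ball_in_sets)
    also have "\<dots> \<le> ennreal (lam z (r + infnorm (x - z)))"
      using assms infnorm_pos_le[of "x - z"] by (intro upper_doubling_ball) auto
    finally show ?thesis .
  qed
  have fin: "emeasure \<mu> (linf_ball x r) \<noteq> \<infinity>"
    using le[of x] by (auto simp: top_unique)
  then have eq: "emeasure \<mu> (linf_ball x r) = ennreal (measure \<mu> (linf_ball x r))"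
    by (simp add: emeasure_eq_ennreal_measure)
  have "measure \<mu> (linf_ball x r) \<le> reg_lam lam x r"
    unfolding reg_lam_def
  proof (rule cINF_greatest)
    fix z show "measure \<mu> (linf_ball x r) \<le> lam z (r + infnorm (x - z))"
      using le[of z] upper_doubling_pos[of "r + infnorm (x - z)" z] assms infnorm_pos_le[of "x - z"]
      unfolding eq by simp
  qed auto
  then show ?thesis unfolding eq by (rule ennreal_leI)
qed

text \<open>An infimum of positive numbers may vanish.  Here it does not: some large ball about \<open>x\<close> has positive
measure, and doubling carries the resulting lower bound down to small radii.\<close>

lemma reg_lam_pos:
  assumes ne: "emeasure \<mu> UNIV \<noteq> 0" and r: "r > 0"
  shows "reg_lam lam x r > 0"
proof -
  have "\<exists>n. emeasure \<mu> (linf_ball x (2 ^ n * r)) \<noteq> 0"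
  proof (rule ccontr)
    assume "\<nexists>n. emeasure \<mu> (linf_ball x (2 ^ n * r)) \<noteq> 0"
    then have "(\<Union>n. linf_ball x (2 ^ n * r)) \<in> null_sets \<mu>"
      by (intro null_sets_UN) (auto simp: null_sets_def linf_ball_in_sets)
    with ne UN_linf_ball[OF r, of x] show False by (auto simp: null_sets_def)
  qed
  then obtain n where n: "emeasure \<mu> (linf_ball x (2 ^ n * r)) \<noteq> 0" by blast
  have C: "C_lam > 0" using upper_doubling_const by linarith
  have "reg_lam lam x (2 ^ n * r) > 0"
    using reg_lam_ball[of "2 ^ n * r" x] n r by (cases "reg_lam lam x (2 ^ n * r) > 0") (auto simp: ennreal_neg)
  moreover have "reg_lam lam x (2 ^ n * r) \<le> C_lam ^ n * reg_lam lam x r"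
  proof (induction n)
    case (Suc n)
    have "reg_lam lam x (2 ^ Suc n * r) \<le> C_lam * reg_lam lam x (2 ^ n * r)"
      using reg_lam_double[of "2 ^ n * r" x] r by (simp add: mult.assoc)
    also have "\<dots> \<le> C_lam * (C_lam ^ n * reg_lam lam x r)"
      using Suc C by (intro mult_left_mono) auto
    finally show ?case by (simp add: mult.assoc)
  qed simp
  ultimately have "0 < C_lam ^ n * reg_lam lam x r" by linarith
  then show ?thesis using C by (simp add: zero_less_mult_iff)
qed

lemma upper_doubling_reg_lam:
  assumes ne: "emeasure \<mu> UNIV \<noteq> 0"
  shows "upper_doubling \<mu> (reg_lam lam) C_lam"
  unfolding upper_doubling_def
  using reg_lam_pos[OF ne] reg_lam_mono reg_lam_double reg_lam_ball by blast

lemma kernel_reg_lam: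
  assumes ne: "emeasure \<mu> UNIV \<noteq> 0" and k: "square_function_kernel lam \<alpha> C1 s"
  shows "square_function_kernel (reg_lam lam) \<alpha> (max 0 C1) s"
proof -
  have den: "0 < kernel_denom (reg_lam lam) \<alpha> t x y"
            "kernel_denom (reg_lam lam) \<alpha> t x y \<le> kernel_denom lam \<alpha> t x y" if "t > 0" for t x y
  proof -
    have *: "0 \<le> infnorm (x - y) powr \<alpha> * reg_lam lam x (infnorm (x - y))"
      "infnorm (x - y) powr \<alpha> * reg_lam lam x (infnorm (x - y)) \<le>
       infnorm (x - y) powr \<alpha> * lam x (infnorm (x - y))"
      using reg_lam_pos[OF ne, of "infnorm (x - y)" x] reg_lam_le[of "infnorm (x - y)" x] infnorm_pos_le[of "x - y"]
      by (cases "infnorm (x - y) = 0"; simp add: less_le mult_left_mono)+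
    show "0 < kernel_denom (reg_lam lam) \<alpha> t x y" unfolding kernel_denom_def
      using * reg_lam_pos[OF ne that, of x] that by (intro add_pos_nonneg) auto
    show "kernel_denom (reg_lam lam) \<alpha> t x y \<le> kernel_denom lam \<alpha> t x y" unfolding kernel_denom_def
      using * reg_lam_le[OF that, of x] that by (intro add_mono *(2) mult_left_mono) auto
  qed
  have le: "C1 * (p / kernel_denom lam \<alpha> t x y) \<le> max 0 C1 * (p / kernel_denom (reg_lam lam) \<alpha> t x y)"
    if "t > 0" "p \<ge> 0" for p t x y
    using den[OF that(1), of x y] that
    by (intro mult_mono divide_left_mono mult_pos_pos) auto
  show ?thesis
    using k unfolding square_function_kernel_def
    by (intro conjI allI impI) (simp, (rule order_trans[OF _ le]; simp)+)
qed

end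

text \<open>The condition \<open>comparable\<close> is what the passage to \<open>reg_lam\<close> achieves.  It makes the kernel bound
almost symmetric in \<open>x\<close> and \<open>y\<close>.\<close>

locale doubling_setting =
  fixes \<mu> :: "(real ^ 'n) measure" and lam :: "real ^ 'n \<Rightarrow> real \<Rightarrow> real" and C_lam \<alpha> :: real
  assumes borel_mu: "sets \<mu> = sets borel"
    and doubling: "upper_doubling \<mu> lam C_lam"
    and comparable: "\<And>x y r. 0 < r \<Longrightarrow> lam x r \<le> lam y (r + infnorm (x - y))"
    and alpha_pos: "\<alpha> > 0"
begin

lemmas lam_pos = upper_doubling_pos[OF borel_mu doubling]
  and lam_mono = upper_doubling_mono[OF borel_mu doubling]
  and lam_double = upper_doubling_double[OF borel_mu doubling]
  and lam_ball = upper_doubling_ball[OF borel_mu doubling]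
  and C_lam_ge_1 = upper_doubling_const[OF borel_mu doubling]
  and ball_sets = linf_ball_in_sets[OF borel_mu doubling]
  and UN_ball = UN_linf_ball

lemma space_mu [simp]: "space \<mu> = UNIV"
  using borel_mu by (metis sets_eq_imp_space_eq space_borel)

lemma measurable_mu [simp]: "measurable \<mu> N = measurable borel N"
  by (rule measurable_cong_sets) (auto simp: borel_mu)

definition K :: "real \<Rightarrow> real ^ 'n \<Rightarrow> real ^ 'n \<Rightarrow> real" where
  "K t x y = t powr \<alpha> / kernel_denom lam \<alpha> t x y"

lemma denom_ge:
  assumes "t > 0"
  shows "t powr \<alpha> * lam x t \<le> kernel_denom lam \<alpha> t x y"
    and "infnorm (x - y) powr \<alpha> * lam x (infnorm (x - y)) \<le> kernel_denom lam \<alpha> t x y"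
    and "0 < kernel_denom lam \<alpha> t x y"
proof -
  have *: "0 \<le> infnorm (x - y) powr \<alpha> * lam x (infnorm (x - y))"
    using lam_pos[of "infnorm (x - y)" x] infnorm_pos_le[of "x - y"]
    by (cases "infnorm (x - y) = 0"; simp add: less_le)
  have "0 < t powr \<alpha> * lam x t" using lam_pos[OF assms, of x] assms by simp
  with * show "t powr \<alpha> * lam x t \<le> kernel_denom lam \<alpha> t x y"
    and "infnorm (x - y) powr \<alpha> * lam x (infnorm (x - y)) \<le> kernel_denom lam \<alpha> t x y"
    and "0 < kernel_denom lam \<alpha> t x y"
    by (auto simp: kernel_denom_def)
qed

lemma K_nonneg: "t > 0 \<Longrightarrow> 0 \<le> K t x y"
  using denom_ge(3)[of t x y] by (simp add: K_def)

lemma K_le: "t > 0 \<Longrightarrow> K t x y \<le> 1 / lam x t"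
  using denom_ge(1,3)[of t x y] lam_pos[of t x] by (simp add: K_def field_simps)

text \<open>Column integrals of the kernel bound reduce to row integrals.  At distance \<open>r = \<bar>x - y\<bar>\<close> the numbers
\<open>lam x u\<close> and \<open>lam y u\<close> are comparable for \<open>u \<ge> r\<close>; if \<open>t < r\<close> the term with \<open>t\<close> is dominated by the one with \<open>r\<close>.\<close>

lemma K_sym:
  assumes t: "t > 0"
  shows "K t x y \<le> 2 * C_lam * K t y x"
proof -
  define r where "r = infnorm (x - y)"
  have r0: "r \<ge> 0" by (simp add: r_def infnorm_pos_le)
  have ryx: "infnorm (y - x) = r" by (simp add: r_def infnorm_sub)
  have C: "C_lam \<ge> 1" by (rule C_lam_ge_1)
  have D: "kernel_denom lam \<alpha> t x y > 0" "kernel_denom lam \<alpha> t y x > 0"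
    using denom_ge(3)[OF t] by auto
  have comp: "lam y u \<le> C_lam * lam x u" if "0 < u" "r \<le> u" for u
  proof -
    have "lam y u \<le> lam x (u + r)" using comparable[of u y x] that by (simp add: ryx)
    also have "\<dots> \<le> lam x (2 * u)" using that r0 by (intro lam_mono) auto
    also have "\<dots> \<le> C_lam * lam x u" using that by (intro lam_double)
    finally show ?thesis .
  qed
  have p2: "r powr \<alpha> * lam y r \<le> C_lam * kernel_denom lam \<alpha> t x y"
  proof (cases "r = 0")
    case True then show ?thesis using C D by simp
  next
    case False
    with r0 have "r > 0" by simp
    from comp[of r] this have "r powr \<alpha> * lam y r \<le> r powr \<alpha> * (C_lam * lam x r)"
      by (intro mult_left_mono) auto
    also have "\<dots> \<le> C_lam * kernel_denom lam \<alpha> t x y"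
      using denom_ge(2)[OF t, of x y] C by (simp add: r_def mult.left_commute)
    finally show ?thesis .
  qed
  have p1: "t powr \<alpha> * lam y t \<le> C_lam * kernel_denom lam \<alpha> t x y"
  proof (cases "r \<le> t")
    case True
    then have "t powr \<alpha> * lam y t \<le> t powr \<alpha> * (C_lam * lam x t)"
      using comp[of t] t by (intro mult_left_mono) auto
    also have "\<dots> \<le> C_lam * kernel_denom lam \<alpha> t x y"
      using denom_ge(1)[OF t, of x y] C by (simp add: mult.left_commute)
    finally show ?thesis .
  next
    case False
    then have "t powr \<alpha> * lam y t \<le> r powr \<alpha> * lam y r"
      using t alpha_pos lam_pos[of t y] by (intro mult_mono powr_mono2 lam_mono) auto
    with p2 show ?thesis by linarith
  qed
  have "kernel_denom lam \<alpha> t y x \<le> 2 * C_lam * kernel_denom lam \<alpha> t x y"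
    using p1 p2 by (simp add: kernel_denom_def[of lam \<alpha> t y x] ryx)
  then have "t powr \<alpha> * kernel_denom lam \<alpha> t y x \<le> t powr \<alpha> * (2 * C_lam * kernel_denom lam \<alpha> t x y)"
    by (intro mult_left_mono) auto
  then show ?thesis
    using D by (simp add: K_def field_simps)
qed

definition tail_const :: real where "tail_const = C_lam / (1 - 2 powr (- \<alpha>))"

lemma two_powr_less_1: "2 powr (- \<alpha>) < 1"
  using alpha_pos powr_less_mono[of "-\<alpha>" 0 2] by simp

lemma tail_const_pos: "tail_const > 0"
  using two_powr_less_1 C_lam_ge_1 by (simp add: tail_const_def)

lemma dyadic_shell:
  assumes "0 < \<rho>" "\<rho> \<le> (r::real)"
  obtains m :: nat where "2 ^ m * \<rho> \<le> r" "r < 2 * (2 ^ m * \<rho>)"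
proof -
  obtain n :: nat where n: "r / \<rho> < 2 ^ n" using real_arch_pow[of 2 "r / \<rho>"] by auto
  define l where "l = (LEAST n::nat. r / \<rho> < 2 ^ n)"
  have l: "r / \<rho> < 2 ^ l" unfolding l_def by (rule LeastI[of _ n]) (rule n)
  have "l \<noteq> 0" using l assms by (intro notI) (simp add: divide_less_eq)
  then obtain m where m: "l = Suc m" by (cases l) auto
  have "\<not> r / \<rho> < 2 ^ m" using not_less_Least[of m "\<lambda>n. r / \<rho> < 2 ^ n"] m by (simp add: l_def)
  with l m assms show ?thesis by (intro that[of m]) (auto simp: field_simps)
qed

text \<open>Sum over the dyadic shells \<open>2\<^sup>m \<rho> \<le> \<bar>x - y\<bar> < 2\<^bsup>m+1\<^esup> \<rho>\<close>: the measure of the ball cancels \<open>lam\<close> up to one doubling,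
and a geometric series in \<open>2\<^bsup>-\<alpha>\<^esup>\<close> remains.  Because \<open>lam\<close> may fail to be a Borel function, the bound is
stated through a Borel majorant of the kernel.\<close>

lemma K_tail_majorant:
  assumes t: "t > 0" and \<rho>: "\<rho> > 0"
  obtains G :: "real ^ 'n \<Rightarrow> ennreal" where "G \<in> borel_measurable borel"
    "\<And>y. \<rho> \<le> infnorm (x - y) \<Longrightarrow> ennreal (K t x y) \<le> G y"
    "(\<integral>\<^sup>+y. G y \<partial>\<mu>) \<le> ennreal (tail_const * (t / \<rho>) powr \<alpha>)"
proof
  define w where "w m = t powr \<alpha> / ((2 ^ m * \<rho>) powr \<alpha> * lam x (2 ^ m * \<rho>))" for m :: nat
  let ?B = "\<lambda>m. linf_ball x (2 * (2 ^ m * \<rho>))"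
  let ?G = "\<lambda>y. \<Sum>m. ennreal (w m) * indicator (?B m) y"
  have w0: "w m \<ge> 0" for m using \<rho> lam_pos[of "2 ^ m * \<rho>" x] by (simp add: w_def)
  have [measurable]: "?B m \<in> sets borel" for m using ball_sets borel_mu by auto
  show "?G \<in> borel_measurable borel" by measurable
  show "ennreal (K t x y) \<le> ?G y" if True: "\<rho> \<le> infnorm (x - y)" for y
  proof -
    obtain m where m: "2 ^ m * \<rho> \<le> infnorm (x - y)" "infnorm (x - y) < 2 * (2 ^ m * \<rho>)"
      using dyadic_shell[OF \<rho> True] by blast
    have pos: "0 < 2 ^ m * \<rho>" using \<rho> by simp
    have "(2 ^ m * \<rho>) powr \<alpha> * lam x (2 ^ m * \<rho>) \<le> infnorm (x - y) powr \<alpha> * lam x (infnorm (x - y))"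
      using m pos alpha_pos lam_pos[OF pos, of x] by (intro mult_mono powr_mono2 lam_mono) auto
    also have "\<dots> \<le> kernel_denom lam \<alpha> t x y" by (rule denom_ge[OF t])
    finally have "K t x y \<le> w m"
      unfolding K_def w_def using pos lam_pos[OF pos, of x] denom_ge(3)[OF t, of x y]
      by (intro divide_left_mono mult_pos_pos) auto
    then have "ennreal (K t x y) \<le> ennreal (w m) * indicator (?B m) y"
      using m by (simp add: linf_ball_def ennreal_leI)
    also have "\<dots> \<le> ?G y"
      using sum_le_suminf[OF summableI, of "{m}" "\<lambda>m. ennreal (w m) * indicator (?B m) y"]
      by (simp del: sum_mult_indicator)
    finally show ?thesis .
  qed
  have "(\<integral>\<^sup>+y. ?G y \<partial>\<mu>) = (\<Sum>m. ennreal (w m) * emeasure \<mu> (?B m))"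
    using ball_sets by (subst nn_integral_suminf) (auto simp: nn_integral_cmult_indicator simp del: measurable_mu)
  also have "\<dots> \<le> (\<Sum>m. ennreal (C_lam * (t / \<rho>) powr \<alpha> * (2 powr (- \<alpha>)) ^ m))"
  proof (rule suminf_le)
    fix m :: nat
    have pos: "0 < 2 ^ m * \<rho>" using \<rho> by simp
    have "ennreal (w m) * emeasure \<mu> (?B m) \<le> ennreal (w m) * ennreal (C_lam * lam x (2 ^ m * \<rho>))"
      using lam_ball[of "2 * (2 ^ m * \<rho>)" x] lam_double[OF pos, of x] pos
      by (intro mult_left_mono order_trans[OF lam_ball] ennreal_leI) auto
    also have "\<dots> = ennreal (w m * (C_lam * lam x (2 ^ m * \<rho>)))"
      by (rule ennreal_mult'[symmetric]) (use w0 in auto)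
    also have "w m * (C_lam * lam x (2 ^ m * \<rho>)) = C_lam * (t / \<rho>) powr \<alpha> * (2 powr (- \<alpha>)) ^ m"
    proof -
      have "(2 ^ m) powr \<alpha> = (2 powr real m) powr \<alpha>" by (simp only: powr_realpow)
      also have "\<dots> = (2 powr \<alpha>) powr real m" by (simp only: powr_powr mult.commute)
      also have "\<dots> = (2 powr \<alpha>) ^ m" by (rule powr_realpow) simp
      finally have "(2 ^ m * \<rho>) powr \<alpha> = (2 powr \<alpha>) ^ m * \<rho> powr \<alpha>"
        using \<rho> by (simp add: powr_mult)
      then have "w m = (t / \<rho>) powr \<alpha> * (2 powr (- \<alpha>)) ^ m / lam x (2 ^ m * \<rho>)"
        using \<rho> t by (simp add: w_def powr_divide powr_minus power_inverse) (simp add: field_simps)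
      then show ?thesis using lam_pos[OF pos, of x] by simp
    qed
    finally show "ennreal (w m) * emeasure \<mu> (?B m) \<le> ennreal (C_lam * (t / \<rho>) powr \<alpha> * (2 powr (- \<alpha>)) ^ m)" .
  qed auto
  also have "\<dots> = ennreal (C_lam * (t / \<rho>) powr \<alpha> * (1 / (1 - 2 powr (- \<alpha>))))"
    using C_lam_ge_1 two_powr_less_1
    by (intro suminf_ennreal_eq sums_mult geometric_sums) auto
  also have "\<dots> = ennreal (tail_const * (t / \<rho>) powr \<alpha>)"
    by (simp add: tail_const_def)
  finally show "(\<integral>\<^sup>+y. ?G y \<partial>\<mu>) \<le> ennreal (tail_const * (t / \<rho>) powr \<alpha>)" .
qed

lemma K_tail_integral_le:
  assumes t: "t > 0" and \<rho>: "\<rho> > 0" and D: "D \<ge> 0"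
    and \<kappa>: "\<And>y. \<kappa> y \<le> ennreal (D * K t x y) * indicator {y. \<rho> \<le> infnorm (x - y)} y"
  shows "(\<integral>\<^sup>+y. \<kappa> y \<partial>\<mu>) \<le> ennreal (D * (tail_const * (t / \<rho>) powr \<alpha>))"
proof -
  obtain G where [measurable]: "G \<in> borel_measurable borel"
    and G: "\<And>y. \<rho> \<le> infnorm (x - y) \<Longrightarrow> ennreal (K t x y) \<le> G y"
      "(\<integral>\<^sup>+y. G y \<partial>\<mu>) \<le> ennreal (tail_const * (t / \<rho>) powr \<alpha>)"
    using K_tail_majorant[OF t \<rho>] by metis
  have "(\<integral>\<^sup>+y. \<kappa> y \<partial>\<mu>) \<le> (\<integral>\<^sup>+y. ennreal D * G y \<partial>\<mu>)"
  proof (rule nn_integral_mono)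
    fix y
    show "\<kappa> y \<le> ennreal D * G y"
    proof (cases "\<rho> \<le> infnorm (x - y)")
      case True
      then have "\<kappa> y \<le> ennreal D * ennreal (K t x y)"
        using \<kappa>[of y] D K_nonneg[OF t, of x y] by (simp add: ennreal_mult)
      also have "\<dots> \<le> ennreal D * G y" by (intro mult_left_mono G True) auto
      finally show ?thesis .
    qed (use \<kappa>[of y] in simp)
  qed
  also have "\<dots> = ennreal D * (\<integral>\<^sup>+y. G y \<partial>\<mu>)" by (rule nn_integral_cmult) simp
  also have "\<dots> \<le> ennreal D * ennreal (tail_const * (t / \<rho>) powr \<alpha>)"
    by (intro mult_left_mono G) auto
  finally show ?thesis using D tail_const_pos by (simp add: ennreal_mult)
qed

lemma K_integral_le:
  assumes t: "t > 0" and D: "D \<ge> 0"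
    and \<kappa>: "\<And>y. \<kappa> y \<le> ennreal (D * K t x y)"
  shows "(\<integral>\<^sup>+y. \<kappa> y \<partial>\<mu>) \<le> ennreal (D * (1 + tail_const))"
proof -
  obtain G where [measurable]: "G \<in> borel_measurable borel"
    and G: "\<And>y. t \<le> infnorm (x - y) \<Longrightarrow> ennreal (K t x y) \<le> G y"
           "(\<integral>\<^sup>+y. G y \<partial>\<mu>) \<le> ennreal (tail_const * (t / t) powr \<alpha>)"
    using K_tail_majorant[OF t t] by metis
  have [measurable]: "linf_ball x t \<in> sets borel" using ball_sets borel_mu by auto
  have "(\<integral>\<^sup>+y. \<kappa> y \<partial>\<mu>) \<le>
    (\<integral>\<^sup>+y. ennreal D * (ennreal (1 / lam x t) * indicator (linf_ball x t) y + G y) \<partial>\<mu>)"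
  proof (rule nn_integral_mono)
    fix y
    have "\<kappa> y \<le> ennreal D * ennreal (K t x y)"
      using \<kappa>[of y] D K_nonneg[OF t, of x y] by (simp add: ennreal_mult)
    also have "\<dots> \<le> ennreal D * (ennreal (1 / lam x t) * indicator (linf_ball x t) y + G y)"
      using G(1)[of y] ennreal_leI[OF K_le[OF t, of x y]]
      by (intro mult_left_mono, cases "infnorm (x - y) < t") (auto simp: linf_ball_def intro: add_increasing2)
    finally show "\<kappa> y \<le> ennreal D * (ennreal (1 / lam x t) * indicator (linf_ball x t) y + G y)" .
  qed
  also have "\<dots> = ennreal D * (ennreal (1 / lam x t) * emeasure \<mu> (linf_ball x t) + (\<integral>\<^sup>+y. G y \<partial>\<mu>))"
    using ball_sets by (simp add: nn_integral_cmult nn_integral_add nn_integral_cmult_indicator)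
  also have "\<dots> \<le> ennreal D * (ennreal (1 / lam x t) * ennreal (lam x t) + ennreal tail_const)"
    using G(2) t by (intro add_mono mult_left_mono lam_ball) auto
  also have "\<dots> = ennreal (D * (1 + tail_const))"
    using lam_pos[OF t, of x] tail_const_pos D by (simp add: ennreal_mult'[symmetric] less_imp_le ennreal_mult)
  finally show ?thesis .
qed

text \<open>This lemma and \<open>marginals_far\<close> supply the hypotheses of Schur's test.  They are stated for an arbitrary
function below the kernel bound, since the functions that are integrated later are built from \<open>s\<close> itself and are
measurable, while \<open>K\<close> need not be.\<close>

lemma marginals_near:
  assumes t: "t > 0" and D: "D \<ge> 0" and \<kappa>: "\<And>x y. \<kappa> x y \<le> ennreal (D * K t x y)"
  shows "(\<integral>\<^sup>+y. \<kappa> x y \<partial>\<mu>) \<le> ennreal (2 * C_lam * (1 + tail_const) * D)"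
    and "(\<integral>\<^sup>+x. \<kappa> x y \<partial>\<mu>) \<le> ennreal (2 * C_lam * (1 + tail_const) * D)"
proof -
  have *: "\<kappa> x y \<le> ennreal (2 * C_lam * D * K t x y)" for x y
  proof -
    have "1 * (D * K t x y) \<le> 2 * C_lam * (D * K t x y)"
      using C_lam_ge_1 D K_nonneg[OF t, of x y] by (intro mult_right_mono) auto
    with \<kappa>[of x y] show ?thesis by (auto simp: mult.assoc intro: order_trans ennreal_leI)
  qed
  show "(\<integral>\<^sup>+y. \<kappa> x y \<partial>\<mu>) \<le> ennreal (2 * C_lam * (1 + tail_const) * D)"
    using K_integral_le[OF t _ *[of x]] D C_lam_ge_1 by (simp add: mult_ac)
  have **: "\<kappa> x y \<le> ennreal (2 * C_lam * D * K t y x)" for x y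
  proof -
    have "D * K t x y \<le> D * (2 * C_lam * K t y x)" using K_sym[OF t] D by (intro mult_left_mono) auto
    with \<kappa>[of x y] show ?thesis by (auto simp: mult_ac intro: order_trans ennreal_leI)
  qed
  show "(\<integral>\<^sup>+x. \<kappa> x y \<partial>\<mu>) \<le> ennreal (2 * C_lam * (1 + tail_const) * D)"
    using K_integral_le[OF t _ **[of _ y]] D C_lam_ge_1 by (simp add: mult_ac)
qed

lemma marginals_far:
  assumes t: "t > 0" and \<rho>: "\<rho> > 0" and D: "D \<ge> 0"
    and \<kappa>: "\<And>x y. \<kappa> x y \<le> ennreal (D * K t x y) * indicator {y. \<rho> \<le> infnorm (x - y)} y"
  shows "(\<integral>\<^sup>+y. \<kappa> x y \<partial>\<mu>) \<le> ennreal (2 * C_lam * (1 + tail_const) * D * (t / \<rho>) powr \<alpha>)"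
    and "(\<integral>\<^sup>+x. \<kappa> x y \<partial>\<mu>) \<le> ennreal (2 * C_lam * (1 + tail_const) * D * (t / \<rho>) powr \<alpha>)"
proof -
  have const: "ennreal (2 * C_lam * D * (tail_const * (t / \<rho>) powr \<alpha>))
      \<le> ennreal (2 * C_lam * (1 + tail_const) * D * (t / \<rho>) powr \<alpha>)"
  proof (rule ennreal_leI)
    have "(2 * C_lam * D * (t / \<rho>) powr \<alpha>) * tail_const \<le> (2 * C_lam * D * (t / \<rho>) powr \<alpha>) * (1 + tail_const)"
      using C_lam_ge_1 D by (intro mult_left_mono) auto
    then show "2 * C_lam * D * (tail_const * (t / \<rho>) powr \<alpha>) \<le> 2 * C_lam * (1 + tail_const) * D * (t / \<rho>) powr \<alpha>"
      by (simp only: mult_ac)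
  qed
  have nonneg: "0 \<le> 2 * C_lam * D" using D C_lam_ge_1 by simp
  have *: "\<kappa> x y \<le> ennreal (2 * C_lam * D * K t x y) * indicator {y. \<rho> \<le> infnorm (x - y)} y" for x y
  proof -
    have "1 * (D * K t x y) \<le> 2 * C_lam * (D * K t x y)"
      using C_lam_ge_1 D K_nonneg[OF t, of x y] by (intro mult_right_mono) auto
    then have "ennreal (D * K t x y) \<le> ennreal (2 * C_lam * D * K t x y)"
      by (intro ennreal_leI) (simp add: mult.assoc)
    then show ?thesis by (rule order_trans[OF \<kappa> mult_right_mono]) simp
  qed
  show "(\<integral>\<^sup>+y. \<kappa> x y \<partial>\<mu>) \<le> ennreal (2 * C_lam * (1 + tail_const) * D * (t / \<rho>) powr \<alpha>)"
    using K_tail_integral_le[OF t \<rho> nonneg *] const by (rule order_trans)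
  have **: "\<kappa> x y \<le> ennreal (2 * C_lam * D * K t y x) * indicator {x. \<rho> \<le> infnorm (y - x)} x" for x y
  proof -
    have "D * K t x y \<le> D * (2 * C_lam * K t y x)" using K_sym[OF t] D by (intro mult_left_mono) auto
    then have "ennreal (D * K t x y) \<le> ennreal (2 * C_lam * D * K t y x)"
      by (intro ennreal_leI) (simp add: mult_ac)
    then have "\<kappa> x y \<le> ennreal (2 * C_lam * D * K t y x) * indicator {y. \<rho> \<le> infnorm (x - y)} y"
      by (rule order_trans[OF \<kappa> mult_right_mono]) simp
    then show ?thesis by (simp add: indicator_def infnorm_sub[of x y])
  qed
  show "(\<integral>\<^sup>+x. \<kappa> x y \<partial>\<mu>) \<le> ennreal (2 * C_lam * (1 + tail_const) * D * (t / \<rho>) powr \<alpha>)"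
    using K_tail_integral_le[OF t \<rho> nonneg **] const by (rule order_trans)
qed

lemma sigma_finite: "sigma_finite_measure \<mu>"
proof
  show "\<exists>A. countable A \<and> A \<subseteq> sets \<mu> \<and> \<Union> A = space \<mu> \<and> (\<forall>a\<in>A. emeasure \<mu> a \<noteq> \<infinity>)"
  proof (intro exI conjI ballI)
    show "countable (range (\<lambda>n. linf_ball 0 (2 ^ n * 1)))" by simp
    show "range (\<lambda>n. linf_ball 0 (2 ^ n * 1)) \<subseteq> sets \<mu>" using ball_sets by auto
    show "\<Union> (range (\<lambda>n. linf_ball 0 (2 ^ n * 1))) = space \<mu>" using UN_ball[of 1 0] by simp
    fix a assume "a \<in> range (\<lambda>n. linf_ball 0 (2 ^ n * 1) :: (real ^ 'n) set)"
    then obtain n where "a = linf_ball 0 (2 ^ n * 1)" by blast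
    then show "emeasure \<mu> a \<noteq> \<infinity>" using lam_ball[of "2 ^ n * 1" 0] by (auto simp: top_unique)
  qed
qed

end

section \<open>Martingale estimates on a tree of cells\<close>

lemma square_sum_le: "(a + b)\<^sup>2 \<le> 2 * a\<^sup>2 + 2 * (b\<^sup>2 :: real)"
  using sum_squares_bound[of a b] by (simp add: power2_sum)

lemma quotient_diff:
  fixes e e' p q :: complex
  assumes "p \<noteq> 0" "q \<noteq> 0"
  shows "e / p - e' / q = (e - e') / p - e' * (p - q) / (p * q)"
  using assms by (simp add: divide_simps) (simp add: algebra_simps)

text \<open>The quotient \<open>u\<^sup>2 / y\<close> is convex and homogeneous of degree one, hence subadditive.\<close>

lemma sum_square_div_le:
  fixes u y :: "'c \<Rightarrow> real"
  assumes "finite A" "\<And>v. v \<in> A \<Longrightarrow> y v \<ge> 0" "\<And>v. v \<in> A \<Longrightarrow> y v = 0 \<Longrightarrow> u v = 0"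
  shows "(\<Sum>v\<in>A. u v)\<^sup>2 / (\<Sum>v\<in>A. y v) \<le> (\<Sum>v\<in>A. (u v)\<^sup>2 / y v)"
proof (cases "(\<Sum>v\<in>A. y v) = 0")
  case True
  then show ?thesis using assms by (auto intro!: sum_nonneg)
next
  case False
  then have pos: "(\<Sum>v\<in>A. y v) > 0" using assms(2) by (simp add: sum_nonneg less_le)
  have "(\<Sum>v\<in>A. u v) = (\<Sum>v\<in>A. u v / sqrt (y v) * sqrt (y v))"
    using assms by (intro sum.cong) auto
  then have "(\<Sum>v\<in>A. u v)\<^sup>2 \<le> (\<Sum>v\<in>A. (u v / sqrt (y v))\<^sup>2) * (\<Sum>v\<in>A. (sqrt (y v))\<^sup>2)"
    using Cauchy_Schwarz_ineq_sum[of "\<lambda>v. u v / sqrt (y v)" "\<lambda>v. sqrt (y v)" A] by simp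
  also have "\<dots> = (\<Sum>v\<in>A. (u v)\<^sup>2 / y v) * (\<Sum>v\<in>A. y v)"
    using assms(2) by (simp add: power_divide)
  finally show ?thesis using pos by (simp add: divide_le_eq)
qed

text \<open>The infinitesimal form of this inequality is that the Bellman function \<open>- u\<^sup>2 / (m + S)\<close> grows in \<open>S\<close> at
rate \<open>u\<^sup>2 / (m + S)\<^sup>2\<close>, which is at least \<open>u\<^sup>2 / (4 m\<^sup>2)\<close> as long as \<open>S \<le> m\<close>.\<close>

lemma carleson_bellman_step:
  fixes m C S u :: real
  assumes "m > 0" "C \<ge> 0" "S \<ge> 0" "S + C \<le> m"
  shows "C * (u / m)\<^sup>2 + 4 * u\<^sup>2 / (m + (S + C)) \<le> 4 * u\<^sup>2 / (m + S)"
proof -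
  have pos: "m + S > 0" "m + (S + C) > 0" using assms by auto
  have "(m + S) * (m + (S + C)) \<le> (2 * m) * (2 * m)"
    using assms by (intro mult_mono) auto
  then have "4 / ((2 * m) * (2 * m)) \<le> 4 / ((m + S) * (m + (S + C)))"
    using assms pos by (intro divide_left_mono mult_pos_pos) auto
  then have "1 / (m * m) \<le> 4 / ((m + S) * (m + (S + C)))" by simp
  then have "C * u\<^sup>2 * (1 / (m * m)) \<le> C * u\<^sup>2 * (4 / ((m + S) * (m + (S + C))))"
    using assms by (intro mult_left_mono) auto
  also have "\<dots> = 4 * u\<^sup>2 / (m + S) - 4 * u\<^sup>2 / (m + (S + C))"
    using pos by (simp add: divide_simps) algebra
  finally show ?thesis by (simp add: power2_eq_square)
qed

text \<open>Generation \<open>0\<close> is the finest.  The index of the cell of generation \<open>j + 1\<close> around \<open>x\<close> is computed by \<open>par\<close>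
from the index in generation \<open>j\<close>, so that every cell is a finite disjoint union of cells one generation
below.\<close>

locale cell_tree =
  fixes \<mu> :: "'a measure" and idx :: "nat \<Rightarrow> 'a \<Rightarrow> 'i::countable" and par :: "'i \<Rightarrow> 'i"
  assumes space_UNIV: "space \<mu> = UNIV"
    and cell_sets: "\<And>j v. {x. idx j x = v} \<in> sets \<mu>"
    and cell_finite: "\<And>j v. emeasure \<mu> {x. idx j x = v} < \<infinity>"
    and idx_Suc: "\<And>j x. idx (Suc j) x = par (idx j x)"
    and finite_children: "\<And>p. finite {v. par v = p}"
begin

definition cell :: "nat \<Rightarrow> 'i \<Rightarrow> 'a set" where "cell j v = {x. idx j x = v}"
definition mass :: "nat \<Rightarrow> 'i \<Rightarrow> real" where "mass j v = measure \<mu> (cell j v)"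
definition cint :: "nat \<Rightarrow> ('a \<Rightarrow> 'b::euclidean_space) \<Rightarrow> 'i \<Rightarrow> 'b" where
  "cint j f v = (LINT x:cell j v|\<mu>. f x)"

text \<open>Averages over null cells are \<open>0\<close> by the convention for division by zero.  This agrees with the
integrals, which vanish there.\<close>

definition cavg :: "nat \<Rightarrow> ('a \<Rightarrow> 'b::euclidean_space) \<Rightarrow> 'i \<Rightarrow> 'b" where
  "cavg j f v = cint j f v /\<^sub>R mass j v"
definition local_L2 :: "('a \<Rightarrow> 'b::euclidean_space) \<Rightarrow> bool" where
  "local_L2 f \<longleftrightarrow> f \<in> borel_measurable \<mu> \<and>
     (\<forall>j v. (\<integral>\<^sup>+x\<in>cell j v. sqnorm (f x) \<partial>\<mu>) < \<infinity>)"

lemma cell_in_sets [measurable, simp]: "cell j v \<in> sets \<mu>"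
  using cell_sets by (simp add: cell_def)

lemma emeasure_cell: "emeasure \<mu> (cell j v) = ennreal (mass j v)"
  using cell_finite[of j v] by (simp add: cell_def mass_def emeasure_eq_ennreal_measure)

lemma mass_nonneg [simp]: "mass j v \<ge> 0" by (simp add: mass_def)

lemma idx_measurable: "idx j \<in> \<mu> \<rightarrow>\<^sub>M count_space UNIV"
proof (subst measurable_count_space_eq_countable[OF countableI_type], intro conjI ballI)
  fix v show "idx j -` {v} \<inter> space \<mu> \<in> sets \<mu>"
    using cell_sets[of j v] by (simp add: space_UNIV vimage_def)
qed auto

lemma idx_compose_measurable [measurable (raw)]: "(\<lambda>x. A (idx j x)) \<in> borel_measurable \<mu>"
  by (rule measurable_compose[OF idx_measurable]) simp

lemma indicator_cell_Suc:
  "(indicator (cell (Suc j) p) x :: 'c::semiring_1) = (\<Sum>v\<in>{v. par v = p}. indicator (cell j v) x)"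
  using finite_children[of p]
  by (auto simp: indicator_def cell_def idx_Suc sum.delta' if_distrib cong: if_cong)

lemma cell_Suc: "cell (Suc j) p = (\<Union>v\<in>{v. par v = p}. cell j v)"
  by (auto simp: cell_def idx_Suc)

lemma nn_integral_cell_Suc:
  assumes [measurable]: "g \<in> borel_measurable \<mu>"
  shows "(\<integral>\<^sup>+x\<in>cell (Suc j) p. g x \<partial>\<mu>) = (\<Sum>v\<in>{v. par v = p}. \<integral>\<^sup>+x\<in>cell j v. g x \<partial>\<mu>)"
  by (simp add: indicator_cell_Suc sum_distrib_left nn_integral_sum)

lemma mass_Suc: "mass (Suc j) p = (\<Sum>v\<in>{v. par v = p}. mass j v)"
proof -
  have "ennreal (mass (Suc j) p) = (\<Sum>v\<in>{v. par v = p}. ennreal (mass j v))"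
    using nn_integral_cell_Suc[of "\<lambda>_. 1" j p] by (simp add: emeasure_cell)
  also have "\<dots> = ennreal (\<Sum>v\<in>{v. par v = p}. mass j v)" by (simp add: sum_ennreal)
  finally show ?thesis by (simp add: sum_nonneg)
qed

lemma nn_integral_norm_cell_sq:
  assumes [measurable]: "f \<in> borel_measurable \<mu>"
  shows "(\<integral>\<^sup>+x\<in>cell j v. ennreal (norm (f x)) \<partial>\<mu>)\<^sup>2
    \<le> ennreal (mass j v) * (\<integral>\<^sup>+x\<in>cell j v. sqnorm (f x) \<partial>\<mu>)"
proof -
  have [simp]: "(indicator (cell j v) x :: ennreal)\<^sup>2 = indicator (cell j v) x" for x
    by (simp add: indicator_def)
  have "(\<integral>\<^sup>+x\<in>cell j v. ennreal (norm (f x)) \<partial>\<mu>)\<^sup>2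
    = (\<integral>\<^sup>+x. (ennreal (norm (f x)) * indicator (cell j v) x) * indicator (cell j v) x \<partial>\<mu>)\<^sup>2"
    by (simp add: mult.assoc power2_eq_square[symmetric])
  also have "\<dots> \<le> (\<integral>\<^sup>+x. (ennreal (norm (f x)) * indicator (cell j v) x)\<^sup>2 \<partial>\<mu>) *
      (\<integral>\<^sup>+x. (indicator (cell j v) x)\<^sup>2 \<partial>\<mu>)"
    by (intro Cauchy_Schwarz_nn_integral) measurable
  finally show ?thesis
    by (simp add: power_mult_distrib emeasure_cell ennreal_power mult.commute)
qed

lemma set_integrable_cell:
  fixes f :: "'a \<Rightarrow> 'b::euclidean_space"
  assumes "local_L2 f"
  shows "set_integrable \<mu> (cell j v) f"
proof -
  have [measurable]: "f \<in> borel_measurable \<mu>" using assms by (simp add: local_L2_def)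
  have "ennreal (mass j v) * (\<integral>\<^sup>+x\<in>cell j v. sqnorm (f x) \<partial>\<mu>) < \<infinity>"
    using assms by (simp add: local_L2_def ennreal_mult_less_top)
  then have "(\<integral>\<^sup>+x\<in>cell j v. ennreal (norm (f x)) \<partial>\<mu>)\<^sup>2 < \<infinity>"
    using nn_integral_norm_cell_sq[of f j v] by (simp add: order_le_less_trans)
  then have "(\<integral>\<^sup>+x\<in>cell j v. ennreal (norm (f x)) \<partial>\<mu>) < \<infinity>"
    by (auto simp: power2_eq_square ennreal_mult_less_top top_unique less_top)
  moreover have "(\<integral>\<^sup>+x. ennreal (norm (indicator (cell j v) x *\<^sub>R f x)) \<partial>\<mu>) = (\<integral>\<^sup>+x\<in>cell j v. ennreal (norm (f x)) \<partial>\<mu>)"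
    by (intro nn_integral_cong) (simp add: indicator_def)
  ultimately show ?thesis
    unfolding set_integrable_def by (intro integrableI_bounded) auto
qed

lemma norm_cint_le:
  fixes f :: "'a \<Rightarrow> 'b::euclidean_space"
  assumes "local_L2 f"
  shows "ennreal (norm (cint j f v)) \<le> (\<integral>\<^sup>+x\<in>cell j v. ennreal (norm (f x)) \<partial>\<mu>)"
proof -
  have "ennreal (norm (cint j f v)) \<le> (\<integral>\<^sup>+x. ennreal (norm (indicator (cell j v) x *\<^sub>R f x)) \<partial>\<mu>)"
    unfolding cint_def set_lebesgue_integral_def
    by (intro integral_norm_bound_ennreal set_integrable_cell[OF assms, unfolded set_integrable_def])
  also have "\<dots> = (\<integral>\<^sup>+x\<in>cell j v. ennreal (norm (f x)) \<partial>\<mu>)"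
    by (intro nn_integral_cong) (simp add: indicator_def)
  finally show ?thesis .
qed

lemma cint_sq_le:
  fixes f :: "'a \<Rightarrow> 'b::euclidean_space"
  assumes "local_L2 f"
  shows "sqnorm (cint j f v) \<le> ennreal (mass j v) * (\<integral>\<^sup>+x\<in>cell j v. sqnorm (f x) \<partial>\<mu>)"
proof -
  have "sqnorm (cint j f v) \<le> (\<integral>\<^sup>+x\<in>cell j v. ennreal (norm (f x)) \<partial>\<mu>)\<^sup>2"
    using power_mono[OF norm_cint_le[OF assms, of j v], of 2] by (simp add: ennreal_power)
  also have "\<dots> \<le> ennreal (mass j v) * (\<integral>\<^sup>+x\<in>cell j v. sqnorm (f x) \<partial>\<mu>)"
    using assms by (intro nn_integral_norm_cell_sq) (simp add: local_L2_def)
  finally show ?thesis .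
qed

lemma cint_null: "local_L2 f \<Longrightarrow> mass j v = 0 \<Longrightarrow> cint j f v = 0"
  using cint_sq_le[of f j v] by simp

lemma mass_cavg: "local_L2 f \<Longrightarrow> mass j v *\<^sub>R cavg j f v = cint j f v"
  using cint_null[of f j v] by (cases "mass j v = 0") (auto simp: cavg_def)

lemma cint_Suc:
  assumes "local_L2 f"
  shows "cint (Suc j) f p = (\<Sum>v\<in>{v. par v = p}. cint j f v)"
  unfolding cint_def cell_Suc
  by (rule set_integral_finite_Union)
     (auto simp: finite_children disjoint_family_on_def set_integrable_cell[OF assms], auto simp: cell_def)

lemma mass_cavg_sq_le:
  fixes f :: "'a \<Rightarrow> 'b::euclidean_space"
  assumes "local_L2 f"
  shows "ennreal (mass j v * (norm (cavg j f v))\<^sup>2) \<le> (\<integral>\<^sup>+x\<in>cell j v. sqnorm (f x) \<partial>\<mu>)"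
proof (cases "mass j v = 0")
  case False
  define F where "F = (\<integral>\<^sup>+x\<in>cell j v. sqnorm (f x) \<partial>\<mu>)"
  have m: "mass j v > 0" using False mass_nonneg[of j v] by linarith
  have "F < \<infinity>" using assms unfolding local_L2_def F_def by blast
  then obtain r where r: "F = ennreal r" "r \<ge> 0" by (cases F) auto
  have "(norm (cint j f v))\<^sup>2 \<le> mass j v * r"
    using cint_sq_le[OF assms, of j v] r by (simp add: F_def ennreal_mult[symmetric])
  then have "mass j v * (norm (cavg j f v))\<^sup>2 \<le> r"
    using m by (simp add: cavg_def power_mult_distrib power2_eq_square field_simps)
  then show ?thesis using r by (simp add: F_def)
qed simp

text \<open>Pythagoras on one cell: the averages over the children split into their mean and their deviations
from it.\<close>

lemma cavg_pythagoras:
  fixes f :: "'a \<Rightarrow> 'b::euclidean_space"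
  assumes f: "local_L2 f"
  shows "(\<Sum>v\<in>{v. par v = p}. mass j v * (norm (cavg j f v - cavg (Suc j) f p))\<^sup>2)
       + mass (Suc j) p * (norm (cavg (Suc j) f p))\<^sup>2 = (\<Sum>v\<in>{v. par v = p}. mass j v * (norm (cavg j f v))\<^sup>2)"
proof -
  let ?e = "cavg (Suc j) f p"
  let ?S = "{v. par v = p}"
  have sum_e: "(\<Sum>v\<in>?S. mass j v *\<^sub>R cavg j f v) = mass (Suc j) p *\<^sub>R ?e"
    by (simp add: mass_cavg[OF f] cint_Suc[OF f])
  have "(\<Sum>v\<in>?S. mass j v * (norm (cavg j f v - ?e))\<^sup>2)
      = (\<Sum>v\<in>?S. mass j v * (norm (cavg j f v))\<^sup>2 - 2 * ((mass j v *\<^sub>R cavg j f v) \<bullet> ?e) + mass j v * (norm ?e)\<^sup>2)"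
    by (intro sum.cong refl)
       (simp add: power2_norm_eq_inner inner_diff_left inner_diff_right inner_commute algebra_simps)
  also have "\<dots> = (\<Sum>v\<in>?S. mass j v * (norm (cavg j f v))\<^sup>2) - 2 * ((\<Sum>v\<in>?S. mass j v *\<^sub>R cavg j f v) \<bullet> ?e)
      + (\<Sum>v\<in>?S. mass j v) * (norm ?e)\<^sup>2"
    by (simp add: sum.distrib sum_subtractf sum_distrib_left sum_distrib_right inner_sum_left)
  also have "\<dots> = (\<Sum>v\<in>?S. mass j v * (norm (cavg j f v))\<^sup>2) - mass (Suc j) p * (norm ?e)\<^sup>2"
    unfolding sum_e mass_Suc[symmetric] by (simp add: power2_norm_eq_inner)
  finally show ?thesis by simp
qed

lemma nn_integral_cell_const:
  "(\<integral>\<^sup>+x\<in>cell j v. ennreal (g (idx j x)) \<partial>\<mu>) = ennreal (g v) * ennreal (mass j v)"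
proof -
  have "(\<integral>\<^sup>+x\<in>cell j v. ennreal (g (idx j x)) \<partial>\<mu>) = (\<integral>\<^sup>+x. ennreal (g v) * indicator (cell j v) x \<partial>\<mu>)"
    by (intro nn_integral_cong) (simp add: indicator_def cell_def)
  then show ?thesis by (simp add: nn_integral_cmult_indicator emeasure_cell)
qed

text \<open>The energy identity \<open>cavg_pythagoras\<close> telescopes from the cell down to generation \<open>0\<close>, where the
Cauchy--Schwarz inequality bounds the averages.\<close>

lemma martingale_square_function:
  fixes f :: "'a \<Rightarrow> 'b::euclidean_space"
  assumes f: "local_L2 f"
  shows "(\<integral>\<^sup>+x\<in>cell m p. (\<Sum>j<m. sqnorm (cavg j f (idx j x) - cavg (Suc j) f (idx (Suc j) x))) \<partial>\<mu>)
       + ennreal (mass m p * (norm (cavg m f p))\<^sup>2) \<le> (\<integral>\<^sup>+x\<in>cell m p. sqnorm (f x) \<partial>\<mu>)"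
proof (induction m arbitrary: p)
  case 0
  show ?case using mass_cavg_sq_le[OF f] by simp
next
  case (Suc m)
  have [measurable]: "f \<in> borel_measurable \<mu>" using f by (simp add: local_L2_def)
  let ?D = "\<lambda>j x. sqnorm (cavg j f (idx j x) - cavg (Suc j) f (idx (Suc j) x))"
  let ?S = "{v. par v = p}"
  have "(\<integral>\<^sup>+x\<in>cell (Suc m) p. (\<Sum>j<Suc m. ?D j x) \<partial>\<mu>)
     = (\<Sum>v\<in>?S. (\<integral>\<^sup>+x\<in>cell m v. (\<Sum>j<m. ?D j x) \<partial>\<mu>) + (\<integral>\<^sup>+x\<in>cell m v. ?D m x \<partial>\<mu>))"
    by (subst nn_integral_cell_Suc)
       (auto simp: distrib_right nn_integral_add intro!: sum.cong)
  also have "\<dots> = (\<Sum>v\<in>?S. (\<integral>\<^sup>+x\<in>cell m v. (\<Sum>j<m. ?D j x) \<partial>\<mu>)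
       + ennreal (mass m v * (norm (cavg m f v - cavg (Suc m) f p))\<^sup>2))"
  proof (intro sum.cong refl arg_cong2[where f="(+)"])
    fix v assume "v \<in> ?S"
    then show "(\<integral>\<^sup>+x\<in>cell m v. ?D m x \<partial>\<mu>) = ennreal (mass m v * (norm (cavg m f v - cavg (Suc m) f p))\<^sup>2)"
      using nn_integral_cell_const[where j = m and v = v and g = "\<lambda>u. (norm (cavg m f u - cavg (Suc m) f (par u)))\<^sup>2"]
      by (simp add: idx_Suc ennreal_mult[symmetric] mult.commute)
  qed
  also have "\<dots> = (\<Sum>v\<in>?S. \<integral>\<^sup>+x\<in>cell m v. (\<Sum>j<m. ?D j x) \<partial>\<mu>)
       + ennreal (\<Sum>v\<in>?S. mass m v * (norm (cavg m f v - cavg (Suc m) f p))\<^sup>2)"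
    by (simp add: sum.distrib sum_ennreal)
  finally have "(\<integral>\<^sup>+x\<in>cell (Suc m) p. (\<Sum>j<Suc m. ?D j x) \<partial>\<mu>) + ennreal (mass (Suc m) p * (norm (cavg (Suc m) f p))\<^sup>2)
      = (\<Sum>v\<in>?S. \<integral>\<^sup>+x\<in>cell m v. (\<Sum>j<m. ?D j x) \<partial>\<mu>)
       + ennreal ((\<Sum>v\<in>?S. mass m v * (norm (cavg m f v - cavg (Suc m) f p))\<^sup>2) + mass (Suc m) p * (norm (cavg (Suc m) f p))\<^sup>2)"
    by (simp add: ennreal_plus sum_nonneg add.assoc)
  also have "\<dots> = (\<Sum>v\<in>?S. (\<integral>\<^sup>+x\<in>cell m v. (\<Sum>j<m. ?D j x) \<partial>\<mu>) + ennreal (mass m v * (norm (cavg m f v))\<^sup>2))"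
    unfolding cavg_pythagoras[OF f] by (simp add: sum.distrib sum_ennreal)
  also have "\<dots> \<le> (\<Sum>v\<in>?S. \<integral>\<^sup>+x\<in>cell m v. sqnorm (f x) \<partial>\<mu>)"
    by (intro sum_mono Suc.IH)
  also have "\<dots> = (\<integral>\<^sup>+x\<in>cell (Suc m) p. sqnorm (f x) \<partial>\<mu>)"
    by (subst nn_integral_cell_Suc) auto
  finally show ?case .
qed

context
  fixes f :: "'a \<Rightarrow> real" and c :: "nat \<Rightarrow> 'a \<Rightarrow> ennreal" and N :: nat
  assumes f: "local_L2 f" 
    and c [measurable]: "\<And>i. c i \<in> borel_measurable \<mu>"
    and packing: "\<And>k v. k \<le> N \<Longrightarrow> (\<integral>\<^sup>+x\<in>cell k v. (\<Sum>i\<le>k. c i x) \<partial>\<mu>) \<le> ennreal (mass k v)"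
begin

text \<open>With \<open>m\<close> the mass of a cell, \<open>u\<close> the integral of \<open>f\<close> and \<open>S\<close> the Carleson mass below it, the quantity
\<open>4 (\<integral> f\<^sup>2 - u\<^sup>2 / (m + S))\<close> dominates the embedding sum over the subtree.  On the
passage to a parent, \<open>sum_square_div_le\<close> compares the sum over the children with the parent, and
\<open>carleson_bellman_step\<close> makes room for the term of the parent itself.\<close>

lemma carleson_bellman:
  assumes "m \<le> N"
  shows "(\<integral>\<^sup>+x\<in>cell m p. (\<Sum>i\<le>m. c i x * ennreal ((cavg i f (idx i x))\<^sup>2)) \<partial>\<mu>)
       + ennreal (4 * (cint m f p)\<^sup>2 / (mass m p + enn2real (\<integral>\<^sup>+x\<in>cell m p. (\<Sum>i\<le>m. c i x) \<partial>\<mu>)))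
       \<le> 4 * (\<integral>\<^sup>+x\<in>cell m p. ennreal ((f x)\<^sup>2) \<partial>\<mu>)"
  using assms
proof (induction m arbitrary: p)
  let ?S = "\<lambda>m p. enn2real (\<integral>\<^sup>+x\<in>cell m p. (\<Sum>i\<le>m. c i x) \<partial>\<mu>)"
  have null: "(\<integral>\<^sup>+x\<in>cell m p. g x \<partial>\<mu>) = 0" if "mass m p = 0" for m p g
  proof -
    have "cell m p \<in> null_sets \<mu>" using that by (auto simp: null_sets_def emeasure_cell)
    then show ?thesis by (rule nn_integral_null_set)
  qed
  have S_enn: "ennreal (?S m p) = (\<integral>\<^sup>+x\<in>cell m p. (\<Sum>i\<le>m. c i x) \<partial>\<mu>)" if "m \<le> N" for m p
    using packing[OF that, of p] by (intro ennreal_enn2real) (auto intro: order_le_less_trans)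
  have S_le: "?S m p \<le> mass m p" if "m \<le> N" for m p
    using packing[OF that, of p] enn2real_mono[of _ "ennreal (mass m p)"] by fastforce
  have top_term: "(\<integral>\<^sup>+x\<in>cell m p. c m x * ennreal ((cavg m f (idx m x))\<^sup>2) \<partial>\<mu>)
      = ennreal (enn2real (\<integral>\<^sup>+x\<in>cell m p. c m x \<partial>\<mu>) * (cint m f p / mass m p)\<^sup>2)"
    and C_enn: "ennreal (enn2real (\<integral>\<^sup>+x\<in>cell m p. c m x \<partial>\<mu>)) = (\<integral>\<^sup>+x\<in>cell m p. c m x \<partial>\<mu>)"
    if "m \<le> N" for m p
  proof -
    have "(\<integral>\<^sup>+x\<in>cell m p. c m x \<partial>\<mu>) \<le> (\<integral>\<^sup>+x\<in>cell m p. (\<Sum>i\<le>m. c i x) \<partial>\<mu>)"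
      by (intro nn_integral_mono mult_right_mono member_le_sum) auto
    then show C: "ennreal (enn2real (\<integral>\<^sup>+x\<in>cell m p. c m x \<partial>\<mu>)) = (\<integral>\<^sup>+x\<in>cell m p. c m x \<partial>\<mu>)"
      using packing[OF that, of p]
      by (intro ennreal_enn2real) (metis ennreal_less_top order_le_less_trans)
    have "(\<integral>\<^sup>+x\<in>cell m p. c m x * ennreal ((cavg m f (idx m x))\<^sup>2) \<partial>\<mu>)
      = (\<integral>\<^sup>+x. ennreal ((cavg m f p)\<^sup>2) * (c m x * indicator (cell m p) x) \<partial>\<mu>)"
      by (intro nn_integral_cong) (simp add: indicator_def cell_def mult.commute)
    also have "\<dots> = ennreal ((cavg m f p)\<^sup>2) * (\<integral>\<^sup>+x\<in>cell m p. c m x \<partial>\<mu>)"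
      by (rule nn_integral_cmult) measurable
    also have "\<dots> = ennreal (enn2real (\<integral>\<^sup>+x\<in>cell m p. c m x \<partial>\<mu>) * (cint m f p / mass m p)\<^sup>2)"
      by (subst C[symmetric]) (simp add: ennreal_mult[symmetric] cavg_def field_simps)
    finally show "(\<integral>\<^sup>+x\<in>cell m p. c m x * ennreal ((cavg m f (idx m x))\<^sup>2) \<partial>\<mu>)
      = ennreal (enn2real (\<integral>\<^sup>+x\<in>cell m p. c m x \<partial>\<mu>) * (cint m f p / mass m p)\<^sup>2)" .
  qed
  {
    case 0
    show ?case
    proof (cases "mass 0 p = 0")
      case True
      then show ?thesis using cint_null[OF f True] null[OF True] by simp
    next
      case False
      let ?C = "enn2real (\<integral>\<^sup>+x\<in>cell 0 p. c 0 x \<partial>\<mu>)" and ?u = "cint 0 f p" and ?m = "mass 0 p"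
      have m: "?m > 0" using False mass_nonneg[of 0 p] by linarith
      have "?C * (?u / ?m)\<^sup>2 + 4 * ?u\<^sup>2 / (?m + (0 + ?C)) \<le> 4 * ?u\<^sup>2 / (?m + 0)"
        using S_le[of 0 p] by (intro carleson_bellman_step m) auto
      then have "ennreal (?C * (?u / ?m)\<^sup>2 + 4 * ?u\<^sup>2 / (?m + ?C)) \<le> ennreal (4 * (?m * (cavg 0 f p)\<^sup>2))"
      proof (intro ennreal_leI)
        have "4 * (?m * (cavg 0 f p)\<^sup>2) = 4 * ?u\<^sup>2 / (?m + 0)"
          using m by (simp add: cavg_def power2_eq_square field_simps)
        then show "?C * (?u / ?m)\<^sup>2 + 4 * ?u\<^sup>2 / (?m + ?C) \<le> 4 * (?m * (cavg 0 f p)\<^sup>2)"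
          using \<open>?C * (?u / ?m)\<^sup>2 + 4 * ?u\<^sup>2 / (?m + (0 + ?C)) \<le> 4 * ?u\<^sup>2 / (?m + 0)\<close> by simp
      qed
      also have "\<dots> \<le> 4 * (\<integral>\<^sup>+x\<in>cell 0 p. ennreal ((f x)\<^sup>2) \<partial>\<mu>)"
        using mass_cavg_sq_le[OF f, of 0 p] m by (simp add: ennreal_mult mult_left_mono)
      finally show ?thesis using top_term[of 0 p] m by (simp add: ennreal_plus)
    qed
  next
    case (Suc m)
    let ?p = p
    show ?case
    proof (cases "mass (Suc m) p = 0")
      case True
      then show ?thesis using cint_null[OF f True] null[OF True] by simp
    next
      case False
      let ?V = "{v. par v = p}"
      let ?C = "enn2real (\<integral>\<^sup>+x\<in>cell (Suc m) p. c (Suc m) x \<partial>\<mu>)"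
      let ?u = "cint (Suc m) f p" and ?m = "mass (Suc m) p"
      let ?L = "\<lambda>v. \<integral>\<^sup>+x\<in>cell m v. (\<Sum>i\<le>m. c i x * ennreal ((cavg i f (idx i x))\<^sup>2)) \<partial>\<mu>"
      have m: "?m > 0" using False mass_nonneg[of "Suc m" p] by linarith
      have mN: "m \<le> N" "Suc m \<le> N" using Suc.prems by auto
      have "ennreal (?S (Suc m) p) = (\<integral>\<^sup>+x\<in>cell (Suc m) p. (\<Sum>i\<le>m. c i x) \<partial>\<mu>) + (\<integral>\<^sup>+x\<in>cell (Suc m) p. c (Suc m) x \<partial>\<mu>)"
        unfolding S_enn[OF mN(2)] by (simp add: distrib_right nn_integral_add)
      also have "\<dots> = (\<Sum>v\<in>?V. ennreal (?S m v)) + ennreal ?C"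
        unfolding C_enn[OF mN(2)] S_enn[OF mN(1)] by (subst nn_integral_cell_Suc) auto
      also have "\<dots> = ennreal ((\<Sum>v\<in>?V. ?S m v) + ?C)" by (simp add: sum_ennreal ennreal_plus sum_nonneg)
      finally have "ennreal (?S (Suc m) p) = ennreal ((\<Sum>v\<in>?V. ?S m v) + ?C)" .
      then have S_eq: "?S (Suc m) p = (\<Sum>v\<in>?V. ?S m v) + ?C"
        by (rule ennreal_inj[THEN iffD1, rotated 2]) (auto intro!: sum_nonneg add_nonneg_nonneg)
      have "(\<integral>\<^sup>+x\<in>cell (Suc m) p. (\<Sum>i\<le>Suc m. c i x * ennreal ((cavg i f (idx i x))\<^sup>2)) \<partial>\<mu>)
        = (\<integral>\<^sup>+x\<in>cell (Suc m) p. (\<Sum>i\<le>m. c i x * ennreal ((cavg i f (idx i x))\<^sup>2)) \<partial>\<mu>)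
        + (\<integral>\<^sup>+x\<in>cell (Suc m) p. c (Suc m) x * ennreal ((cavg (Suc m) f (idx (Suc m) x))\<^sup>2) \<partial>\<mu>)"
        by (simp add: distrib_right nn_integral_add)
      also have "\<dots> = (\<Sum>v\<in>?V. ?L v) + ennreal (?C * (?u / ?m)\<^sup>2)"
        unfolding top_term[OF mN(2)] by (subst nn_integral_cell_Suc) auto
      finally have "(\<integral>\<^sup>+x\<in>cell (Suc m) p. (\<Sum>i\<le>Suc m. c i x * ennreal ((cavg i f (idx i x))\<^sup>2)) \<partial>\<mu>)
        + ennreal (4 * ?u\<^sup>2 / (?m + ?S (Suc m) p))
        = (\<Sum>v\<in>?V. ?L v) + ennreal (?C * (?u / ?m)\<^sup>2 + 4 * ?u\<^sup>2 / (?m + ((\<Sum>v\<in>?V. ?S m v) + ?C)))"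
        using m S_eq by (simp add: ennreal_plus sum_nonneg add.assoc)
      also have "\<dots> \<le> (\<Sum>v\<in>?V. ?L v) + ennreal (4 * ?u\<^sup>2 / (?m + (\<Sum>v\<in>?V. ?S m v)))"
        using S_le[OF mN(2), of p] S_eq
        by (intro add_left_mono ennreal_leI carleson_bellman_step m) (auto intro: sum_nonneg)
      also have "\<dots> \<le> (\<Sum>v\<in>?V. ?L v) + ennreal (\<Sum>v\<in>?V. 4 * (cint m f v)\<^sup>2 / (mass m v + ?S m v))"
      proof -
        have "(\<Sum>v\<in>?V. cint m f v)\<^sup>2 / (\<Sum>v\<in>?V. mass m v + ?S m v) \<le> (\<Sum>v\<in>?V. (cint m f v)\<^sup>2 / (mass m v + ?S m v))"
          by (intro sum_square_div_le finite_children)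
             (auto intro!: cint_null[OF f] simp: add_nonneg_eq_0_iff)
        then have "4 * ?u\<^sup>2 / (?m + (\<Sum>v\<in>?V. ?S m v)) \<le> (\<Sum>v\<in>?V. 4 * (cint m f v)\<^sup>2 / (mass m v + ?S m v))"
          by (simp add: cint_Suc[OF f] mass_Suc sum.distrib sum_distrib_left[symmetric] times_divide_eq_right[symmetric]
                   del: times_divide_eq_right)
        then show ?thesis by (intro add_left_mono ennreal_leI)
      qed
      also have "\<dots> = (\<Sum>v\<in>?V. ?L v + ennreal (4 * (cint m f v)\<^sup>2 / (mass m v + ?S m v)))"
        by (simp add: sum.distrib sum_ennreal)
      also have "\<dots> \<le> (\<Sum>v\<in>?V. 4 * (\<integral>\<^sup>+x\<in>cell m v. ennreal ((f x)\<^sup>2) \<partial>\<mu>))"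
        using Suc.IH mN by (intro sum_mono) auto
      also have "\<dots> = 4 * (\<integral>\<^sup>+x\<in>cell (Suc m) p. ennreal ((f x)\<^sup>2) \<partial>\<mu>)"
        using f by (subst nn_integral_cell_Suc) (auto simp: sum_distrib_left local_L2_def)
      finally show ?thesis .
    qed
  }
qed

end

text \<open>The cells of one generation form a countable partition.\<close>

lemma nn_integral_mono_cells:
  assumes [measurable]: "g \<in> borel_measurable \<mu>" "h \<in> borel_measurable \<mu>"
    and le: "\<And>p. (\<integral>\<^sup>+x\<in>cell m p. g x \<partial>\<mu>) \<le> (\<integral>\<^sup>+x\<in>cell m p. h x \<partial>\<mu>)"
  shows "(\<integral>\<^sup>+x. g x \<partial>\<mu>) \<le> (\<integral>\<^sup>+x. h x \<partial>\<mu>)"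
proof -
  define B where "B n = {x. to_nat (idx m x) = n}" for n
  have B: "B n = {} \<or> (\<exists>v. B n = cell m v)" for n
    by (cases "\<exists>v::'i. to_nat v = n") (auto simp: B_def cell_def)
  have [measurable]: "B n \<in> sets \<mu>" for n using B[of n] by auto
  have disj: "disjoint_family B" by (auto simp: disjoint_family_on_def B_def)
  have UN: "(\<Union>n. B n) = UNIV" by (auto simp: B_def)
  have "(\<integral>\<^sup>+x\<in>B n. g x \<partial>\<mu>) \<le> (\<integral>\<^sup>+x\<in>B n. h x \<partial>\<mu>)" for n using B[of n] le by auto
  then have "(\<Sum>n. (\<integral>\<^sup>+x\<in>B n. g x \<partial>\<mu>)) \<le> (\<Sum>n. (\<integral>\<^sup>+x\<in>B n. h x \<partial>\<mu>))" by (intro suminf_le) auto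
  then have "(\<integral>\<^sup>+x\<in>(\<Union>n. B n). g x \<partial>\<mu>) \<le> (\<integral>\<^sup>+x\<in>(\<Union>n. B n). h x \<partial>\<mu>)"
    by (subst (1 2) nn_integral_disjoint_family) (auto simp: disj)
  then show ?thesis by (simp add: UN)
qed

text \<open>Dividing the densities by \<open>B\<close> reduces the packing constant to \<open>1\<close>; the Bellman estimate is then added up
over the cells of the top generation.\<close>

theorem carleson_embedding:
  fixes f :: "'a \<Rightarrow> real" and c :: "nat \<Rightarrow> 'a \<Rightarrow> ennreal"
  assumes f: "local_L2 f" and c [measurable]: "\<And>i. c i \<in> borel_measurable \<mu>"
    and B: "B > 0"
    and packing: "\<And>k v. k \<le> N \<Longrightarrow> (\<integral>\<^sup>+x\<in>cell k v. (\<Sum>i\<le>k. c i x) \<partial>\<mu>) \<le> ennreal (B * mass k v)"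
  shows "(\<integral>\<^sup>+x. (\<Sum>i\<le>N. c i x * ennreal ((cavg i f (idx i x))\<^sup>2)) \<partial>\<mu>)
     \<le> ennreal (4 * B) * (\<integral>\<^sup>+x. ennreal ((f x)\<^sup>2) \<partial>\<mu>)"
proof -
  have [measurable]: "f \<in> borel_measurable \<mu>" using f by (simp add: local_L2_def)
  let ?c = "\<lambda>i x. ennreal (1 / B) * c i x"
  have pack: "(\<integral>\<^sup>+x\<in>cell k v. (\<Sum>i\<le>k. ?c i x) \<partial>\<mu>) \<le> ennreal (mass k v)" if "k \<le> N" for k v
  proof -
    have "(\<integral>\<^sup>+x\<in>cell k v. (\<Sum>i\<le>k. ?c i x) \<partial>\<mu>) = ennreal (1 / B) * (\<integral>\<^sup>+x\<in>cell k v. (\<Sum>i\<le>k. c i x) \<partial>\<mu>)"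
      by (simp add: sum_distrib_left[symmetric] mult.assoc nn_integral_cmult)
    also have "\<dots> \<le> ennreal (1 / B) * ennreal (B * mass k v)" by (intro mult_left_mono packing that) auto
    also have "\<dots> = ennreal (mass k v)" using B by (simp add: ennreal_mult[symmetric])
    finally show ?thesis .
  qed
  have "(\<integral>\<^sup>+x. (\<Sum>i\<le>N. ?c i x * ennreal ((cavg i f (idx i x))\<^sup>2)) \<partial>\<mu>)
     \<le> (\<integral>\<^sup>+x. 4 * ennreal ((f x)\<^sup>2) \<partial>\<mu>)"
  proof (rule nn_integral_mono_cells[where m = N])
    fix p
    have "(\<integral>\<^sup>+x\<in>cell N p. (\<Sum>i\<le>N. ?c i x * ennreal ((cavg i f (idx i x))\<^sup>2)) \<partial>\<mu>)
      \<le> 4 * (\<integral>\<^sup>+x\<in>cell N p. ennreal ((f x)\<^sup>2) \<partial>\<mu>)"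
      by (rule order_trans[OF _ carleson_bellman[OF f _ pack order_refl]]) auto
    then show "(\<integral>\<^sup>+x\<in>cell N p. (\<Sum>i\<le>N. ?c i x * ennreal ((cavg i f (idx i x))\<^sup>2)) \<partial>\<mu>)
      \<le> (\<integral>\<^sup>+x\<in>cell N p. (4 * ennreal ((f x)\<^sup>2)) \<partial>\<mu>)"
      by (simp add: mult.assoc nn_integral_cmult)
  qed auto
  then have "ennreal B * (\<integral>\<^sup>+x. (\<Sum>i\<le>N. ?c i x * ennreal ((cavg i f (idx i x))\<^sup>2)) \<partial>\<mu>)
     \<le> ennreal B * (4 * (\<integral>\<^sup>+x. ennreal ((f x)\<^sup>2) \<partial>\<mu>))"
    by (intro mult_left_mono) (auto simp: nn_integral_cmult)
  also have "ennreal B * (\<integral>\<^sup>+x. (\<Sum>i\<le>N. ?c i x * ennreal ((cavg i f (idx i x))\<^sup>2)) \<partial>\<mu>)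
     = (\<integral>\<^sup>+x. (\<Sum>i\<le>N. c i x * ennreal ((cavg i f (idx i x))\<^sup>2)) \<partial>\<mu>)"
  proof -
    have "ennreal B * (ennreal (1 / B) * y) = y" for y
      using B by (simp add: mult.assoc[symmetric] ennreal_mult[symmetric])
    then show ?thesis
      by (subst nn_integral_cmult[symmetric]) (auto simp: sum_distrib_left mult.assoc)
  qed
  also have "ennreal B * (4 * (\<integral>\<^sup>+x. ennreal ((f x)\<^sup>2) \<partial>\<mu>)) = ennreal (4 * B) * (\<integral>\<^sup>+x. ennreal ((f x)\<^sup>2) \<partial>\<mu>)"
    using B by (simp add: ennreal_mult mult_ac)
  finally show ?thesis .
qed

lemma AE_mass_pos: "AE x in \<mu>. \<forall>j. mass j (idx j x) > 0"
proof (subst AE_all_countable, intro allI)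
  fix j
  have "(\<Union>v\<in>{v. mass j v = 0}. cell j v) \<in> null_sets \<mu>"
    by (intro null_sets_UN' countableI_type) (auto simp: null_sets_def emeasure_cell)
  then show "AE x in \<mu>. mass j (idx j x) > 0"
    by (rule AE_I') (auto simp: cell_def less_le)
qed

lemma local_L2_norm: "local_L2 f \<Longrightarrow> local_L2 (\<lambda>x. norm (f x))"
  unfolding local_L2_def by (auto intro: borel_measurable_norm)

lemma norm_cavg_le:
  fixes f :: "'a \<Rightarrow> 'b::euclidean_space"
  shows "norm (cavg j f v) \<le> cavg j (\<lambda>x. norm (f x)) v"
proof -
  have "norm (cint j f v) \<le> (LINT x|\<mu>. norm (indicator (cell j v) x *\<^sub>R f x))"
    unfolding cint_def set_lebesgue_integral_def by (rule integral_norm_bound)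
  also have "\<dots> = cint j (\<lambda>x. norm (f x)) v"
    unfolding cint_def set_lebesgue_integral_def by (intro Bochner_Integration.integral_cong) auto
  finally show ?thesis by (simp add: cavg_def mult_left_mono)
qed

lemma cavg_sq_nn_integral_le:
  fixes f :: "'a \<Rightarrow> 'b::euclidean_space"
  assumes f: "local_L2 f"
  shows "(\<integral>\<^sup>+x. sqnorm (cavg m f (idx m x)) \<partial>\<mu>) \<le> (sqint \<mu> f)"
proof (rule nn_integral_mono_cells[where m = m])
  have [measurable]: "f \<in> borel_measurable \<mu>" using f by (simp add: local_L2_def)
  show "(\<lambda>x. sqnorm (f x)) \<in> borel_measurable \<mu>" by measurable
  fix p
  show "(\<integral>\<^sup>+x\<in>cell m p. sqnorm (cavg m f (idx m x)) \<partial>\<mu>) \<le> (\<integral>\<^sup>+x\<in>cell m p. sqnorm (f x) \<partial>\<mu>)"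
    using nn_integral_cell_const[where j = m and v = p and g = "\<lambda>u. (norm (cavg m f u))\<^sup>2"] mass_cavg_sq_le[OF f, of m p]
    by (simp add: ennreal_mult[symmetric] mult.commute)
qed measurable

text \<open>The function equal to \<open>coef j b f v * b\<close> on the cell \<open>v\<close> has there the same integral as \<open>f\<close>.\<close>

definition coef :: "nat \<Rightarrow> ('a \<Rightarrow> complex) \<Rightarrow> ('a \<Rightarrow> complex) \<Rightarrow> 'i \<Rightarrow> complex" where
  "coef j b f v = cint j f v / cint j b v"

text \<open>Above the top generation \<open>N\<close> the coefficient counts as \<open>0\<close>, so that the differences of the generations
\<open>k\<close> to \<open>N\<close> add up to the coefficient of generation \<open>k\<close>.\<close>

definition coef_diff :: "nat \<Rightarrow> nat \<Rightarrow> ('a \<Rightarrow> complex) \<Rightarrow> ('a \<Rightarrow> complex) \<Rightarrow> 'a \<Rightarrow> complex" where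
  "coef_diff N j b f x = coef j b f (idx j x) - (if j < N then coef (Suc j) b f (idx (Suc j) x) else 0)"

lemma coef_diff_measurable [measurable]: "coef_diff N j b f \<in> borel_measurable \<mu>"
  unfolding coef_diff_def by (cases "j < N") (simp_all add: borel_measurable_diff)

context
  fixes b f :: "'a \<Rightarrow> complex" and c0 M :: real
  assumes f: "local_L2 f" and b: "local_L2 b" and c0: "c0 > 0" and M: "M > 0"
    and accretive: "\<And>j v. c0 * mass j v \<le> norm (cint j b v)"
    and b_sq: "\<And>j v. (\<integral>\<^sup>+x\<in>cell j v. sqnorm (b x) \<partial>\<mu>) \<le> ennreal (M\<^sup>2 * mass j v)"
begin

lemma coef_eq_cavg: "mass j v > 0 \<Longrightarrow> coef j b f v = cavg j f v / cavg j b v"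
  by (simp add: coef_def cavg_def scaleR_conv_of_real)

lemma cavg_accretive: "mass j v > 0 \<Longrightarrow> c0 \<le> norm (cavg j b v)"
  using accretive[of j v] by (simp add: cavg_def field_simps)

lemma norm_coef_le: "norm (coef j b f v) \<le> norm (cavg j f v) / c0"
proof (cases "mass j v > 0")
  case True
  then show ?thesis
    using cavg_accretive[OF True] c0 by (simp add: coef_eq_cavg norm_divide frac_le)
next
  case False
  then have "mass j v = 0" using mass_nonneg[of j v] by linarith
  then show ?thesis using c0 by (simp add: coef_def cint_null[OF f])
qed

lemma coef_L2: "(\<integral>\<^sup>+x. sqnorm (coef j b f (idx j x)) \<partial>\<mu>)
    \<le> ennreal (1 / c0\<^sup>2) * (sqint \<mu> f)"
proof -
  have "(\<integral>\<^sup>+x. sqnorm (coef j b f (idx j x)) \<partial>\<mu>)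
      \<le> (\<integral>\<^sup>+x. ennreal (1 / c0\<^sup>2) * sqnorm (cavg j f (idx j x)) \<partial>\<mu>)"
  proof (rule nn_integral_mono)
    fix x
    have "(norm (coef j b f (idx j x)))\<^sup>2 \<le> (norm (cavg j f (idx j x)) / c0)\<^sup>2"
      by (intro power_mono norm_coef_le) auto
    then show "sqnorm (coef j b f (idx j x)) \<le> ennreal (1 / c0\<^sup>2) * sqnorm (cavg j f (idx j x))"
      by (simp add: ennreal_mult[symmetric] power_divide ennreal_leI)
  qed
  also have "\<dots> = ennreal (1 / c0\<^sup>2) * (\<integral>\<^sup>+x. sqnorm (cavg j f (idx j x)) \<partial>\<mu>)"
    by (rule nn_integral_cmult) measurable
  also have "\<dots> \<le> ennreal (1 / c0\<^sup>2) * (sqint \<mu> f)"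
    by (intro mult_left_mono cavg_sq_nn_integral_le f) auto
  finally show ?thesis .
qed

text \<open>The coefficient is a quotient of two averages.  Its variation is the variation of the numerator, or
an average of \<open>f\<close> times the variation of the denominator, which is bounded below by accretivity.\<close>

lemma coef_diff_sq_le:
  assumes pos: "mass j v > 0" "mass (Suc j) w > 0"
  shows "(norm (coef j b f v - coef (Suc j) b f w))\<^sup>2
    \<le> 2 / c0\<^sup>2 * (norm (cavg j f v - cavg (Suc j) f w))\<^sup>2
    + 2 / c0 ^ 4 * ((norm (cavg j b v - cavg (Suc j) b w))\<^sup>2 * (cavg (Suc j) (\<lambda>x. norm (f x)) w)\<^sup>2)"
proof -
  let ?e = "cavg j f v" and ?e' = "cavg (Suc j) f w" and ?\<beta> = "cavg j b v" and ?\<beta>' = "cavg (Suc j) b w"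
  have \<beta>: "c0 \<le> norm ?\<beta>" "c0 \<le> norm ?\<beta>'" using cavg_accretive pos by auto
  then have nz: "?\<beta> \<noteq> 0" "?\<beta>' \<noteq> 0" using c0 by auto
  have "?e / ?\<beta> - ?e' / ?\<beta>' = (?e - ?e') / ?\<beta> - ?e' * (?\<beta> - ?\<beta>') / (?\<beta> * ?\<beta>')"
    by (rule quotient_diff[OF nz])
  then have "norm (?e / ?\<beta> - ?e' / ?\<beta>') \<le> norm ((?e - ?e') / ?\<beta>) + norm (?e' * (?\<beta> - ?\<beta>') / (?\<beta> * ?\<beta>'))"
    by (simp only: norm_triangle_ineq4)
  also have "\<dots> = norm (?e - ?e') / norm ?\<beta> + norm ?e' * norm (?\<beta> - ?\<beta>') / (norm ?\<beta> * norm ?\<beta>')"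
    by (simp only: norm_divide norm_mult)
  also have "\<dots> \<le> norm (?e - ?e') / c0 + cavg (Suc j) (\<lambda>x. norm (f x)) w * norm (?\<beta> - ?\<beta>') / (c0 * c0)"
  proof (rule add_mono)
    show "norm (?e - ?e') / norm ?\<beta> \<le> norm (?e - ?e') / c0"
      by (rule frac_le) (use \<beta> c0 in auto)
    have le: "norm ?e' \<le> cavg (Suc j) (\<lambda>x. norm (f x)) w" by (rule norm_cavg_le)
    show "norm ?e' * norm (?\<beta> - ?\<beta>') / (norm ?\<beta> * norm ?\<beta>')
        \<le> cavg (Suc j) (\<lambda>x. norm (f x)) w * norm (?\<beta> - ?\<beta>') / (c0 * c0)"
    proof (rule frac_le)
      show "c0 * c0 \<le> norm ?\<beta> * norm ?\<beta>'" by (rule mult_mono) (use \<beta> c0 in auto)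
      show "0 \<le> cavg (Suc j) (\<lambda>x. norm (f x)) w * norm (?\<beta> - ?\<beta>')"
        by (rule mult_nonneg_nonneg) (use le order_trans[OF norm_ge_zero le] in auto)
    qed (use le c0 in \<open>auto intro: mult_right_mono\<close>)
  qed
  finally have "norm (coef j b f v - coef (Suc j) b f w)
     \<le> norm (?e - ?e') / c0 + cavg (Suc j) (\<lambda>x. norm (f x)) w * norm (?\<beta> - ?\<beta>') / (c0 * c0)"
    using pos by (simp add: coef_eq_cavg)
  then have "(norm (coef j b f v - coef (Suc j) b f w))\<^sup>2
     \<le> (norm (?e - ?e') / c0 + cavg (Suc j) (\<lambda>x. norm (f x)) w * norm (?\<beta> - ?\<beta>') / (c0 * c0))\<^sup>2"
    by (intro power_mono) auto
  also have "\<dots> \<le> 2 * (norm (?e - ?e') / c0)\<^sup>2 + 2 * (cavg (Suc j) (\<lambda>x. norm (f x)) w * norm (?\<beta> - ?\<beta>') / (c0 * c0))\<^sup>2"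
    by (rule square_sum_le)
  also have "\<dots> = 2 / c0\<^sup>2 * (norm (?e - ?e'))\<^sup>2
    + 2 / c0 ^ 4 * ((norm (?\<beta> - ?\<beta>'))\<^sup>2 * (cavg (Suc j) (\<lambda>x. norm (f x)) w)\<^sup>2)"
  proof -
    have "(c0 * c0)\<^sup>2 = c0 ^ 4" by (simp add: power2_eq_square power4_eq_xxxx)
    then show ?thesis unfolding power_divide power_mult_distrib by (simp add: mult.commute)
  qed
  finally show ?thesis .
qed

text \<open>The first part of \<open>coef_diff_sq_le\<close> is summed by \<open>martingale_square_function\<close> for \<open>f\<close>.  For the second
part the squared martingale differences of \<open>b\<close> serve as Carleson densities: by the same lemma for \<open>b\<close>
their mass below a cell is at most the integral of \<open>\<bar>b\<bar>\<^sup>2\<close> over it.  The coefficient of the top generation is bounded by an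
average of \<open>f\<close>.\<close>

theorem adapted_square_function:
  "(\<integral>\<^sup>+x. (\<Sum>j\<le>N. sqnorm (coef_diff N j b f x)) \<partial>\<mu>)
    \<le> ennreal (3 / c0\<^sup>2 + 8 * M\<^sup>2 / c0 ^ 4) * (sqint \<mu> f)"
proof -
  have [measurable]: "f \<in> borel_measurable \<mu>" "b \<in> borel_measurable \<mu>"
    using f b by (auto simp: local_L2_def)
  let ?F = "sqint \<mu> f"
  let ?A = "\<lambda>i x. (cavg i (\<lambda>x. norm (f x)) (idx i x))\<^sup>2"
  let ?Df = "\<lambda>j x. (norm (cavg j f (idx j x) - cavg (Suc j) f (idx (Suc j) x)))\<^sup>2"
  let ?Db = "\<lambda>j x. (norm (cavg j b (idx j x) - cavg (Suc j) b (idx (Suc j) x)))\<^sup>2"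
  define c where "c i x = (case i of 0 \<Rightarrow> 0 | Suc j \<Rightarrow> ennreal (?Db j x))" for i x
  have c_meas: "c i \<in> borel_measurable \<mu>" for i
    unfolding c_def by (cases i) auto
  have sum_c: "(\<Sum>i\<le>k. c i x * g i) = (\<Sum>j<k. ennreal (?Db j x) * g (Suc j))" for k x and g :: "nat \<Rightarrow> ennreal"
    by (induction k) (auto simp: c_def)
  have sum_c': "(\<Sum>i\<le>k. c i x) = (\<Sum>j<k. ennreal (?Db j x))" for k x
    by (induction k) (auto simp: c_def)
  have "(\<integral>\<^sup>+x. (\<Sum>i\<le>N. c i x * ennreal (?A i x)) \<partial>\<mu>) \<le> ennreal (4 * M\<^sup>2) * (sqint \<mu> f)"
  proof (rule carleson_embedding[OF local_L2_norm[OF f] c_meas])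
    fix k v
    have "(\<integral>\<^sup>+x\<in>cell k v. (\<Sum>i\<le>k. c i x) \<partial>\<mu>) = (\<integral>\<^sup>+x\<in>cell k v. (\<Sum>j<k. ennreal (?Db j x)) \<partial>\<mu>)"
      by (simp add: sum_c')
    also have "\<dots> \<le> (\<integral>\<^sup>+x\<in>cell k v. sqnorm (b x) \<partial>\<mu>)"
      by (rule order_trans[OF _ martingale_square_function[OF b]]) simp
    finally show "(\<integral>\<^sup>+x\<in>cell k v. (\<Sum>i\<le>k. c i x) \<partial>\<mu>) \<le> ennreal (M\<^sup>2 * mass k v)"
      using b_sq[of k v] by simp
  qed (use M in auto)
  then have carl: "(\<integral>\<^sup>+x. (\<Sum>j<N. ennreal (?Db j x) * ennreal (?A (Suc j) x)) \<partial>\<mu>) \<le> ennreal (4 * M\<^sup>2) * ?F"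
    by (simp add: sum_c)
  have mart: "(\<integral>\<^sup>+x. (\<Sum>j<N. ennreal (?Df j x)) \<partial>\<mu>) \<le> ?F"
    by (rule nn_integral_mono_cells[where m = N], simp_all, rule order_trans[OF _ martingale_square_function[OF f]], simp)
  have "(\<integral>\<^sup>+x. (\<Sum>j\<le>N. sqnorm (coef_diff N j b f x)) \<partial>\<mu>)
    \<le> (\<integral>\<^sup>+x. ennreal (2 / c0\<^sup>2) * (\<Sum>j<N. ennreal (?Df j x))
        + ennreal (2 / c0 ^ 4) * (\<Sum>j<N. ennreal (?Db j x) * ennreal (?A (Suc j) x))
        + sqnorm (coef N b f (idx N x)) \<partial>\<mu>)"
  proof (rule nn_integral_mono_AE, use AE_mass_pos in eventually_elim)
    fix x assume pos: "\<forall>j. mass j (idx j x) > 0"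
    have "sqnorm (coef_diff N j b f x)
       \<le> ennreal (2 / c0\<^sup>2) * ennreal (?Df j x) + ennreal (2 / c0 ^ 4) * (ennreal (?Db j x) * ennreal (?A (Suc j) x))"
      if "j < N" for j
    proof -
      have "sqnorm (coef_diff N j b f x) \<le> ennreal (2 / c0\<^sup>2 * ?Df j x + 2 / c0 ^ 4 * (?Db j x * ?A (Suc j) x))"
        using that pos coef_diff_sq_le[of j "idx j x" "idx (Suc j) x"] unfolding coef_diff_def
        by (intro ennreal_leI) simp
      also have "\<dots> = ennreal (2 / c0\<^sup>2) * ennreal (?Df j x) + ennreal (2 / c0 ^ 4) * (ennreal (?Db j x) * ennreal (?A (Suc j) x))"
        using c0 by (simp add: ennreal_mult[symmetric] ennreal_plus[symmetric] del: ennreal_plus)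
      finally show ?thesis .
    qed
    then have "(\<Sum>j<N. sqnorm (coef_diff N j b f x))
       \<le> (\<Sum>j<N. ennreal (2 / c0\<^sup>2) * ennreal (?Df j x) + ennreal (2 / c0 ^ 4) * (ennreal (?Db j x) * ennreal (?A (Suc j) x)))"
      by (intro sum_mono) auto
    also have "\<dots> = ennreal (2 / c0\<^sup>2) * (\<Sum>j<N. ennreal (?Df j x))
        + ennreal (2 / c0 ^ 4) * (\<Sum>j<N. ennreal (?Db j x) * ennreal (?A (Suc j) x))"
      by (simp only: sum.distrib sum_distrib_left)
    finally have "(\<Sum>j<N. sqnorm (coef_diff N j b f x)) + sqnorm (coef_diff N N b f x)
       \<le> ennreal (2 / c0\<^sup>2) * (\<Sum>j<N. ennreal (?Df j x))
        + ennreal (2 / c0 ^ 4) * (\<Sum>j<N. ennreal (?Db j x) * ennreal (?A (Suc j) x))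
        + sqnorm (coef N b f (idx N x))"
      by (rule add_mono) (simp add: coef_diff_def)
    then show "(\<Sum>j\<le>N. sqnorm (coef_diff N j b f x))
       \<le> ennreal (2 / c0\<^sup>2) * (\<Sum>j<N. ennreal (?Df j x))
        + ennreal (2 / c0 ^ 4) * (\<Sum>j<N. ennreal (?Db j x) * ennreal (?A (Suc j) x))
        + sqnorm (coef N b f (idx N x))"
      by (simp add: lessThan_Suc_atMost[symmetric])
  qed
  also have "\<dots> = ennreal (2 / c0\<^sup>2) * (\<integral>\<^sup>+x. (\<Sum>j<N. ennreal (?Df j x)) \<partial>\<mu>)
      + ennreal (2 / c0 ^ 4) * (\<integral>\<^sup>+x. (\<Sum>j<N. ennreal (?Db j x) * ennreal (?A (Suc j) x)) \<partial>\<mu>)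
      + (\<integral>\<^sup>+x. sqnorm (coef N b f (idx N x)) \<partial>\<mu>)"
    by (simp add: nn_integral_add nn_integral_cmult del: sum_ennreal)
  also have "\<dots> \<le> ennreal (2 / c0\<^sup>2) * ?F + ennreal (2 / c0 ^ 4) * (ennreal (4 * M\<^sup>2) * ?F) + ennreal (1 / c0\<^sup>2) * ?F"
    by (intro add_mono mult_left_mono mart carl coef_L2) auto
  also have "\<dots> = ennreal (3 / c0\<^sup>2 + 8 * M\<^sup>2 / c0 ^ 4) * ?F"
  proof -
    have "ennreal (3 / c0\<^sup>2 + 8 * M\<^sup>2 / c0 ^ 4) = ennreal (2 / c0\<^sup>2) + ennreal (2 / c0 ^ 4) * ennreal (4 * M\<^sup>2) + ennreal (1 / c0\<^sup>2)"
      using c0 by (simp add: ennreal_mult[symmetric] ennreal_plus[symmetric] del: ennreal_plus)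
    then show ?thesis by (simp add: distrib_right mult.assoc)
  qed
  finally show ?thesis .
qed

end

end

lemma (in cell_tree) integral_zero_cells:
  fixes \<phi> :: "'a \<Rightarrow> 'b::euclidean_space"
  assumes int: "integrable \<mu> \<phi>" and zero: "\<And>v. cint m \<phi> v = 0"
  shows "(LINT x|\<mu>. \<phi> x) = 0"
proof -
  define B where "B n = {x. to_nat (idx m x) = n}" for n
  have B: "B n = {} \<or> (\<exists>v. B n = cell m v)" for n
    by (cases "\<exists>v::'i. to_nat v = n") (auto simp: B_def cell_def)
  have [measurable]: "B n \<in> sets \<mu>" for n using B[of n] by auto
  have UN: "(\<Union>n. B n) = space \<mu>" by (auto simp: B_def space_UNIV)
  have z: "(LINT x:B n|\<mu>. \<phi> x) = 0" for n
    using B[of n] zero by (auto simp: cint_def set_lebesgue_integral_def)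
  have "(LINT x:(\<Union>n. B n)|\<mu>. \<phi> x) = (\<Sum>n. (LINT x:B n|\<mu>. \<phi> x))"
  proof (rule lebesgue_integral_countable_add)
    show "B i \<inter> B j = {}" if "i \<noteq> j" for i j using that by (auto simp: B_def)
    show "set_integrable \<mu> (\<Union>n. B n) \<phi>" unfolding UN set_integrable_def by (intro integrable_mult_indicator int) simp
  qed simp
  then show ?thesis unfolding z UN by (simp add: set_integral_space int)
qed

lemma (in cell_tree) local_L2I:
  assumes "f \<in> borel_measurable \<mu>" "sqint \<mu> f < \<infinity>"
  shows "local_L2 f"
  unfolding local_L2_def
proof (intro conjI allI)
  fix j v
  have "(\<integral>\<^sup>+x\<in>cell j v. sqnorm (f x) \<partial>\<mu>) \<le> (sqint \<mu> f)"
    by (intro nn_integral_mono) (auto simp: indicator_def)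
  then show "(\<integral>\<^sup>+x\<in>cell j v. sqnorm (f x) \<partial>\<mu>) < \<infinity>"
    using assms(2) by (rule order_le_less_trans)
qed (rule assms(1))

lemma (in cell_tree) cint_diff:
  "local_L2 f \<Longrightarrow> local_L2 g \<Longrightarrow> cint j (\<lambda>x. f x - g x) v = cint j f v - cint j g v"
  unfolding cint_def by (intro set_integral_diff set_integrable_cell)

section \<open>Shifted grids and points far from cell boundaries\<close>

lemma infnorm_le_iff:
  fixes x :: "real ^ 'n"
  shows "infnorm x \<le> a \<longleftrightarrow> (\<forall>i. \<bar>x $ i\<bar> \<le> a)"
proof
  assume "\<forall>i. \<bar>x $ i\<bar> \<le> a"
  then show "infnorm x \<le> a" unfolding infnorm_cart by (intro cSup_least) auto
qed (meson component_le_infnorm_cart order_trans)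

lemma infnorm_less_iff:
  fixes x :: "real ^ 'n"
  shows "infnorm x < a \<longleftrightarrow> (\<forall>i. \<bar>x $ i\<bar> < a)"
proof
  assume "\<forall>i. \<bar>x $ i\<bar> < a"
  then have "infnorm x < a \<or> infnorm x = a" using infnorm_le_iff[of x a] by (auto simp: less_le)
  moreover have "\<exists>i. \<bar>x $ i\<bar> = infnorm x"
  proof -
    have "infnorm x \<in> (\<lambda>b. \<bar>x \<bullet> b\<bar>) ` Basis" unfolding infnorm_Max by (intro Max_in) auto
    then show ?thesis by (auto simp: Basis_vec_def inner_axis)
  qed
  ultimately show "infnorm x < a" using \<open>\<forall>i. \<bar>x $ i\<bar> < a\<close> by (metis less_irrefl)
qed (meson component_le_infnorm_cart order_le_less_trans)

lemma infnorm_diff_triangle: "infnorm (x - z) \<le> infnorm (x - y) + infnorm (y - z)"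
  using infnorm_triangle[of "x - y" "y - z"] by simp

lemma in_cube_infnorm:
  assumes "x \<in> cube c l" shows "infnorm (x - c) \<le> l / 2"
  unfolding infnorm_le_iff
proof
  fix i
  have "c $ i - l / 2 \<le> x $ i \<and> x $ i < c $ i + l / 2" using assms by (simp add: cube_def)
  then show "\<bar>(x - c) $ i\<bar> \<le> l / 2" unfolding vector_minus_component by linarith
qed

lemma infnorm_in_cube:
  assumes "infnorm (x - c) < l / 2" shows "x \<in> cube c l"
proof -
  have "c $ i - l / 2 \<le> x $ i \<and> x $ i < c $ i + l / 2" for i
    using assms[unfolded infnorm_less_iff, rule_format, of i] unfolding vector_minus_component by linarith
  then show ?thesis by (simp add: cube_def)
qed

lemma cube_in_borel [measurable]: "cube c l \<in> sets borel"
proof -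
  have "{x \<in> space borel. \<forall>i. c $ i - l / 2 \<le> x $ i \<and> x $ i < c $ i + l / 2} \<in> sets borel"
    by measurable
  then show ?thesis by (simp add: cube_def)
qed

text \<open>The grid is shifted by the same amount \<open>\<tau>\<close> in all coordinates.  One parameter is enough because the
bad shifts are counted by a union bound over the coordinates.\<close>

definition grid_idx :: "real \<Rightarrow> real \<Rightarrow> nat \<Rightarrow> real ^ 'n \<Rightarrow> 'n \<Rightarrow> int" where
  "grid_idx \<tau> h j x i = \<lfloor>(x $ i - \<tau>) / (h * 4 ^ j)\<rfloor>"

definition grid_centre :: "real \<Rightarrow> real \<Rightarrow> nat \<Rightarrow> ('n \<Rightarrow> int) \<Rightarrow> real ^ 'n" where
  "grid_centre \<tau> h j v = (\<chi> i. \<tau> + (of_int (v i) + 1 / 2) * (h * 4 ^ j))"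

definition grid_par :: "('n \<Rightarrow> int) \<Rightarrow> 'n \<Rightarrow> int" where
  "grid_par v i = v i div 4"

text \<open>The distance of a point of a cell to its boundary is half the side minus the distance to the centre.
A point is good at scale \<open>k\<close> if, for the cell of each generation \<open>j \<ge> k\<close>, this distance is at least the fraction
\<open>c 2\<^bsup>k-j\<^esup>\<close> of the side \<open>h 4\<^sup>j\<close>, in other words \<open>c\<close> times the geometric mean of the sides at \<open>j\<close> and \<open>k\<close>.\<close>

definition good :: "real \<Rightarrow> real \<Rightarrow> nat \<Rightarrow> real \<Rightarrow> nat \<Rightarrow> (real ^ 'n) set" where
  "good \<tau> h N c k = {x. \<forall>j\<in>{k..N}. c * h * 2 ^ (j + k) \<le>
     h * 4 ^ j / 2 - infnorm (x - grid_centre \<tau> h j (grid_idx \<tau> h j x))}"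

lemma grid_idx_Suc: "grid_idx \<tau> h (Suc j) x = grid_par (grid_idx \<tau> h j x)"
proof
  fix i
  show "grid_idx \<tau> h (Suc j) x i = grid_par (grid_idx \<tau> h j x) i"
    using floor_divide_real_eq_div[of 4 "(x $ i - \<tau>) / (h * 4 ^ j)"]
    by (simp add: grid_idx_def grid_par_def mult_ac)
qed

lemma finite_grid_children: "finite {v :: 'n::finite \<Rightarrow> int. grid_par v = p}"
proof (rule finite_subset)
  show "{v. grid_par v = p} \<subseteq> (\<Pi>\<^sub>E i\<in>UNIV. {4 * p i..4 * p i + 3})"
    by (auto simp: grid_par_def)
qed (auto intro: finite_PiE)

lemma grid_cell:
  assumes "h > 0"
  shows "{x. grid_idx \<tau> h j x = v} = cube (grid_centre \<tau> h j v) (h * 4 ^ j)"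
proof -
  have H: "h * 4 ^ j > 0" using assms by simp
  have "\<lfloor>(y - \<tau>) / (h * 4 ^ j)\<rfloor> = k \<longleftrightarrow>
      \<tau> + (of_int k + 1 / 2) * (h * 4 ^ j) - h * 4 ^ j / 2 \<le> y \<and> y < \<tau> + (of_int k + 1 / 2) * (h * 4 ^ j) + h * 4 ^ j / 2"
    for y k
    unfolding floor_eq_iff using H by (simp add: pos_le_divide_eq pos_divide_less_eq algebra_simps)
  then show ?thesis by (auto simp: cube_def grid_idx_def grid_centre_def fun_eq_iff)
qed

lemma good_in_borel [measurable]:
  assumes "h > 0"
  shows "(good \<tau> h N c k :: (real ^ 'n) set) \<in> sets borel"
proof -
  have idx_meas: "(grid_idx \<tau> h j :: real ^ 'n \<Rightarrow> 'n \<Rightarrow> int) \<in> borel \<rightarrow>\<^sub>M count_space UNIV" for j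
  proof (subst measurable_count_space_eq_countable[OF countableI_type], intro conjI ballI)
    fix v :: "'n \<Rightarrow> int" 
    have "grid_idx \<tau> h j -` {v} = cube (grid_centre \<tau> h j v) (h * 4 ^ j)"
      using grid_cell[OF assms, of \<tau> j v] by (auto simp: vimage_def)
    then show "(grid_idx \<tau> h j :: real ^ 'n \<Rightarrow> 'n \<Rightarrow> int) -` {v} \<inter> space borel \<in> sets borel" by simp
  qed auto
  have "{x \<in> space (borel :: (real ^ 'n) measure). c * h * 2 ^ (j + k) \<le>
     h * 4 ^ j / 2 - infnorm (x - grid_centre \<tau> h j (grid_idx \<tau> h j x))} \<in> sets borel" for j
  proof (rule borel_measurable_le)
    have "(\<lambda>x :: real ^ 'n. grid_centre \<tau> h j (grid_idx \<tau> h j x)) \<in> borel_measurable borel"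
      by (rule measurable_compose[OF idx_meas]) (simp add: measurable_count_space_eq1)
    then have "(\<lambda>x :: real ^ 'n. x - grid_centre \<tau> h j (grid_idx \<tau> h j x)) \<in> borel_measurable borel"
      by (rule borel_measurable_diff[OF measurable_ident_sets[OF refl]])
    moreover have "(infnorm :: real ^ 'n \<Rightarrow> real) \<in> borel_measurable borel"
      by (intro borel_measurable_continuous_onI continuous_intros)
    ultimately have "(\<lambda>x :: real ^ 'n. infnorm (x - grid_centre \<tau> h j (grid_idx \<tau> h j x))) \<in> borel_measurable borel"
      by (rule measurable_compose)
    then show "(\<lambda>x :: real ^ 'n. h * 4 ^ j / 2 - infnorm (x - grid_centre \<tau> h j (grid_idx \<tau> h j x))) \<in> borel_measurable borel"
      by (intro borel_measurable_diff borel_measurable_const)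
  qed (rule borel_measurable_const)
  then have "(\<Inter>j\<in>{k..N}. {x. c * h * 2 ^ (j + k) \<le>
     h * 4 ^ j / 2 - infnorm (x - grid_centre \<tau> h j (grid_idx \<tau> h j x))}) \<in> sets (borel :: (real ^ 'n) measure)"
    by (cases "{k..N} = {}") (auto intro!: sets.finite_INT)
  moreover have "good \<tau> h N c k = (\<Inter>j\<in>{k..N}. {x :: real ^ 'n. c * h * 2 ^ (j + k) \<le>
     h * 4 ^ j / 2 - infnorm (x - grid_centre \<tau> h j (grid_idx \<tau> h j x))})"
    by (auto simp: good_def)
  ultimately show ?thesis by simp
qed

lemma int_interval:
  fixes a b :: real
  assumes "a \<le> b + 1"
  shows "finite {z::int. a < z \<and> z < b}" and "real (card {z::int. a < z \<and> z < b}) \<le> b - a + 1"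
proof -
  have sub: "{z::int. a < z \<and> z < b} \<subseteq> {\<lfloor>a\<rfloor> + 1..\<lceil>b\<rceil> - 1}"
    by (auto simp: floor_less_iff less_ceiling_iff)  linarith+
  then show "finite {z::int. a < z \<and> z < b}" by (rule finite_subset) simp
  have "card {z::int. a < z \<and> z < b} \<le> card {\<lfloor>a\<rfloor> + 1..\<lceil>b\<rceil> - 1}" by (intro card_mono sub) simp
  also have "\<dots> = nat (\<lceil>b\<rceil> - 1 - \<lfloor>a\<rfloor>)" by simp
  finally have "real (card {z::int. a < z \<and> z < b}) \<le> real (nat (\<lceil>b\<rceil> - 1 - \<lfloor>a\<rfloor>))" by simp
  also have "\<dots> \<le> b - a + 1" using assms by linarith
  finally show "real (card {z::int. a < z \<and> z < b}) \<le> b - a + 1" .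
qed

text \<open>Among \<open>M\<close> equidistant points that cover at least one period \<open>H\<close>, the proportion of those within \<open>\<rho>\<close> of a lattice
of period \<open>H\<close> is of order \<open>\<rho> / H\<close>, provided that the spacing is at most \<open>\<rho>\<close>.\<close>

lemma count_near_lattice:
  fixes \<xi> \<epsilon> H \<rho> :: real
  assumes eps: "0 < \<epsilon>" "\<epsilon> \<le> \<rho>" and H: "\<rho> \<le> H / 2" "H \<le> real M * \<epsilon>"
  shows "real (card {m. m < M \<and> (\<exists>z::int. \<bar>\<xi> - real m * \<epsilon> - of_int z * H\<bar> < \<rho>)}) \<le> 9 * real M * (\<rho> / H)"
proof -
  have pos: "\<rho> > 0" "H > 0" using assms by auto
  define Z where "Z = {z::int. (\<xi> - real M * \<epsilon> - \<rho>) / H < z \<and> z < (\<xi> + \<rho>) / H}"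
  define I where "I z = {m. m < M \<and> \<bar>\<xi> - real m * \<epsilon> - of_int z * H\<bar> < \<rho>}" for z :: int
  have len: "(\<xi> - real M * \<epsilon> - \<rho>) / H \<le> (\<xi> + \<rho>) / H"
    using pos eps by (intro divide_right_mono) (auto intro: add_nonneg_nonneg order_trans[of _ 0])
  have Zfin: "finite Z" unfolding Z_def using len by (intro int_interval) auto
  have "real (card Z) \<le> (\<xi> + \<rho>) / H - (\<xi> - real M * \<epsilon> - \<rho>) / H + 1"
    unfolding Z_def using len by (intro int_interval) auto
  also have "\<dots> = real M * \<epsilon> / H + 2 * \<rho> / H + 1" using pos by (simp add: field_simps)
  also have "\<dots> \<le> 3 * (real M * \<epsilon> / H)"
  proof -
    have "1 \<le> real M * \<epsilon> / H" "2 * \<rho> / H \<le> 1" using pos H by (auto simp: field_simps)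
    moreover have "a + b + 1 \<le> 3 * a" if "1 \<le> a" "b \<le> 1" for a b :: real using that by linarith
    ultimately show ?thesis by blast
  qed
  finally have cZ: "real (card Z) \<le> 3 * (real M * \<epsilon> / H)" .
  have cI: "real (card (I z)) \<le> 3 * (\<rho> / \<epsilon>)" for z
  proof -
    let ?J = "{w::int. (\<xi> - of_int z * H - \<rho>) / \<epsilon> < w \<and> w < (\<xi> - of_int z * H + \<rho>) / \<epsilon>}"
    have l: "(\<xi> - of_int z * H - \<rho>) / \<epsilon> \<le> (\<xi> - of_int z * H + \<rho>) / \<epsilon>"
      using pos eps by (intro divide_right_mono) auto
    have "int ` I z \<subseteq> ?J"
      using eps by (auto simp: I_def abs_less_iff pos_divide_less_eq pos_less_divide_eq algebra_simps)
    then have "card (int ` I z) \<le> card ?J" using l by (intro card_mono int_interval) auto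
    then have "real (card (I z)) \<le> real (card ?J)" by (simp add: card_image)
    also have "\<dots> \<le> (\<xi> - of_int z * H + \<rho>) / \<epsilon> - (\<xi> - of_int z * H - \<rho>) / \<epsilon> + 1"
      using l by (intro int_interval) auto
    also have "\<dots> = 2 * (\<rho> / \<epsilon>) + 1" using eps by (simp add: field_simps)
    also have "\<dots> \<le> 3 * (\<rho> / \<epsilon>)" using eps by (simp add: field_simps)
    finally show ?thesis .
  qed
  have "{m. m < M \<and> (\<exists>z::int. \<bar>\<xi> - real m * \<epsilon> - of_int z * H\<bar> < \<rho>)} \<subseteq> (\<Union>z\<in>Z. I z)"
  proof safe
    fix m and z :: int assume m: "m < M" and z: "\<bar>\<xi> - real m * \<epsilon> - of_int z * H\<bar> < \<rho>"
    have "0 \<le> real m * \<epsilon>" "real m * \<epsilon> \<le> real M * \<epsilon>" using m eps by (auto intro: mult_right_mono)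
    with z have "z \<in> Z" unfolding Z_def using pos
      by (auto simp: pos_divide_less_eq pos_less_divide_eq abs_less_iff)
    then show "m \<in> (\<Union>z\<in>Z. I z)" using m z by (auto simp: I_def)
  qed
  then have "card {m. m < M \<and> (\<exists>z::int. \<bar>\<xi> - real m * \<epsilon> - of_int z * H\<bar> < \<rho>)} \<le> card (\<Union>z\<in>Z. I z)"
    using Zfin by (intro card_mono finite_UN_I) (auto simp: I_def)
  also have "\<dots> \<le> (\<Sum>z\<in>Z. card (I z))" by (rule card_UN_le[OF Zfin])
  finally have "real (card {m. m < M \<and> (\<exists>z::int. \<bar>\<xi> - real m * \<epsilon> - of_int z * H\<bar> < \<rho>)}) \<le> (\<Sum>z\<in>Z. real (card (I z)))"
    by (simp add: of_nat_sum[symmetric] del: of_nat_sum)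
  also have "\<dots> \<le> (\<Sum>z\<in>Z. 3 * (\<rho> / \<epsilon>))" by (intro sum_mono cI)
  also have "\<dots> = real (card Z) * (3 * (\<rho> / \<epsilon>))" by simp
  also have "\<dots> \<le> 3 * (real M * \<epsilon> / H) * (3 * (\<rho> / \<epsilon>))"
    using cZ pos eps by (intro mult_right_mono) auto
  also have "\<dots> = 9 * real M * (\<rho> / H)" using eps by simp
  finally show ?thesis .
qed

text \<open>In generation \<open>j\<close> and one coordinate the proportion of bad shifts is at most \<open>9 c 2\<^bsup>k-j\<^esup>\<close>.  Summed over \<open>j\<close> and the
coordinates this is \<open>18 c\<close> times the dimension, which is \<open>1/2\<close> for the chosen \<open>c\<close>.  The spacing \<open>c h\<close> is at most
as large as the widths that occur, and the shifts cover one period of the coarsest grid.\<close>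

lemma few_bad_shifts:
  fixes x :: "real ^ 'n"
  assumes h: "h > 0" and k: "k \<le> N"
    and c: "c = 1 / (36 * real CARD('n))" and M: "M = 36 * CARD('n) * 4 ^ N"
  shows "2 * card {m. m < M \<and> x \<notin> good (real m * (c * h)) h N c k} \<le> M"
proof -
  let ?n = "real CARD('n)"
  have n1: "?n \<ge> 1" using zero_less_card_finite[where 'a='n] by linarith
  have c0: "c > 0" "c \<le> 1 / 36" using n1 by (auto simp: c field_simps)
  define B where "B j i = {m. m < M \<and> (\<exists>z::int. \<bar>x $ i - real m * (c * h) - of_int z * (h * 4 ^ j)\<bar> < c * h * 2 ^ (j + k))}" for j i
  have sub: "{m. m < M \<and> x \<notin> good (real m * (c * h)) h N c k} \<subseteq> (\<Union>j\<in>{k..N}. \<Union>i\<in>UNIV. B j i)"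
  proof safe
    fix m assume m: "m < M" and bad: "x \<notin> good (real m * (c * h)) h N c k"
    let ?\<tau> = "real m * (c * h)"
    from bad obtain j where j: "j \<in> {k..N}"
      and "h * 4 ^ j / 2 - c * h * 2 ^ (j + k) < infnorm (x - grid_centre ?\<tau> h j (grid_idx ?\<tau> h j x))"
      by (auto simp: good_def)
    then obtain i where i: "h * 4 ^ j / 2 - c * h * 2 ^ (j + k) < \<bar>(x - grid_centre ?\<tau> h j (grid_idx ?\<tau> h j x)) $ i\<bar>"
      using infnorm_le_iff[of "x - grid_centre ?\<tau> h j (grid_idx ?\<tau> h j x)" "h * 4 ^ j / 2 - c * h * 2 ^ (j + k)"]
      by (auto simp: not_le)
    define H where "H = h * 4 ^ j"
    have H: "H > 0" using h by (simp add: H_def)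
    define v where "v = \<lfloor>(x $ i - ?\<tau>) / H\<rfloor>"
    have "of_int v \<le> (x $ i - ?\<tau>) / H" "(x $ i - ?\<tau>) / H < of_int v + 1"
      unfolding v_def by linarith+
    then have v: "of_int v * H \<le> x $ i - ?\<tau>" "x $ i - ?\<tau> < (of_int v + 1) * H"
      using H by (simp_all add: pos_le_divide_eq pos_divide_less_eq)
    have i': "H / 2 - c * h * 2 ^ (j + k) < \<bar>x $ i - ?\<tau> - (of_int v + 1 / 2) * H\<bar>"
      using i by (simp add: grid_centre_def grid_idx_def v_def H_def algebra_simps)
    (* In units of H the coordinate lies between v and v + 1; the witness is the nearer of the two. *)
    have "\<exists>z::int. \<bar>x $ i - ?\<tau> - of_int z * H\<bar> < c * h * 2 ^ (j + k)"
    proof (cases "x $ i - ?\<tau> - (of_int v + 1 / 2) * H \<le> 0")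
      case True
      then show ?thesis using i' v by (intro exI[of _ v]) (simp add: algebra_simps)
    next
      case False
      then show ?thesis using i' v by (intro exI[of _ "v + 1"]) (simp add: algebra_simps)
    qed
    then have "m \<in> B j i" using m by (simp add: B_def H_def)
    then show "m \<in> (\<Union>j\<in>{k..N}. \<Union>i\<in>UNIV. B j i)" using j by blast
  qed
  have cB: "real (card (B j i)) \<le> 9 * real M * (c * (1/2) ^ (j - k))" if j: "j \<in> {k..N}" for j i
  proof -
    have jk: "k \<le> j" "j \<le> N" using j by auto
    have "(2::real) ^ (j + k) \<le> 2 ^ (j + j)" using jk by (intro power_increasing) auto
    also have "\<dots> = 4 ^ j" by (simp add: power_add power_mult_distrib[symmetric])
    finally have p: "(2::real) ^ (j + k) \<le> 4 ^ j" .
    have cM: "real M * (c * h) = h * 4 ^ N" using n1 by (simp add: M c field_simps)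
    have "real (card (B j i)) \<le> 9 * real M * (c * h * 2 ^ (j + k) / (h * 4 ^ j))"
      unfolding B_def
    proof (rule count_near_lattice)
      show "0 < c * h" using c0 h by simp
      show "c * h \<le> c * h * 2 ^ (j + k)" using c0 h by simp
      have "c * h * 2 ^ (j + k) \<le> (1/2) * h * 4 ^ j" using c0 h p by (intro mult_mono) auto
      then show "c * h * 2 ^ (j + k) \<le> h * 4 ^ j / 2" by simp
      show "h * 4 ^ j \<le> real M * (c * h)" unfolding cM using h jk by (intro mult_left_mono power_increasing) auto
    qed
    also have "c * h * 2 ^ (j + k) / (h * 4 ^ j) = c * (1/2) ^ (j - k)"
    proof -
      obtain d where d: "j = k + d" using jk le_Suc_ex by blast
      have "(4::real) ^ j = 2 ^ j * 2 ^ j" by (simp add: power_mult_distrib[symmetric])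
      then show ?thesis using h d by (simp add: power_add power_divide field_simps)
    qed
    finally show ?thesis .
  qed
  have "card {m. m < M \<and> x \<notin> good (real m * (c * h)) h N c k} \<le> card (\<Union>j\<in>{k..N}. \<Union>i\<in>UNIV. B j i)"
    by (intro card_mono sub finite_UN_I) (auto simp: B_def)
  also have "\<dots> \<le> (\<Sum>j\<in>{k..N}. card (\<Union>i\<in>UNIV. B j i))" by (rule card_UN_le) simp
  also have "\<dots> \<le> (\<Sum>j\<in>{k..N}. \<Sum>i\<in>UNIV. card (B j i))" by (intro sum_mono card_UN_le) simp
  finally have "real (card {m. m < M \<and> x \<notin> good (real m * (c * h)) h N c k}) \<le> real (\<Sum>j\<in>{k..N}. \<Sum>i\<in>UNIV. card (B j i))"
    by (simp only: of_nat_le_iff)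
  also have "\<dots> = (\<Sum>j\<in>{k..N}. \<Sum>i\<in>UNIV. real (card (B j i)))" by simp
  also have "\<dots> \<le> (\<Sum>j\<in>{k..N}. \<Sum>i\<in>(UNIV::'n set). 9 * real M * (c * (1/2) ^ (j - k)))"
    by (intro sum_mono cB)
  also have "\<dots> = 9 * real M * c * ?n * (\<Sum>j\<in>{k..N}. (1/2) ^ (j - k))"
    by (simp add: sum_distrib_left mult_ac)
  also have "(\<Sum>j\<in>{k..N}. (1/2) ^ (j - k)) = (\<Sum>i\<in>{0..N - k}. (1/2::real) ^ i)"
    using k by (intro sum.reindex_bij_witness[of _ "\<lambda>i. i + k" "\<lambda>j. j - k"]) auto
  also have "9 * real M * c * ?n * (\<Sum>i\<in>{0..N - k}. (1/2::real) ^ i) \<le> 9 * real M * c * ?n * 2"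
  proof (intro mult_left_mono)
    have "(\<Sum>i\<in>{0..N - k}. (1/2::real) ^ i) \<le> (\<Sum>i. (1/2::real) ^ i)"
      by (intro sum_le_suminf summable_geometric) auto
    also have "\<dots> = 2" by (subst suminf_geometric) auto
    finally show "(\<Sum>i\<in>{0..N - k}. (1/2::real) ^ i) \<le> 2" .
  qed (use c0 in auto)
  also have "9 * real M * c * ?n * 2 = real M / 2" using n1 by (simp add: c)
  finally show ?thesis by linarith
qed

section \<open>Carleson boxes: passing from the dilated cube to the cube\<close>

lemma emeasure_lborel_infnorm_ball:
  fixes x :: "real ^ 'n"
  assumes "r > 0"
  shows "emeasure lborel {c. infnorm (c - x) < r} = ennreal ((2 * r) ^ CARD('n))"
proof -
  have eq: "{c. infnorm (c - x) < r} = box (x - (\<chi> i. r)) (x + (\<chi> i. r))"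
  proof -
    have "\<bar>(c - x) $ i\<bar> < r \<longleftrightarrow> (x - (\<chi> i. r)) $ i < c $ i \<and> c $ i < (x + (\<chi> i. r)) $ i" for c i
      unfolding vector_minus_component vector_add_component vec_lambda_beta by linarith
    then show ?thesis by (simp only: set_eq_iff mem_Collect_eq infnorm_less_iff mem_box_cart all_conj_distrib simp_thms)
  qed
  have "emeasure lborel (box (x - (\<chi> i. r)) (x + (\<chi> i. r)))
    = ennreal (\<Prod>b\<in>Basis. ((x + (\<chi> i. r)) - (x - (\<chi> i. r))) \<bullet> b)"
    using assms by (intro emeasure_lborel_box) (auto simp: Basis_vec_def inner_axis algebra_simps)
  also have "(\<Prod>b\<in>Basis. ((x + (\<chi> i. r)) - (x - (\<chi> i. r))) \<bullet> b) = (\<Prod>b\<in>(Basis :: (real^'n) set). 2 * r)"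
    by (intro prod.cong) (auto simp: Basis_vec_def inner_axis)
  finally show ?thesis by (simp add: eq)
qed

lemma cube_measurable_pred [measurable (raw)]:
  fixes f g :: "'a \<Rightarrow> real ^ 'n"
  assumes [measurable]: "f \<in> borel_measurable N" "g \<in> borel_measurable N" "l \<in> borel_measurable N"
  shows "Measurable.pred N (\<lambda>q. f q \<in> cube (g q) (l q))"
proof -
  have nth: "(\<lambda>x :: real ^ 'n. x $ i) \<in> borel_measurable borel" for i
    by (intro borel_measurable_continuous_onI continuous_intros)
  have [measurable]: "(\<lambda>q. f q $ i) \<in> borel_measurable N" "(\<lambda>q. g q $ i) \<in> borel_measurable N" for i
    by (rule measurable_compose[OF assms(1) nth], rule measurable_compose[OF assms(2) nth])
  show ?thesis unfolding cube_def mem_Collect_eq by measurable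
qed

lemma ennreal_power_mult:
  "0 \<le> a \<Longrightarrow> 0 \<le> b \<Longrightarrow> ennreal (a ^ n) * ennreal (b ^ n) = ennreal ((a * b) ^ n)"
  by (simp add: ennreal_mult power_mult_distrib)

context
  fixes \<mu> :: "(real ^ 'n) measure" and G :: "(real ^ 'n) \<times> real \<Rightarrow> ennreal" and C0 L :: real
    and p :: "real ^ 'n"
  assumes borel: "sets \<mu> = sets borel" and sf: "sigma_finite_measure \<mu>"
    and G: "G \<in> borel_measurable (\<mu> \<Otimes>\<^sub>M lborel)" and C0: "C0 \<ge> 0"
    and carleson: "\<And>c l. l > 0 \<Longrightarrow>
      (\<integral>\<^sup>+q\<in>carleson_box c l. G q \<partial>(\<mu> \<Otimes>\<^sub>M lborel)) \<le> ennreal C0 * emeasure \<mu> (cube c (3 * l))"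
begin

text \<open>A continuous form of the Whitney decomposition of the cube.  Let \<open>\<delta>\<close> be the distance to its
boundary.  The testing inequality for the cube with centre \<open>c\<close> and side \<open>\<delta>(c)/2\<close>, whose triple stays inside the given cube, is
integrated over all centres \<open>c\<close> with respect to \<open>\<delta>(c)\<^bsup>-n\<^esup> dc\<close>.  Since \<open>\<delta>\<close> is Lipschitz, the centres that see a given point
\<open>x\<close> fill a ball of radius comparable to \<open>\<delta>(x)\<close>, so that every point of the region is counted with a
multiplicity bounded from below, by \<open>(2/9)\<^sup>n\<close>, and every point of the cube with a multiplicity
bounded from above, by \<open>14\<^sup>n\<close>.  The quotient of the two constants is \<open>63\<^sup>n\<close>.\<close>

lemma whitney_packing:
  "(\<integral>\<^sup>+q\<in>{(x, t). 0 < t \<and> t \<le> (L / 2 - infnorm (x - p)) / 4}. G q \<partial>(\<mu> \<Otimes>\<^sub>M lborel))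
   \<le> ennreal (63 ^ CARD('n) * C0) * emeasure \<mu> (cube p L)"
proof -
  let ?n = "CARD('n)"
  define \<delta> where "\<delta> x = L / 2 - infnorm (x - p)" for x :: "real ^ 'n"
  define w where "w c = (if \<delta> c > 0 then (1 / \<delta> c) ^ ?n else 0)" for c
  define A where "A c q = (0 < \<delta> c \<and> fst q \<in> cube c (\<delta> c / 2) \<and> 0 < snd q \<and> snd q < \<delta> c / 2)" for c and q :: "(real^'n) \<times> real"
  define W where "W = {(x, t). 0 < t \<and> t \<le> \<delta> x / 4}"
  have \<delta>_lip: "\<delta> x \<le> \<delta> y + infnorm (x - y)" for x y
    using infnorm_diff_triangle[of y p x] by (simp add: \<delta>_def infnorm_sub[of x y])
  interpret M: sigma_finite_measure \<mu> by (rule sf)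
  interpret P: pair_sigma_finite \<mu> "lborel :: real measure" by unfold_locales
  interpret MN: pair_sigma_finite "lborel :: (real^'n) measure" "\<mu> \<Otimes>\<^sub>M (lborel :: real measure)"
    by unfold_locales
  interpret MM: pair_sigma_finite "lborel :: (real^'n) measure" \<mu>
    by unfold_locales
  have \<delta>_meas [measurable]: "\<delta> \<in> borel_measurable borel" unfolding \<delta>_def by measurable
  have w_meas [measurable]: "w \<in> borel_measurable borel" unfolding w_def by measurable
  note [measurable] = G
  have [measurable_cong]: "sets \<mu> = sets borel" by (rule borel)
  define V where "V c q = ennreal (w c) * (if A c q then 1 else 0)" for c q
  define U where "U c z = ennreal (w c) * (if 0 < \<delta> c \<and> z \<in> cube c (3 * (\<delta> c / 2)) then 1 else 0)" for c z
  have [measurable]: "fst \<in> \<mu> \<Otimes>\<^sub>M (lborel :: real measure) \<rightarrow>\<^sub>M borel"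
    using measurable_fst[of \<mu> "lborel :: real measure"] borel measurable_cong_sets by blast
  have V_meas [measurable]: "case_prod V \<in> borel_measurable ((lborel :: (real^'n) measure) \<Otimes>\<^sub>M (\<mu> \<Otimes>\<^sub>M (lborel :: real measure)))"
    unfolding V_def A_def by measurable
  have U_meas [measurable]: "case_prod U \<in> borel_measurable ((lborel :: (real^'n) measure) \<Otimes>\<^sub>M \<mu>)"
    unfolding U_def by measurable
  have W_meas [measurable]: "W \<in> sets (\<mu> \<Otimes>\<^sub>M (lborel :: real measure))"
  proof -
    have "{q \<in> space (\<mu> \<Otimes>\<^sub>M (lborel :: real measure)). 0 < snd q \<and> snd q \<le> \<delta> (fst q) / 4} \<in> sets (\<mu> \<Otimes>\<^sub>M (lborel :: real measure))"
      by measurable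
    moreover have "space (\<mu> \<Otimes>\<^sub>M (lborel :: real measure)) = UNIV"
      using sets_eq_imp_space_eq[OF borel] by (simp add: space_pair_measure)
    moreover have "W = {q. 0 < snd q \<and> snd q \<le> \<delta> (fst q) / 4}" by (auto simp: W_def)
    ultimately show ?thesis by simp
  qed
  (* On the ball of radius \<delta>(x)/8 about x, \<delta>(c) lies between 7/8 and 9/8 of \<delta>(x). *)
  have lower: "ennreal ((2 / 9) ^ ?n) \<le> (\<integral>\<^sup>+c. V c q \<partial>lborel)" if q: "q \<in> W" for q
  proof -
    obtain x t where qxt: "q = (x, t)" and t: "0 < t" "t \<le> \<delta> x / 4" using q by (auto simp: W_def)
    let ?d = "\<delta> x"
    have d: "?d > 0" using t by linarith
    let ?B = "{c. infnorm (c - x) < ?d / 8}"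
    have "8 / (9 * ?d) * (2 * (?d / 8)) = 2 / 9" using d by simp
    then have "ennreal ((2 / 9) ^ ?n) = ennreal ((8 / (9 * ?d)) ^ ?n) * ennreal ((2 * (?d / 8)) ^ ?n)"
      using d by (subst ennreal_power_mult) auto
    also have "\<dots> = (\<integral>\<^sup>+c. ennreal ((8 / (9 * ?d)) ^ ?n) * indicator ?B c \<partial>lborel)"
      using d emeasure_lborel_infnorm_ball[of "?d / 8" x]
      by (subst nn_integral_cmult_indicator) (auto simp del: less_divide_eq_numeral1)
    also have "\<dots> \<le> (\<integral>\<^sup>+c. V c q \<partial>lborel)"
    proof (rule nn_integral_mono)
      fix c
      show "ennreal ((8 / (9 * ?d)) ^ ?n) * indicator ?B c \<le> V c q"
      proof (cases "c \<in> ?B")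
        case True
        then have c: "infnorm (c - x) < ?d / 8" "infnorm (x - c) < ?d / 8" by (auto simp: infnorm_sub[of x c])
        have dc: "7 * ?d / 8 \<le> \<delta> c" "\<delta> c \<le> 9 * ?d / 8"
          using \<delta>_lip[of x c] \<delta>_lip[of c x] c by linarith+
        have "x \<in> cube c (\<delta> c / 2)" using c dc d by (intro infnorm_in_cube) linarith
        then have "A c q" using dc t d by (simp add: A_def qxt)
        moreover have "(8 / (9 * ?d)) ^ ?n \<le> w c"
        proof -
          have "8 / (9 * ?d) \<le> 1 / \<delta> c" using dc d by (simp add: field_simps)
          then show ?thesis using dc d by (auto simp: w_def intro!: power_mono)
        qed
        ultimately show ?thesis using True by (simp add: V_def ennreal_leI)
      qed simp
    qed
    finally show ?thesis .
  qed
  (* If z lies in the tripled cube about c, then \<delta>(c) lies between 4/7 and 4 times \<delta>(z). *)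
  have upper: "(\<integral>\<^sup>+c. U c z \<partial>lborel) \<le> ennreal (14 ^ ?n) * indicator (cube p L) z" for z
  proof (cases "\<delta> z > 0")
    case True
    let ?d = "\<delta> z"
    let ?B = "{c. infnorm (c - z) < 4 * ?d}"
    have zin: "z \<in> cube p L" using True by (intro infnorm_in_cube) (simp add: \<delta>_def)
    have "(\<integral>\<^sup>+c. U c z \<partial>lborel) \<le> (\<integral>\<^sup>+c. ennreal ((7 / (4 * ?d)) ^ ?n) * indicator ?B c \<partial>lborel)"
    proof (rule nn_integral_mono)
      fix c
      show "U c z \<le> ennreal ((7 / (4 * ?d)) ^ ?n) * indicator ?B c"
      proof (cases "0 < \<delta> c \<and> z \<in> cube c (3 * (\<delta> c / 2))")
        case in_cube: True
        then have "infnorm (z - c) \<le> 3 * (\<delta> c / 2) / 2" using in_cube_infnorm by blast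
        then have zc: "infnorm (z - c) \<le> 3 / 4 * \<delta> c" "infnorm (c - z) \<le> 3 / 4 * \<delta> c"
          by (auto simp: infnorm_sub[of c z])
        have dc: "\<delta> c \<le> 4 * ?d" "?d \<le> 7 / 4 * \<delta> c"
          using \<delta>_lip[of c z] \<delta>_lip[of z c] zc by linarith+
        have "c \<in> ?B" using zc dc True by simp
        moreover have "w c \<le> (7 / (4 * ?d)) ^ ?n"
        proof -
          have "1 / \<delta> c \<le> 7 / (4 * ?d)" using dc True in_cube by (simp add: field_simps)
          then show ?thesis using True by (auto simp: w_def intro!: power_mono)
        qed
        ultimately show ?thesis by (simp add: U_def ennreal_leI)
      qed (auto simp: U_def)
    qed
    also have "\<dots> = ennreal ((7 / (4 * ?d)) ^ ?n) * ennreal ((2 * (4 * ?d)) ^ ?n)"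
      using True by (subst nn_integral_cmult_indicator) (auto simp: emeasure_lborel_infnorm_ball)
    also have "\<dots> = ennreal (14 ^ ?n)"
      using True by (subst ennreal_power_mult) auto
    finally show ?thesis using zin by simp
  next
    case False
    have "U c z = 0" for c
    proof (cases "0 < \<delta> c \<and> z \<in> cube c (3 * (\<delta> c / 2))")
      case True
      then have "infnorm (z - c) \<le> 3 * (\<delta> c / 2) / 2" using in_cube_infnorm by blast
      then have "infnorm (c - z) \<le> 3 / 4 * \<delta> c" by (simp add: infnorm_sub[of c z])
      then show ?thesis using False True \<delta>_lip[of c z] by linarith
    qed (auto simp: U_def)
    then show ?thesis by simp
  qed
  have "ennreal ((2 / 9) ^ ?n) * (\<integral>\<^sup>+q\<in>W. G q \<partial>(\<mu> \<Otimes>\<^sub>M lborel))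
      = (\<integral>\<^sup>+q. ennreal ((2 / 9) ^ ?n) * (G q * indicator W q) \<partial>(\<mu> \<Otimes>\<^sub>M lborel))"
    by (rule nn_integral_cmult[symmetric]) measurable
  also have "\<dots> \<le> (\<integral>\<^sup>+q. (\<integral>\<^sup>+c. V c q * G q \<partial>lborel) \<partial>(\<mu> \<Otimes>\<^sub>M lborel))"
  proof (rule nn_integral_mono)
    fix q :: "(real^'n) \<times> real"
    have [measurable]: "(\<lambda>c. V c q) \<in> borel_measurable lborel" unfolding V_def A_def by measurable
    have "ennreal ((2 / 9) ^ ?n) * (G q * indicator W q) \<le> (\<integral>\<^sup>+c. V c q \<partial>lborel) * G q"
      using lower[of q] by (auto simp: indicator_def intro!: mult_right_mono)
    then show "ennreal ((2 / 9) ^ ?n) * (G q * indicator W q) \<le> (\<integral>\<^sup>+c. V c q * G q \<partial>lborel)"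
      by (simp add: nn_integral_multc)
  qed
  also have "\<dots> = (\<integral>\<^sup>+c. (\<integral>\<^sup>+q. V c q * G q \<partial>(\<mu> \<Otimes>\<^sub>M lborel)) \<partial>lborel)"
    by (rule MN.Fubini') measurable
  also have "\<dots> \<le> (\<integral>\<^sup>+c. (\<integral>\<^sup>+z. ennreal C0 * U c z \<partial>\<mu>) \<partial>lborel)"
  proof (rule nn_integral_mono)
    fix c
    show "(\<integral>\<^sup>+q. V c q * G q \<partial>(\<mu> \<Otimes>\<^sub>M lborel)) \<le> (\<integral>\<^sup>+z. ennreal C0 * U c z \<partial>\<mu>)"
    proof (cases "\<delta> c > 0")
      case True
      have [measurable]: "carleson_box c (\<delta> c / 2) \<in> sets (\<mu> \<Otimes>\<^sub>M (lborel :: real measure))"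
        unfolding carleson_box_def by measurable
      have "(\<integral>\<^sup>+q. V c q * G q \<partial>(\<mu> \<Otimes>\<^sub>M lborel)) = (\<integral>\<^sup>+q. ennreal (w c) * (G q * indicator (carleson_box c (\<delta> c / 2)) q) \<partial>(\<mu> \<Otimes>\<^sub>M lborel))"
        using True by (intro nn_integral_cong) (auto simp: V_def A_def carleson_box_def indicator_def)
      also have "\<dots> = ennreal (w c) * (\<integral>\<^sup>+q\<in>carleson_box c (\<delta> c / 2). G q \<partial>(\<mu> \<Otimes>\<^sub>M lborel))"
        by (rule nn_integral_cmult) measurable
      also have "\<dots> \<le> ennreal (w c) * (ennreal C0 * emeasure \<mu> (cube c (3 * (\<delta> c / 2))))"
        using True by (intro mult_left_mono carleson) auto
      also have "\<dots> = (\<integral>\<^sup>+z. (ennreal C0 * ennreal (w c)) * indicator (cube c (3 * (\<delta> c / 2))) z \<partial>\<mu>)"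
        using borel cube_in_borel by (subst nn_integral_cmult_indicator) (auto simp: mult_ac)
      also have "\<dots> = (\<integral>\<^sup>+z. ennreal C0 * U c z \<partial>\<mu>)"
        using True by (intro nn_integral_cong) (auto simp: U_def indicator_def)
      finally show ?thesis .
    qed (simp add: V_def A_def)
  qed
  also have "\<dots> = (\<integral>\<^sup>+z. (\<integral>\<^sup>+c. ennreal C0 * U c z \<partial>lborel) \<partial>\<mu>)"
    by (rule MM.Fubini'[symmetric]) measurable
  also have "\<dots> \<le> (\<integral>\<^sup>+z. ennreal C0 * ennreal (14 ^ ?n) * indicator (cube p L) z \<partial>\<mu>)"
  proof (rule nn_integral_mono)
    fix z
    have [measurable]: "(\<lambda>c. U c z) \<in> borel_measurable lborel" unfolding U_def by measurable
    have "(\<integral>\<^sup>+c. ennreal C0 * U c z \<partial>lborel) = ennreal C0 * (\<integral>\<^sup>+c. U c z \<partial>lborel)"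
      by (rule nn_integral_cmult) measurable
    also have "\<dots> \<le> ennreal C0 * (ennreal (14 ^ ?n) * indicator (cube p L) z)"
      by (intro mult_left_mono upper) auto
    finally show "(\<integral>\<^sup>+c. ennreal C0 * U c z \<partial>lborel) \<le> ennreal C0 * ennreal (14 ^ ?n) * indicator (cube p L) z"
      by (simp add: mult.assoc)
  qed
  also have "\<dots> = ennreal (14 ^ ?n * C0) * emeasure \<mu> (cube p L)"
    using C0 borel cube_in_borel by (subst nn_integral_cmult_indicator) (auto simp: ennreal_mult mult_ac)
  finally have "ennreal ((9 / 2) ^ ?n) * (ennreal ((2 / 9) ^ ?n) * (\<integral>\<^sup>+q\<in>W. G q \<partial>(\<mu> \<Otimes>\<^sub>M lborel)))
     \<le> ennreal ((9 / 2) ^ ?n) * (ennreal (14 ^ ?n * C0) * emeasure \<mu> (cube p L))"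
    by (intro mult_left_mono) auto
  moreover have "ennreal ((9 / 2) ^ ?n) * ennreal ((2 / 9) ^ ?n) = 1"
    by (subst ennreal_power_mult) auto
  moreover have "ennreal ((9 / 2) ^ ?n) * ennreal (14 ^ ?n * C0) = ennreal (63 ^ ?n * C0)"
  proof -
    have "ennreal ((9 / 2) ^ ?n) * ennreal (14 ^ ?n) = ennreal (63 ^ ?n)" by (subst ennreal_power_mult) auto
    then show ?thesis using C0 by (simp add: ennreal_mult mult.assoc[symmetric])
  qed
  ultimately show ?thesis
    unfolding mult.assoc[symmetric] by (simp add: W_def \<delta>_def)
qed

end

section \<open>Schur's test and the operators on square-integrable functions\<close>

text \<open>Cauchy--Schwarz with respect to the measure of density \<open>\<kappa> x\<close> in each row, and then Tonelli.\<close>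

lemma schur_test:
  fixes \<kappa> :: "'a \<Rightarrow> 'a \<Rightarrow> ennreal" and g :: "'a \<Rightarrow> ennreal"
  assumes sf: "sigma_finite_measure \<mu>"
    and \<kappa> [measurable]: "case_prod \<kappa> \<in> borel_measurable (\<mu> \<Otimes>\<^sub>M \<mu>)" and g [measurable]: "g \<in> borel_measurable \<mu>"
    and rows: "\<And>x. (\<integral>\<^sup>+y. \<kappa> x y \<partial>\<mu>) \<le> A" and cols: "\<And>y. (\<integral>\<^sup>+x. \<kappa> x y \<partial>\<mu>) \<le> A"
  shows "(\<integral>\<^sup>+x. (\<integral>\<^sup>+y. \<kappa> x y * g y \<partial>\<mu>)\<^sup>2 \<partial>\<mu>) \<le> A * (A * (\<integral>\<^sup>+y. (g y)\<^sup>2 \<partial>\<mu>))"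
proof -
  interpret sigma_finite_measure \<mu> by (rule sf)
  interpret P: pair_sigma_finite \<mu> \<mu> by unfold_locales
  have row_meas: "\<kappa> x \<in> borel_measurable \<mu>" if "x \<in> space \<mu>" for x
    using measurable_Pair2[OF \<kappa>, of x] that by simp
  have col_meas: "(\<lambda>x. \<kappa> x y) \<in> borel_measurable \<mu>" if "y \<in> space \<mu>" for y
    using measurable_Pair1[OF \<kappa>, of y] that by simp
  have "(\<integral>\<^sup>+x. (\<integral>\<^sup>+y. \<kappa> x y * g y \<partial>\<mu>)\<^sup>2 \<partial>\<mu>) \<le> (\<integral>\<^sup>+x. A * (\<integral>\<^sup>+y. \<kappa> x y * (g y)\<^sup>2 \<partial>\<mu>) \<partial>\<mu>)"
  proof (rule nn_integral_mono)
    fix x assume x: "x \<in> space \<mu>"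
    note [measurable] = row_meas[OF x]
    have "(\<integral>\<^sup>+y. \<kappa> x y * g y \<partial>\<mu>)\<^sup>2 = (\<integral>\<^sup>+y. 1 * g y \<partial>density \<mu> (\<kappa> x))\<^sup>2"
      by (subst nn_integral_density) auto
    also have "\<dots> \<le> (\<integral>\<^sup>+y. 1\<^sup>2 \<partial>density \<mu> (\<kappa> x)) * (\<integral>\<^sup>+y. (g y)\<^sup>2 \<partial>density \<mu> (\<kappa> x))"
      by (rule Cauchy_Schwarz_nn_integral) auto
    also have "\<dots> = (\<integral>\<^sup>+y. \<kappa> x y \<partial>\<mu>) * (\<integral>\<^sup>+y. \<kappa> x y * (g y)\<^sup>2 \<partial>\<mu>)"
      by (subst (1 2) nn_integral_density) auto
    also have "\<dots> \<le> A * (\<integral>\<^sup>+y. \<kappa> x y * (g y)\<^sup>2 \<partial>\<mu>)" by (intro mult_right_mono rows) auto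
    finally show "(\<integral>\<^sup>+y. \<kappa> x y * g y \<partial>\<mu>)\<^sup>2 \<le> A * (\<integral>\<^sup>+y. \<kappa> x y * (g y)\<^sup>2 \<partial>\<mu>)" .
  qed
  also have "\<dots> = A * (\<integral>\<^sup>+x. (\<integral>\<^sup>+y. \<kappa> x y * (g y)\<^sup>2 \<partial>\<mu>) \<partial>\<mu>)"
    by (rule nn_integral_cmult) measurable
  also have "(\<integral>\<^sup>+x. (\<integral>\<^sup>+y. \<kappa> x y * (g y)\<^sup>2 \<partial>\<mu>) \<partial>\<mu>) = (\<integral>\<^sup>+y. (\<integral>\<^sup>+x. \<kappa> x y * (g y)\<^sup>2 \<partial>\<mu>) \<partial>\<mu>)"
    by (rule P.Fubini'[symmetric]) measurable
  also have "\<dots> = (\<integral>\<^sup>+y. (\<integral>\<^sup>+x. \<kappa> x y \<partial>\<mu>) * (g y)\<^sup>2 \<partial>\<mu>)"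
    by (intro nn_integral_cong nn_integral_multc col_meas)
  also have "\<dots> \<le> (\<integral>\<^sup>+y. A * (g y)\<^sup>2 \<partial>\<mu>)" by (intro nn_integral_mono mult_right_mono cols) auto
  also have "\<dots> = A * (\<integral>\<^sup>+y. (g y)\<^sup>2 \<partial>\<mu>)" by (rule nn_integral_cmult) measurable
  finally show ?thesis by (simp add: mult_left_mono)
qed

text \<open>With geometric weights \<open>r\<close> this turns decay of the individual terms into a bound for their sum.\<close>

lemma weighted_sum_sq_le:
  fixes z :: "'c \<Rightarrow> ennreal" and r :: "'c \<Rightarrow> real"
  assumes fin: "finite I" and r: "\<And>i. i \<in> I \<Longrightarrow> r i > 0"
  shows "(\<Sum>i\<in>I. z i)\<^sup>2 \<le> ennreal (\<Sum>i\<in>I. r i) * (\<Sum>i\<in>I. ennreal (1 / r i) * (z i)\<^sup>2)"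
proof (cases "\<exists>i\<in>I. z i = \<infinity>")
  case True
  then obtain i where i: "i \<in> I" "z i = \<infinity>" by blast
  have "(\<Sum>i\<in>I. r i) > 0" using i r fin by (intro sum_pos) auto
  moreover have "(\<Sum>i\<in>I. ennreal (1 / r i) * (z i)\<^sup>2) = \<infinity>"
  proof -
    have "ennreal (1 / r i) * (z i)\<^sup>2 = \<infinity>" using i r[of i] by (simp add: ennreal_mult_eq_top_iff power2_eq_square)
    moreover have "ennreal (1 / r i) * (z i)\<^sup>2 \<le> (\<Sum>i\<in>I. ennreal (1 / r i) * (z i)\<^sup>2)"
      using i fin by (intro member_le_sum) auto
    ultimately show ?thesis by (simp add: top_unique)
  qed
  ultimately show ?thesis by (simp add: ennreal_mult_eq_top_iff)
next
  case False
  have r0: "r i \<ge> 0" if "i \<in> I" for i using r[OF that] by simp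
  define u where "u i = enn2real (z i)" for i
  have u: "z i = ennreal (u i)" "u i \<ge> 0" if "i \<in> I" for i
    using False that by (auto simp: u_def less_top)
  have "(\<Sum>i\<in>I. z i)\<^sup>2 = ennreal ((\<Sum>i\<in>I. u i)\<^sup>2)"
    using u by (simp add: sum_ennreal ennreal_power sum_nonneg cong: sum.cong)
  also have "\<dots> \<le> ennreal ((\<Sum>i\<in>I. r i) * (\<Sum>i\<in>I. (u i)\<^sup>2 / r i))"
  proof (rule ennreal_leI, cases "I = {}")
    case False
    have pos: "(\<Sum>i\<in>I. r i) > 0" using fin r False by (intro sum_pos) auto
    have "(\<Sum>i\<in>I. u i)\<^sup>2 / (\<Sum>i\<in>I. r i) \<le> (\<Sum>i\<in>I. (u i)\<^sup>2 / r i)"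
      using fin r by (intro sum_square_div_le) (force dest: less_imp_le)+
    then show "(\<Sum>i\<in>I. u i)\<^sup>2 \<le> (\<Sum>i\<in>I. r i) * (\<Sum>i\<in>I. (u i)\<^sup>2 / r i)"
      using pos by (simp add: pos_divide_le_eq mult.commute)
  qed simp
  also have "\<dots> = ennreal (\<Sum>i\<in>I. r i) * (\<Sum>i\<in>I. ennreal (1 / r i) * (z i)\<^sup>2)"
  proof -
    have "(\<Sum>i\<in>I. ennreal (1 / r i) * (z i)\<^sup>2) = (\<Sum>i\<in>I. ennreal ((u i)\<^sup>2 / r i))"
      using u r by (intro sum.cong) (auto simp: ennreal_power ennreal_mult[symmetric] less_imp_le)
    also have "\<dots> = ennreal (\<Sum>i\<in>I. (u i)\<^sup>2 / r i)"
      using r0 by (intro sum_ennreal) auto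
    finally show ?thesis using r0 by (subst ennreal_mult) (auto intro!: sum_nonneg)
  qed
  finally show ?thesis .
qed

locale kernel_setting = doubling_setting \<mu> lam C_lam \<alpha>
  for \<mu> :: "(real ^ 'n) measure" and lam :: "real ^ 'n \<Rightarrow> real \<Rightarrow> real" and C_lam \<alpha> :: real +
  fixes s :: "real \<Rightarrow> real ^ 'n \<Rightarrow> real ^ 'n \<Rightarrow> complex" and C1 :: real
  assumes kernel: "square_function_kernel lam \<alpha> C1 s" and C1_nonneg: "C1 \<ge> 0"
begin

lemma sets_cong [measurable_cong]: "sets \<mu> = sets borel" by (rule borel_mu)

lemma fst_borel [measurable]: "fst \<in> \<mu> \<Otimes>\<^sub>M (lborel :: real measure) \<rightarrow>\<^sub>M borel"
  using measurable_fst[of \<mu> "lborel :: real measure"] borel_mu measurable_cong_sets by blast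

sublocale SF: sigma_finite_measure \<mu> by (rule sigma_finite)

sublocale MT: pair_sigma_finite \<mu> "lborel :: real measure" by unfold_locales

lemma kernel_size: "t > 0 \<Longrightarrow> norm (s t x y) \<le> C1 * K t x y"
  using kernel by (simp add: square_function_kernel_def K_def)

lemma kernel_smooth:
  assumes "t > 0" "infnorm (y - z) < t / 2"
  shows "norm (s t x y - s t x z) \<le> C1 * (infnorm (y - z) / t) powr \<alpha> * K t x y"
proof -
  have "norm (s t x y - s t x z) \<le> C1 * (infnorm (y - z) powr \<alpha> / kernel_denom lam \<alpha> t x y)"
    using kernel assms by (simp add: square_function_kernel_def)
  also have "infnorm (y - z) powr \<alpha> / kernel_denom lam \<alpha> t x y = (infnorm (y - z) / t) powr \<alpha> * K t x y"
    using assms(1) by (simp add: K_def powr_divide infnorm_pos_le)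
  finally show ?thesis by (simp add: mult.assoc)
qed

text \<open>The kernel is measurable on the half-space of positive \<open>t\<close> only; composing with the map that sends
\<open>t \<le> 0\<close> to \<open>1\<close> extends it to a Borel function.\<close>

lemma kernel_measurable:
  "(\<lambda>(x, y, t). if t > 0 then s t x y else 0) \<in> borel_measurable (borel \<Otimes>\<^sub>M borel \<Otimes>\<^sub>M borel)"
proof -
  have s: "(\<lambda>(x, y, t). s t x y) \<in> borel_measurable (borel \<Otimes>\<^sub>M borel \<Otimes>\<^sub>M restrict_space borel {0<..})"
    using kernel by (simp add: square_function_kernel_def)
  define T where "T t = (if t > 0 then t else 1)" for t :: real
  have T: "T \<in> borel \<rightarrow>\<^sub>M restrict_space borel {0<..}"
  proof (intro measurable_restrict_space2)
    show "T \<in> borel_measurable borel" unfolding T_def by measurable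
  qed (auto simp: T_def)
  have "(\<lambda>(x, y, t). (x, y, T t)) \<in> borel \<Otimes>\<^sub>M borel \<Otimes>\<^sub>M borel \<rightarrow>\<^sub>M borel \<Otimes>\<^sub>M borel \<Otimes>\<^sub>M restrict_space borel {0<..}"
    using T by measurable
  from measurable_compose[OF this s]
  have [measurable]: "(\<lambda>q. s (T (snd (snd q))) (fst q) (fst (snd q))) \<in> borel_measurable (borel \<Otimes>\<^sub>M borel \<Otimes>\<^sub>M borel)"
    by (simp add: case_prod_beta)
  have "(\<lambda>q. if snd (snd q) > 0 then s (T (snd (snd q))) (fst q) (fst (snd q)) else 0) \<in> borel_measurable (borel \<Otimes>\<^sub>M borel \<Otimes>\<^sub>M borel)"
    by measurable
  also have "(\<lambda>q. if snd (snd q) > 0 then s (T (snd (snd q))) (fst q) (fst (snd q)) else 0) = (\<lambda>(x, y, t). if t > 0 then s t x y else 0)"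
    by (auto simp: T_def fun_eq_iff)
  finally show ?thesis .
qed

lemma kernel_measurable_xy:
  assumes "t > 0"
  shows "(\<lambda>(x, y). s t x y) \<in> borel_measurable (borel \<Otimes>\<^sub>M borel)"
proof -
  have "(\<lambda>(x, y). (x, y, t)) \<in> borel \<Otimes>\<^sub>M borel \<rightarrow>\<^sub>M borel \<Otimes>\<^sub>M borel \<Otimes>\<^sub>M borel" by measurable
  from measurable_compose[OF this kernel_measurable] show ?thesis
    using assms by (simp add: case_prod_beta)
qed

lemma kernel_measurable_y [measurable (raw)]:
  assumes "t > 0" and f: "f \<in> borel_measurable N"
  shows "(\<lambda>y. s t x (f y)) \<in> borel_measurable N"
proof -
  have "(\<lambda>y. (x, f y)) \<in> N \<rightarrow>\<^sub>M borel \<Otimes>\<^sub>M borel" using f by measurable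
  from measurable_compose[OF this kernel_measurable_xy[OF assms(1)]] show ?thesis by simp
qed

text \<open>The integrand of the square function, set to \<open>0\<close> for \<open>t \<le> 0\<close>, where nothing is known about \<open>s\<close>.\<close>

definition density_at :: "(real ^ 'n \<Rightarrow> complex) \<Rightarrow> real ^ 'n \<Rightarrow> real \<Rightarrow> ennreal" where
  "density_at f x t = (if t > 0 then ennreal ((norm (theta \<mu> s t f x))\<^sup>2 / t) else 0)"

lemma density_at_measurable:
  assumes [measurable]: "f \<in> borel_measurable borel"
  shows "(\<lambda>(x, t). density_at f x t) \<in> borel_measurable (\<mu> \<Otimes>\<^sub>M lborel)"
proof -
  define s' where "s' t x y = (if t > 0 then s t x y else 0)" for t x y
  have m: "(\<lambda>q. (fst (fst q), snd q, snd (fst q))) \<in> (\<mu> \<Otimes>\<^sub>M lborel) \<Otimes>\<^sub>M \<mu> \<rightarrow>\<^sub>M borel \<Otimes>\<^sub>M borel \<Otimes>\<^sub>M borel"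
    by measurable
  have [measurable]: "(\<lambda>q. s' (snd (fst q)) (fst (fst q)) (snd q)) \<in> borel_measurable ((\<mu> \<Otimes>\<^sub>M lborel) \<Otimes>\<^sub>M \<mu>)"
    using measurable_compose[OF m kernel_measurable] by (simp add: s'_def)
  have [measurable]: "(\<lambda>q. \<integral>y. s' (snd q) (fst q) y * f y \<partial>\<mu>) \<in> borel_measurable (\<mu> \<Otimes>\<^sub>M lborel)"
  proof (rule SF.borel_measurable_lebesgue_integral)
    have [measurable]: "(\<lambda>q. f (snd q)) \<in> borel_measurable ((\<mu> \<Otimes>\<^sub>M (lborel :: real measure)) \<Otimes>\<^sub>M \<mu>)"
      by measurable
    have "(\<lambda>q. s' (snd (fst q)) (fst (fst q)) (snd q) * f (snd q)) \<in> borel_measurable ((\<mu> \<Otimes>\<^sub>M lborel) \<Otimes>\<^sub>M \<mu>)"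
      by measurable
    then show "(\<lambda>(q, y). s' (snd q) (fst q) y * f y) \<in> borel_measurable ((\<mu> \<Otimes>\<^sub>M lborel) \<Otimes>\<^sub>M \<mu>)"
      by (simp add: case_prod_beta)
  qed
  have "(\<lambda>q. if snd q > 0 then ennreal ((norm (\<integral>y. s' (snd q) (fst q) y * f y \<partial>\<mu>))\<^sup>2 / snd q) else 0)
     \<in> borel_measurable (\<mu> \<Otimes>\<^sub>M lborel)"
    by measurable
  also have "(\<lambda>q. if snd q > 0 then ennreal ((norm (\<integral>y. s' (snd q) (fst q) y * f y \<partial>\<mu>))\<^sup>2 / snd q) else 0)
     = (\<lambda>(x, t). density_at f x t)"
    by (auto simp: density_at_def theta_def s'_def fun_eq_iff)
  finally show ?thesis .
qed

lemma square_integral_eq: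
  assumes "A \<subseteq> UNIV \<times> {0<..}"
  shows "square_integral \<mu> s f A = (\<integral>\<^sup>+q\<in>A. (case q of (x, t) \<Rightarrow> density_at f x t) \<partial>(\<mu> \<Otimes>\<^sub>M lborel))"
  unfolding square_integral_def
  using assms by (intro nn_integral_cong) (auto simp: density_at_def indicator_def)

text \<open>The function \<open>u\<close> is bounded and integrable, hence square integrable, and \<open>2 \<bar>u g\<bar> \<le> \<bar>u\<bar>\<^sup>2 + \<bar>g\<bar>\<^sup>2\<close>.\<close>

lemma integrable_kernel_bound:
  fixes u g :: "real ^ 'n \<Rightarrow> complex"
  assumes t: "t > 0" and D: "D \<ge> 0" and [measurable]: "u \<in> borel_measurable borel" "g \<in> borel_measurable borel"
    and u: "\<And>y. norm (u y) \<le> D * K t x y"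
    and g: "sqint \<mu> g < \<infinity>"
  shows "integrable \<mu> (\<lambda>y. u y * g y)"
proof (rule integrableI_bounded)
  have L: "lam x t > 0" by (rule lam_pos[OF t])
  have "(\<integral>\<^sup>+y. ennreal (norm (u y * g y)) \<partial>\<mu>)
     \<le> (\<integral>\<^sup>+y. ennreal (D / lam x t) * ennreal (norm (u y)) + sqnorm (g y) \<partial>\<mu>)"
  proof (rule nn_integral_mono)
    fix y
    have "norm (u y) \<le> D / lam x t"
      using u[of y] mult_left_mono[OF K_le[OF t, of x y] D] by simp
    then have "norm (u y) * norm (u y) \<le> D / lam x t * norm (u y)" by (intro mult_right_mono) auto
    moreover have "norm (u y) * norm (g y) \<le> norm (u y) * norm (u y) + (norm (g y))\<^sup>2"
    proof -
      have "0 \<le> (norm (u y) - norm (g y))\<^sup>2 + (norm (u y))\<^sup>2 + (norm (g y))\<^sup>2" by simp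
      then show ?thesis by (simp add: power2_eq_square algebra_simps)
    qed
    ultimately have "norm (u y * g y) \<le> D / lam x t * norm (u y) + (norm (g y))\<^sup>2" by (simp add: norm_mult)
    then have "ennreal (norm (u y * g y)) \<le> ennreal (D / lam x t * norm (u y) + (norm (g y))\<^sup>2)" by (rule ennreal_leI)
    also have "\<dots> = ennreal (D / lam x t) * ennreal (norm (u y)) + sqnorm (g y)"
      using D L by (subst ennreal_plus) (auto simp: ennreal_mult[symmetric])
    finally show "ennreal (norm (u y * g y)) \<le> ennreal (D / lam x t) * ennreal (norm (u y)) + sqnorm (g y)" .
  qed
  also have "\<dots> = ennreal (D / lam x t) * (\<integral>\<^sup>+y. ennreal (norm (u y)) \<partial>\<mu>) + (sqint \<mu> g)"
    by (simp add: nn_integral_add nn_integral_cmult)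
  also have "\<dots> < \<infinity>"
  proof -
    have "(\<integral>\<^sup>+y. ennreal (norm (u y)) \<partial>\<mu>) \<le> ennreal (D * (1 + tail_const))"
      by (intro K_integral_le[OF t D, where x = x] ennreal_leI u)
    then have "(\<integral>\<^sup>+y. ennreal (norm (u y)) \<partial>\<mu>) < \<infinity>"
      by (simp add: order_le_less_trans)
    then show ?thesis using g by (simp add: ennreal_mult_less_top)
  qed
  finally show "(\<integral>\<^sup>+y. ennreal (norm (u y * g y)) \<partial>\<mu>) < \<infinity>" .
qed measurable

lemma integrable_kernel_L2:
  assumes "t > 0" "g \<in> borel_measurable borel" "sqint \<mu> g < \<infinity>"
  shows "integrable \<mu> (\<lambda>y. s t x y * g y)"
  using assms C1_nonneg
  by (intro integrable_kernel_bound[where D = C1 and x = x]) (auto intro: kernel_size)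

lemma kernel_bounded_integral:
  assumes t: "t > 0" and [measurable]: "g \<in> borel_measurable borel" and B: "B \<ge> 0"
    and g: "AE y in \<mu>. norm (g y) \<le> B"
  shows "integrable \<mu> (\<lambda>y. s t x y * g y)"
    and "norm (theta \<mu> s t g x) \<le> C1 * B * (1 + tail_const)"
proof -
  note [measurable] = kernel_measurable_y[OF t]
  have "(\<integral>\<^sup>+y. ennreal (norm (s t x y * g y)) \<partial>\<mu>) \<le> (\<integral>\<^sup>+y. ennreal (B * norm (s t x y)) \<partial>\<mu>)"
    using g by (intro nn_integral_mono_AE) (auto elim!: eventually_mono simp: norm_mult mult.commute intro!: ennreal_leI mult_right_mono)
  also have "\<dots> \<le> ennreal (B * C1 * (1 + tail_const))"
  proof (rule K_integral_le[OF t])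
    fix y show "ennreal (B * norm (s t x y)) \<le> ennreal (B * C1 * K t x y)"
      using mult_left_mono[OF kernel_size[OF t, of x y] B] by (intro ennreal_leI) (simp add: mult.assoc)
  qed (use B C1_nonneg in auto)
  finally have le: "(\<integral>\<^sup>+y. ennreal (norm (s t x y * g y)) \<partial>\<mu>) \<le> ennreal (B * C1 * (1 + tail_const))" .
  show int: "integrable \<mu> (\<lambda>y. s t x y * g y)"
  proof (rule integrableI_bounded)
    show "(\<integral>\<^sup>+y. ennreal (norm (s t x y * g y)) \<partial>\<mu>) < \<infinity>"
      by (rule order_le_less_trans[OF le]) simp
  qed measurable
  have "ennreal (norm (theta \<mu> s t g x)) \<le> ennreal (B * C1 * (1 + tail_const))"
    unfolding theta_def by (rule order_trans[OF integral_norm_bound_ennreal[OF int] le])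
  then show "norm (theta \<mu> s t g x) \<le> C1 * B * (1 + tail_const)"
    using B C1_nonneg tail_const_pos by (simp add: mult_ac)
qed

end

section \<open>One grid: decomposing the operator\<close>

lemma norm_diff_square_le: "(norm (a - b))\<^sup>2 \<le> 2 * (norm a)\<^sup>2 + 2 * (norm b)\<^sup>2"
  by (rule order_trans[OF power_mono[OF norm_triangle_ineq4] square_sum_le]) simp

lemma nn_integral_diff_square_le:
  assumes [measurable]: "f \<in> borel_measurable M" "g \<in> borel_measurable M"
  shows "(\<integral>\<^sup>+x. sqnorm (f x - g x) \<partial>M)
    \<le> 2 * (\<integral>\<^sup>+x. sqnorm (f x) \<partial>M) + 2 * (\<integral>\<^sup>+x. sqnorm (g x) \<partial>M)"
proof -
  have "(\<integral>\<^sup>+x. sqnorm (f x - g x) \<partial>M)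
    \<le> (\<integral>\<^sup>+x. 2 * sqnorm (f x) + 2 * sqnorm (g x) \<partial>M)"
  proof (rule nn_integral_mono)
    fix x
    have "sqnorm (f x - g x) \<le> ennreal (2 * (norm (f x))\<^sup>2 + 2 * (norm (g x))\<^sup>2)"
      by (intro ennreal_leI norm_diff_square_le)
    then show "sqnorm (f x - g x) \<le> 2 * sqnorm (f x) + 2 * sqnorm (g x)"
      by (simp add: ennreal_mult)
  qed
  then show ?thesis by (simp add: nn_integral_add nn_integral_cmult)
qed

locale tb_setting = kernel_setting \<mu> lam C_lam \<alpha> s C1
  for \<mu> :: "(real ^ 'n) measure" and lam C_lam \<alpha> s C1 +
  fixes b :: "real ^ 'n \<Rightarrow> complex" and c0 C0 M :: real
  assumes b_meas [measurable]: "b \<in> borel_measurable borel"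
    and b_bound: "AE x in \<mu>. norm (b x) \<le> M" and M_pos: "M > 0"
    and c0_pos: "c0 > 0" and C0_nonneg: "C0 \<ge> 0"
    and accretive: "\<And>c l. l > 0 \<Longrightarrow> c0 * measure \<mu> (cube c l) \<le> norm (\<integral>x\<in>cube c l. b x \<partial>\<mu>)"
    and testing: "\<And>c l. l > 0 \<Longrightarrow>
      square_integral \<mu> s b (carleson_box c l) \<le> ennreal C0 * emeasure \<mu> (cube c (3 * l))"
begin

lemma cube_in_sets [measurable]: "cube c l \<in> sets \<mu>"
  using cube_in_borel borel_mu by auto

lemma emeasure_cube_finite: "emeasure \<mu> (cube c l) < \<infinity>"
proof -
  have "cube c l \<subseteq> linf_ball c (\<bar>l\<bar> + 1)"
  proof
    fix x assume "x \<in> cube c l"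
    then have "infnorm (x - c) \<le> l / 2" by (rule in_cube_infnorm)
    then show "x \<in> linf_ball c (\<bar>l\<bar> + 1)" by (simp add: linf_ball_def infnorm_sub[of c x])
  qed
  then have "emeasure \<mu> (cube c l) \<le> emeasure \<mu> (linf_ball c (\<bar>l\<bar> + 1))"
    by (intro emeasure_mono ball_sets)
  also have "\<dots> \<le> ennreal (lam c (\<bar>l\<bar> + 1))" by (intro lam_ball) auto
  finally show ?thesis by (rule order_le_less_trans) simp
qed

lemma nn_integral_mult_b_sq:
  assumes [measurable]: "u \<in> borel_measurable borel"
  shows "(\<integral>\<^sup>+x. sqnorm (u x * b x) \<partial>\<mu>) \<le> ennreal (M\<^sup>2) * (sqint \<mu> u)"
proof -
  have "(\<integral>\<^sup>+x. sqnorm (u x * b x) \<partial>\<mu>) \<le> (\<integral>\<^sup>+x. ennreal (M\<^sup>2) * sqnorm (u x) \<partial>\<mu>)"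
  proof (rule nn_integral_mono_AE, use b_bound in eventually_elim)
    fix x assume x: "norm (b x) \<le> M"
    have "(norm (b x))\<^sup>2 * (norm (u x))\<^sup>2 \<le> M\<^sup>2 * (norm (u x))\<^sup>2"
      using x by (intro mult_right_mono power_mono) auto
    then show "sqnorm (u x * b x) \<le> ennreal (M\<^sup>2) * sqnorm (u x)"
      by (simp add: ennreal_mult[symmetric] norm_mult power_mult_distrib mult.commute ennreal_leI)
  qed
  then show ?thesis by (simp add: nn_integral_cmult)
qed

text \<open>The relative distance to the boundary for which \<open>few_bad_shifts\<close> leaves enough good shifts.\<close>

definition sep :: real where "sep = 1 / (36 * real CARD('n))"

lemma sep: "0 < sep" "sep \<le> 1"
proof -
  define n where "n = real CARD('n)"
  have "n \<ge> 1" using zero_less_card_finite[where 'a='n] unfolding n_def by linarith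
  then show "0 < sep" "sep \<le> 1" unfolding sep_def n_def[symmetric] by (auto simp: divide_le_eq)
qed

definition schur_const :: real where "schur_const = 2 * C_lam * (1 + tail_const) * C1"

lemma schur_const_nonneg: "schur_const \<ge> 0" using C_lam_ge_1 tail_const_pos C1_nonneg by (simp add: schur_const_def)

lemma cell_tree_grid:
  assumes "h > 0"
  shows "cell_tree \<mu> (grid_idx \<tau> h) grid_par"
proof
  show "space \<mu> = UNIV" by simp
  show "{x. grid_idx \<tau> h j x = v} \<in> sets \<mu>" for j v unfolding grid_cell[OF assms] by simp
  show "emeasure \<mu> {x. grid_idx \<tau> h j x = v} < \<infinity>" for j v
    unfolding grid_cell[OF assms] by (rule emeasure_cube_finite)
qed (auto simp: grid_idx_Suc finite_grid_children)

end

locale grid_setting = tb_setting \<mu> lam C_lam \<alpha> s C1 b c0 C0 M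
  for \<mu> :: "(real ^ 'n) measure" and lam C_lam \<alpha> s C1 b c0 C0 M +
  fixes \<tau> h :: real and N :: nat and f :: "real ^ 'n \<Rightarrow> complex"
  assumes h_pos: "h > 0" and f_meas [measurable]: "f \<in> borel_measurable borel"
    and f_L2: "sqint \<mu> f < \<infinity>"
begin

sublocale cell_tree \<mu> "grid_idx \<tau> h" grid_par
  by (rule cell_tree_grid[OF h_pos])

abbreviation "F \<equiv> (sqint \<mu> f)"
abbreviation "idx \<equiv> grid_idx \<tau> h"
abbreviation "centre \<equiv> grid_centre \<tau> h"

definition adapted_avg :: "nat \<Rightarrow> real ^ 'n \<Rightarrow> complex" where "adapted_avg j x = coef j b f (idx j x) * b x"
definition adapted_diff :: "nat \<Rightarrow> real ^ 'n \<Rightarrow> complex" where "adapted_diff j = coef_diff N j b f"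

lemma cell_eq_cube: "cell j v = cube (centre j v) (h * 4 ^ j)"
  unfolding cell_def by (rule grid_cell[OF h_pos])

lemma side_pos: "h * 4 ^ j > 0" using h_pos by simp

lemma idx_compose_borel [measurable (raw)]: "(\<lambda>x :: real ^ 'n. A (idx j x)) \<in> borel_measurable borel"
  using idx_compose_measurable[of A j] by simp

lemma adapted_diff_meas [measurable]: "adapted_diff j \<in> borel_measurable borel"
  using coef_diff_measurable[of N j b f] by (simp add: adapted_diff_def)

lemma adapted_avg_meas [measurable]: "adapted_avg j \<in> borel_measurable borel"
  unfolding adapted_avg_def by measurable

lemma f_local: "local_L2 f" using local_L2I[of f] f_L2 by simp

lemma b_sq: "(\<integral>\<^sup>+x\<in>cell j v. sqnorm (b x) \<partial>\<mu>) \<le> ennreal (M\<^sup>2 * mass j v)"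
proof -
  have "(\<integral>\<^sup>+x\<in>cell j v. sqnorm (b x) \<partial>\<mu>) \<le> (\<integral>\<^sup>+x. ennreal (M\<^sup>2) * indicator (cell j v) x \<partial>\<mu>)"
    by (rule nn_integral_mono_AE, use b_bound in eventually_elim)
       (auto intro!: mult_right_mono ennreal_leI power_mono)
  then show ?thesis by (simp add: nn_integral_cmult_indicator emeasure_cell ennreal_mult)
qed

lemma b_local: "local_L2 b"
  unfolding local_L2_def
proof (intro conjI allI)
  fix j v show "(\<integral>\<^sup>+x\<in>cell j v. sqnorm (b x) \<partial>\<mu>) < \<infinity>"
    by (rule order_le_less_trans[OF b_sq]) simp
qed simp

lemma accretive_cell: "c0 * mass j v \<le> norm (cint j b v)"
  unfolding mass_def cint_def cell_eq_cube by (rule accretive[OF side_pos])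

lemma adapted_avg_L2: "sqint \<mu> (adapted_avg j) \<le> ennreal (M\<^sup>2 / c0\<^sup>2) * F"
proof -
  have "sqint \<mu> (adapted_avg j) \<le> ennreal (M\<^sup>2) * (\<integral>\<^sup>+x. sqnorm (coef j b f (idx j x)) \<partial>\<mu>)"
    unfolding adapted_avg_def by (rule nn_integral_mult_b_sq) measurable
  also have "\<dots> \<le> ennreal (M\<^sup>2) * (ennreal (1 / c0\<^sup>2) * F)"
    by (intro mult_left_mono coef_L2[OF f_local b_local c0_pos M_pos accretive_cell b_sq]) auto
  also have "\<dots> = ennreal (M\<^sup>2 / c0\<^sup>2) * F"
    by (simp add: mult.assoc[symmetric] ennreal_mult[symmetric])
  finally show ?thesis .
qed

lemma adapted_avg_fin: "sqint \<mu> (adapted_avg j) < \<infinity>"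
  by (rule order_le_less_trans[OF adapted_avg_L2]) (use f_L2 in \<open>simp add: ennreal_mult_less_top\<close>)

lemma adapted_avg_local: "local_L2 (adapted_avg j)" using local_L2I[of "adapted_avg j"] adapted_avg_fin[of j] by simp

lemma f_minus_adapted_avg_fin: "(\<integral>\<^sup>+x. sqnorm (f x - adapted_avg j x) \<partial>\<mu>) < \<infinity>"
  by (rule order_le_less_trans[OF nn_integral_diff_square_le]) (use f_L2 adapted_avg_fin[of j] in \<open>simp_all add: ennreal_mult_less_top\<close>)

text \<open>The function \<open>adapted_avg j\<close> has the same integrals as \<open>f\<close> over the cells of generation \<open>j\<close>, hence over those
of all coarser generations.\<close>

lemma cint_adapted_avg: "cint (j + i) (adapted_avg j) v = cint (j + i) f v"
proof (induction i arbitrary: v)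
  case 0
  have "cint j (adapted_avg j) v = (LINT x:cell j v|\<mu>. coef j b f v * b x)"
    unfolding cint_def by (rule set_lebesgue_integral_cong[OF cell_in_sets]) (auto simp: adapted_avg_def cell_def)
  also have "\<dots> = coef j b f v * cint j b v" unfolding cint_def by simp
  also have "\<dots> = cint j f v"
  proof (cases "mass j v = 0")
    case True
    then show ?thesis using cint_null[OF f_local True] cint_null[OF b_local True] by simp
  next
    case False
    then have "mass j v > 0" using mass_nonneg[of j v] by linarith
    then have "c0 * mass j v > 0" using c0_pos by simp
    then have "cint j b v \<noteq> 0" using accretive_cell[of j v] by auto
    then show ?thesis by (simp add: coef_def)
  qed
  finally show ?case by simp
next
  case (Suc i)
  show ?case using Suc by (simp add: cint_Suc[OF adapted_avg_local] cint_Suc[OF f_local])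
qed

lemma mean_zero:
  assumes "j \<le> i" shows "cint i (\<lambda>x. f x - adapted_avg j x) v = 0"
  using cint_adapted_avg[of j "i - j" v] assms by (simp add: cint_diff[OF f_local adapted_avg_local])

lemma adapted_diff_mult_b: "j < N \<Longrightarrow> adapted_diff j x * b x = adapted_avg j x - adapted_avg (Suc j) x"
  by (simp add: adapted_diff_def coef_diff_def adapted_avg_def left_diff_distrib)

lemma mean_zero_adapted_diff:
  assumes "j < N" shows "cint (Suc j) (\<lambda>x. adapted_diff j x * b x) v = 0"
  using cint_adapted_avg[of j 1 v] cint_adapted_avg[of "Suc j" 0 v]
  unfolding adapted_diff_mult_b[OF assms] by (simp add: cint_diff[OF adapted_avg_local adapted_avg_local])

lemma adapted_diff_b_fin:
  assumes "j < N" shows "(\<integral>\<^sup>+x. sqnorm (adapted_diff j x * b x) \<partial>\<mu>) < \<infinity>"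
  unfolding adapted_diff_mult_b[OF assms]
  by (rule order_le_less_trans[OF nn_integral_diff_square_le]) (use adapted_avg_fin[of j] adapted_avg_fin[of "Suc j"] in \<open>simp_all add: ennreal_mult_less_top\<close>)

text \<open>Subtracting the value of the kernel at the centre of the cell of \<open>y\<close> costs nothing against a function with mean
zero on cells.\<close>

definition fine_kernel :: "nat \<Rightarrow> real \<Rightarrow> real ^ 'n \<Rightarrow> real ^ 'n \<Rightarrow> ennreal" where
  "fine_kernel i t x y = ennreal (norm (s t x y - s t x (centre i (idx i y))))"

definition far_kernel :: "real \<Rightarrow> real \<Rightarrow> real ^ 'n \<Rightarrow> real ^ 'n \<Rightarrow> ennreal" where
  "far_kernel \<rho> t x y = ennreal (norm (s t x y)) * indicator {y. \<rho> \<le> infnorm (x - y)} y"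

lemma kernel_measurable_pair:
  assumes t: "t > 0" and [measurable]: "p \<in> borel_measurable Z" "q \<in> borel_measurable Z"
  shows "(\<lambda>z. s t (p z) (q z)) \<in> borel_measurable Z"
proof -
  have "(\<lambda>z. (p z, q z)) \<in> Z \<rightarrow>\<^sub>M borel \<Otimes>\<^sub>M borel" by measurable
  from measurable_compose[OF this kernel_measurable_xy[OF t]] show ?thesis by simp
qed

lemma centre_meas [measurable]: "(\<lambda>y :: real ^ 'n. centre i (idx i y)) \<in> borel_measurable borel"
  by (rule idx_compose_borel)

lemma fine_kernel_meas:
  assumes t: "t > 0"
  shows "case_prod (fine_kernel i t) \<in> borel_measurable (\<mu> \<Otimes>\<^sub>M \<mu>)"
proof -
  have [measurable]: "(\<lambda>z. s t (fst z) (snd z)) \<in> borel_measurable (\<mu> \<Otimes>\<^sub>M \<mu>)"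
    by (rule kernel_measurable_pair[OF t]) measurable
  have [measurable]: "(\<lambda>z. s t (fst z) (centre i (idx i (snd z)))) \<in> borel_measurable (\<mu> \<Otimes>\<^sub>M \<mu>)"
  proof (rule kernel_measurable_pair[OF t])
    have "snd \<in> \<mu> \<Otimes>\<^sub>M \<mu> \<rightarrow>\<^sub>M (borel :: (real ^ 'n) measure)" by measurable
    from measurable_compose[OF this centre_meas]
    show "(\<lambda>z. centre i (idx i (snd z))) \<in> borel_measurable (\<mu> \<Otimes>\<^sub>M \<mu>)" .
  qed measurable
  show ?thesis unfolding fine_kernel_def case_prod_beta by measurable
qed

lemma far_kernel_meas:
  assumes t: "t > 0"
  shows "case_prod (far_kernel \<rho> t) \<in> borel_measurable (\<mu> \<Otimes>\<^sub>M \<mu>)"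
proof -
  have [measurable]: "(\<lambda>z. s t (fst z) (snd z)) \<in> borel_measurable (\<mu> \<Otimes>\<^sub>M \<mu>)"
    by (rule kernel_measurable_pair[OF t]) measurable
  have "(\<lambda>z. ennreal (norm (s t (fst z) (snd z))) * (if \<rho> \<le> infnorm (fst z - snd z) then 1 else 0)) \<in> borel_measurable (\<mu> \<Otimes>\<^sub>M \<mu>)"
    by measurable
  also have "(\<lambda>z. ennreal (norm (s t (fst z) (snd z))) * (if \<rho> \<le> infnorm (fst z - snd z) then 1 else 0)) = case_prod (far_kernel \<rho> t)"
    by (auto simp: far_kernel_def fun_eq_iff indicator_def)
  finally show ?thesis .
qed

lemma infnorm_centre:
  fixes y :: "real ^ 'n"
  shows "infnorm (y - centre i (idx i y)) \<le> h * 4 ^ i / 2"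
proof (rule in_cube_infnorm)
  show "y \<in> cube (centre i (idx i y)) (h * 4 ^ i)"
    unfolding cell_eq_cube[symmetric] by (simp add: cell_def)
qed

lemma fine_kernel_diff_le:
  assumes t: "h * 4 ^ i < t"
  shows "norm (s t x y - s t x (centre i (idx i y))) \<le> C1 * (h * 4 ^ i / t) powr \<alpha> * K t x y"
proof -
  have t0: "t > 0" using t side_pos[of i] by linarith
  have "infnorm (y - centre i (idx i y)) < t / 2" using infnorm_centre[of y i] t by linarith
  then have "norm (s t x y - s t x (centre i (idx i y))) \<le> C1 * (infnorm (y - centre i (idx i y)) / t) powr \<alpha> * K t x y"
    by (rule kernel_smooth[OF t0])
  also have "\<dots> \<le> C1 * (h * 4 ^ i / t) powr \<alpha> * K t x y"
  proof (intro mult_right_mono mult_left_mono powr_mono2 divide_right_mono)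
    show "infnorm (y - centre i (idx i y)) \<le> h * 4 ^ i" using infnorm_centre[of y i] side_pos[of i] by linarith
  qed (use t0 alpha_pos C1_nonneg K_nonneg[OF t0] in \<open>auto simp: infnorm_pos_le\<close>)
  finally show ?thesis .
qed

text \<open>The function \<open>y \<mapsto> s t x (centre i (idx i y))\<close> is constant on cells of generation \<open>i\<close> and therefore annihilates \<open>g\<close>.\<close>

lemma theta_mean_zero_le:
  assumes t: "h * 4 ^ i < t" and g [measurable]: "g \<in> borel_measurable borel"
    and fin: "sqint \<mu> g < \<infinity>" and zero: "\<And>v. cint i g v = 0"
  shows "ennreal (norm (theta \<mu> s t g x)) \<le> (\<integral>\<^sup>+y. fine_kernel i t x y * ennreal (norm (g y)) \<partial>\<mu>)"
proof -
  have t0: "t > 0" using t side_pos[of i] by linarith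
  note [measurable] = kernel_measurable_y[OF t0]
  have int1: "integrable \<mu> (\<lambda>y. s t x y * g y)" by (rule integrable_kernel_L2[OF t0 g fin])
  have int2: "integrable \<mu> (\<lambda>y. s t x (centre i (idx i y)) * g y)"
  proof (rule integrable_kernel_bound[OF t0 _ _ g _ fin, where D = "2 * C1" and x = x])
    show "(\<lambda>y. s t x (centre i (idx i y))) \<in> borel_measurable borel" by measurable
    fix y
    have "(h * 4 ^ i / t) powr \<alpha> \<le> 1" using t side_pos[of i] alpha_pos t0 h_pos by (intro powr_le1) auto
    then have "C1 * (h * 4 ^ i / t) powr \<alpha> * K t x y \<le> C1 * 1 * K t x y"
      using C1_nonneg K_nonneg[OF t0, of x y] by (intro mult_right_mono mult_left_mono) auto
    then have "norm (s t x y - s t x (centre i (idx i y))) \<le> C1 * K t x y"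
      using fine_kernel_diff_le[OF t, of x y] by simp
    moreover have "norm (s t x (centre i (idx i y))) \<le> norm (s t x y) + norm (s t x y - s t x (centre i (idx i y)))"
      by (metis norm_minus_commute norm_triangle_sub)
    ultimately show "norm (s t x (centre i (idx i y))) \<le> 2 * C1 * K t x y"
      using kernel_size[OF t0, of x y] by simp
  qed (use C1_nonneg in simp)
  have zero2: "(LINT y|\<mu>. s t x (centre i (idx i y)) * g y) = 0"
  proof (rule integral_zero_cells[OF int2])
    fix v
    have "cint i (\<lambda>y. s t x (centre i (idx i y)) * g y) v = (LINT y:cell i v|\<mu>. s t x (centre i v) * g y)"
      unfolding cint_def by (rule set_lebesgue_integral_cong[OF cell_in_sets]) (auto simp: cell_def)
    also have "\<dots> = s t x (centre i v) * cint i g v" by (simp add: cint_def)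
    finally show "cint i (\<lambda>y. s t x (centre i (idx i y)) * g y) v = 0" by (simp add: zero)
  qed
  have "theta \<mu> s t g x = (LINT y|\<mu>. s t x y * g y - s t x (centre i (idx i y)) * g y)"
    unfolding theta_def Bochner_Integration.integral_diff[OF int1 int2] zero2 by simp
  then have "ennreal (norm (theta \<mu> s t g x)) \<le> (\<integral>\<^sup>+y. ennreal (norm (s t x y * g y - s t x (centre i (idx i y)) * g y)) \<partial>\<mu>)"
    using integral_norm_bound_ennreal[OF Bochner_Integration.integrable_diff[OF int1 int2]] by simp
  also have "\<dots> = (\<integral>\<^sup>+y. fine_kernel i t x y * ennreal (norm (g y)) \<partial>\<mu>)"
    by (intro nn_integral_cong) (simp add: fine_kernel_def ennreal_mult[symmetric] norm_mult[symmetric] left_diff_distrib)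
  finally show ?thesis .
qed

lemma fine_kernel_L2:
  assumes t: "h * 4 ^ i < t" and [measurable]: "g \<in> borel_measurable borel"
  shows "(\<integral>\<^sup>+x. (\<integral>\<^sup>+y. fine_kernel i t x y * ennreal (norm (g y)) \<partial>\<mu>)\<^sup>2 \<partial>\<mu>)
    \<le> ennreal ((schur_const * (h * 4 ^ i / t) powr \<alpha>)\<^sup>2) * (sqint \<mu> g)"
proof -
  have t0: "t > 0" using t side_pos[of i] by linarith
  let ?D = "C1 * (h * 4 ^ i / t) powr \<alpha>"
  have D: "?D \<ge> 0" using C1_nonneg by simp
  have \<kappa>: "fine_kernel i t x y \<le> ennreal (?D * K t x y)" for x y
    unfolding fine_kernel_def by (intro ennreal_leI fine_kernel_diff_le t)
  have "(\<integral>\<^sup>+x. (\<integral>\<^sup>+y. fine_kernel i t x y * ennreal (norm (g y)) \<partial>\<mu>)\<^sup>2 \<partial>\<mu>)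
    \<le> ennreal (2 * C_lam * (1 + tail_const) * ?D) * (ennreal (2 * C_lam * (1 + tail_const) * ?D) * (\<integral>\<^sup>+y. (ennreal (norm (g y)))\<^sup>2 \<partial>\<mu>))"
    by (intro schur_test sigma_finite fine_kernel_meas t0 marginals_near[OF t0 D \<kappa>]) auto
  also have "2 * C_lam * (1 + tail_const) * ?D = schur_const * (h * 4 ^ i / t) powr \<alpha>" by (simp add: schur_const_def)
  finally show ?thesis
    using schur_const_nonneg by (simp add: mult.assoc[symmetric] ennreal_mult[symmetric] power2_eq_square[symmetric] ennreal_power del: power2_eq_square)
qed

lemma far_kernel_marginals:
  assumes t: "t > 0" and \<rho>: "\<rho> > 0"
  shows "(\<integral>\<^sup>+y. far_kernel \<rho> t x y \<partial>\<mu>) \<le> ennreal (schur_const * (t / \<rho>) powr \<alpha>)"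
    and "(\<integral>\<^sup>+x. far_kernel \<rho> t x y \<partial>\<mu>) \<le> ennreal (schur_const * (t / \<rho>) powr \<alpha>)"
proof -
  have \<kappa>: "far_kernel \<rho> t x y \<le> ennreal (C1 * K t x y) * indicator {y. \<rho> \<le> infnorm (x - y)} y" for x y
    unfolding far_kernel_def by (intro mult_right_mono ennreal_leI kernel_size t) auto
  have A: "2 * C_lam * (1 + tail_const) * C1 * (t / \<rho>) powr \<alpha> = schur_const * (t / \<rho>) powr \<alpha>" by (simp add: schur_const_def)
  note m = marginals_far[OF t \<rho> C1_nonneg \<kappa>, unfolded A]
  show "(\<integral>\<^sup>+y. far_kernel \<rho> t x y \<partial>\<mu>) \<le> ennreal (schur_const * (t / \<rho>) powr \<alpha>)" by (rule m)
  show "(\<integral>\<^sup>+x. far_kernel \<rho> t x y \<partial>\<mu>) \<le> ennreal (schur_const * (t / \<rho>) powr \<alpha>)" by (rule m)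
qed

lemma far_kernel_L2:
  assumes t: "t > 0" and \<rho>: "\<rho> > 0" and [measurable]: "g \<in> borel_measurable borel"
  shows "(\<integral>\<^sup>+x. (\<integral>\<^sup>+y. far_kernel \<rho> t x y * ennreal (norm (g y)) \<partial>\<mu>)\<^sup>2 \<partial>\<mu>)
    \<le> ennreal ((schur_const * (t / \<rho>) powr \<alpha>)\<^sup>2) * (sqint \<mu> g)"
proof -
  have "(\<integral>\<^sup>+x. (\<integral>\<^sup>+y. far_kernel \<rho> t x y * ennreal (norm (g y)) \<partial>\<mu>)\<^sup>2 \<partial>\<mu>)
    \<le> ennreal (schur_const * (t / \<rho>) powr \<alpha>) * (ennreal (schur_const * (t / \<rho>) powr \<alpha>) * (\<integral>\<^sup>+y. (ennreal (norm (g y)))\<^sup>2 \<partial>\<mu>))"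
    by (intro schur_test sigma_finite far_kernel_meas t far_kernel_marginals \<rho>) auto
  then show ?thesis
    using schur_const_nonneg by (simp add: mult.assoc[symmetric] ennreal_mult[symmetric] power2_eq_square[symmetric] ennreal_power del: power2_eq_square)
qed

end

lemma ennreal_square_sum_le: "((a::ennreal) + b)\<^sup>2 \<le> 2 * a\<^sup>2 + 2 * b\<^sup>2"
proof (cases "a = \<infinity> \<or> b = \<infinity>")
  case True
  then show ?thesis by (auto simp: power2_eq_square ennreal_mult_top ennreal_top_mult)
next
  case False
  then obtain u v where uv: "a = ennreal u" "u \<ge> 0" "b = ennreal v" "v \<ge> 0"
    by (cases a; cases b) auto
  then have "(a + b)\<^sup>2 = ennreal ((u + v)\<^sup>2)" by (simp add: ennreal_power ennreal_plus[symmetric] del: ennreal_plus)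
  also have "\<dots> \<le> ennreal (2 * u\<^sup>2 + 2 * v\<^sup>2)" by (intro ennreal_leI square_sum_le)
  also have "\<dots> = 2 * a\<^sup>2 + 2 * b\<^sup>2" using uv by (simp add: ennreal_mult ennreal_power)
  finally show ?thesis .
qed

context tb_setting
begin

text \<open>\<open>q\<close> is the gain per generation.\<close>

definition q :: real where "q = 2 powr (- \<alpha>)"

text \<open>Large enough for the three cases of \<open>rem_term_L2\<close>: the factors \<open>2\<close> and \<open>M\<close> occur in the coarse terms, and
\<open>4 / sep\<close> is the loss in the ratio \<open>t / rho j k\<close>.\<close>

definition remainder_const :: real where "remainder_const = 2 * (M + 1) * schur_const * (4 / sep) powr \<alpha>"

lemma q: "0 < q" "q < 1" using two_powr_less_1 by (auto simp: q_def)

lemma decay_powr: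
  assumes "0 \<le> a" "a \<le> 4 / sep * (1 / 2) ^ m"
  shows "a powr \<alpha> \<le> (4 / sep) powr \<alpha> * q ^ m"
proof -
  have "a powr \<alpha> \<le> (4 / sep * (1 / 2) ^ m) powr \<alpha>" using assms alpha_pos by (intro powr_mono2) auto
  also have "\<dots> = (4 / sep) powr \<alpha> * ((1 / 2) ^ m) powr \<alpha>" using sep by (intro powr_mult)
  also have "((1 / 2) ^ m) powr \<alpha> = q ^ m"
  proof -
    have "((1 / 2) ^ m) powr \<alpha> = ((1 / 2) powr real m) powr \<alpha>" by (simp only: powr_realpow)
    also have "\<dots> = ((1 / 2) powr \<alpha>) powr real m" by (simp only: powr_powr mult.commute)
    also have "\<dots> = ((1 / 2) powr \<alpha>) ^ m" by (rule powr_realpow) simp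
    also have "(1 / 2) powr \<alpha> = q" by (simp add: q_def powr_divide powr_minus_divide)
    finally show ?thesis .
  qed
  finally show ?thesis .
qed

end

context grid_setting
begin

text \<open>By \<open>good_separates\<close>, a point that is good at scale \<open>k\<close> is at least this far from all points
outside its cell of generation \<open>j\<close>.\<close>

definition rho :: "nat \<Rightarrow> nat \<Rightarrow> real" where "rho j k = sep * h * 2 ^ (j + k)"

lemma rho_pos: "rho j k > 0" using sep h_pos by (simp add: rho_def)

lemma adapted_diff_cong: "idx j x = idx j y \<Longrightarrow> adapted_diff j x = adapted_diff j y"
  by (simp add: adapted_diff_def coef_diff_def idx_Suc)

text \<open>No boundary term remains, because the coefficient above generation \<open>N\<close> counts as \<open>0\<close>.\<close>

lemma coef_eq_sum: "k \<le> N \<Longrightarrow> coef k b f (idx k x) = (\<Sum>j\<in>{k..N}. adapted_diff j x)"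
proof (induction rule: inc_induct)
  case base
  show ?case by (simp add: adapted_diff_def coef_diff_def)
next
  case (step n)
  then show ?case by (simp add: sum.atLeast_Suc_atMost[of n N] adapted_diff_def coef_diff_def)
qed

lemma good_separates:
  fixes x y :: "real ^ 'n"
  assumes x: "x \<in> good \<tau> h N sep k" and j: "j \<in> {k..N}" and ne: "idx j x \<noteq> idx j y"
  shows "rho j k \<le> infnorm (x - y)"
proof -
  have "y \<notin> cube (centre j (idx j x)) (h * 4 ^ j)"
    using ne unfolding cell_eq_cube[symmetric] by (auto simp: cell_def)
  then have "h * 4 ^ j / 2 \<le> infnorm (y - centre j (idx j x))" using infnorm_in_cube by (meson not_le)
  also have "\<dots> \<le> infnorm (x - y) + infnorm (x - centre j (idx j x))"
    using infnorm_diff_triangle[of y "centre j (idx j x)" x] by (simp add: infnorm_sub[of y x])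
  finally have "h * 4 ^ j / 2 \<le> infnorm (x - y) + infnorm (x - centre j (idx j x))" .
  moreover have "rho j k \<le> h * 4 ^ j / 2 - infnorm (x - centre j (idx j x))"
    using x j unfolding good_def rho_def by blast
  ultimately show ?thesis by linarith
qed

definition far_term :: "nat \<Rightarrow> real \<Rightarrow> nat \<Rightarrow> real ^ 'n \<Rightarrow> ennreal" where
  "far_term k t j x = ennreal M * ((\<integral>\<^sup>+y. far_kernel (rho j k) t x y * ennreal (norm (adapted_diff j y)) \<partial>\<mu>)
     + ennreal (norm (adapted_diff j x)) * (\<integral>\<^sup>+y. far_kernel (rho j k) t x y \<partial>\<mu>))"

text \<open>The index \<open>0\<close> stands for the part of \<open>f\<close> below the finest generation and \<open>Suc j\<close> for the differences
of generation \<open>j\<close>.\<close>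

definition rem_term :: "nat \<Rightarrow> real \<Rightarrow> nat \<Rightarrow> real ^ 'n \<Rightarrow> ennreal" where
  "rem_term k t i x = (case i of
      0 \<Rightarrow> (\<integral>\<^sup>+y. fine_kernel 0 t x y * ennreal (norm (f y - adapted_avg 0 y)) \<partial>\<mu>)
    | Suc j \<Rightarrow> if j < k then (\<integral>\<^sup>+y. fine_kernel (Suc j) t x y * ennreal (norm (adapted_diff j y * b y)) \<partial>\<mu>)
               else far_term k t j x)"

text \<open>Replacing the coefficient function by its value at \<open>x\<close> produces, for each \<open>j \<ge> k\<close>, the difference
\<open>adapted_diff j y - adapted_diff j x\<close>.  It vanishes for \<open>y\<close> in the cell of generation \<open>j\<close> around \<open>x\<close>, and the other \<open>y\<close> are far
away.\<close>

lemma coarse_remainder: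
  assumes x: "x \<in> good \<tau> h N sep k" and k: "k \<le> N" and t: "t > 0"
  shows "ennreal (norm (theta \<mu> s t (adapted_avg k) x - coef k b f (idx k x) * theta \<mu> s t b x)) \<le> (\<Sum>j\<in>{k..N}. far_term k t j x)"
proof -
  note [measurable] = kernel_measurable_y[OF t]
  have [measurable]: "far_kernel \<rho> t x \<in> borel_measurable borel" for \<rho>
  proof -
    have "(\<lambda>y. ennreal (norm (s t x y)) * (if \<rho> \<le> infnorm (x - y) then 1 else 0)) \<in> borel_measurable borel"
      by measurable
    also have "(\<lambda>y. ennreal (norm (s t x y)) * (if \<rho> \<le> infnorm (x - y) then 1 else 0)) = far_kernel \<rho> t x"
      by (auto simp: far_kernel_def fun_eq_iff indicator_def)
    finally show ?thesis .
  qed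
  let ?a = "coef k b f (idx k x)"
  have int1: "integrable \<mu> (\<lambda>y. s t x y * adapted_avg k y)" by (rule integrable_kernel_L2[OF t adapted_avg_meas adapted_avg_fin])
  have int2: "integrable \<mu> (\<lambda>y. s t x y * b y)"
    by (rule kernel_bounded_integral[OF t b_meas _ b_bound]) (use M_pos in simp)
  have int3: "integrable \<mu> (\<lambda>y. ?a * (s t x y * b y))" by (intro integrable_mult_right int2)
  have "theta \<mu> s t (adapted_avg k) x - ?a * theta \<mu> s t b x = (LINT y|\<mu>. s t x y * adapted_avg k y - ?a * (s t x y * b y))"
    unfolding theta_def Bochner_Integration.integral_diff[OF int1 int3] by simp
  then have "ennreal (norm (theta \<mu> s t (adapted_avg k) x - ?a * theta \<mu> s t b x))
      \<le> (\<integral>\<^sup>+y. ennreal (norm (s t x y * adapted_avg k y - ?a * (s t x y * b y))) \<partial>\<mu>)"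
    using integral_norm_bound_ennreal[OF Bochner_Integration.integrable_diff[OF int1 int3]] by simp
  also have "\<dots> \<le> (\<integral>\<^sup>+y. (\<Sum>j\<in>{k..N}. ennreal M * (far_kernel (rho j k) t x y * ennreal (norm (adapted_diff j y))
       + ennreal (norm (adapted_diff j x)) * far_kernel (rho j k) t x y)) \<partial>\<mu>)"
  proof (rule nn_integral_mono_AE, use b_bound in eventually_elim)
    fix y assume y: "norm (b y) \<le> M"
    have "s t x y * adapted_avg k y - ?a * (s t x y * b y) = (\<Sum>j\<in>{k..N}. s t x y * (adapted_diff j y - adapted_diff j x) * b y)"
      by (simp add: adapted_avg_def coef_eq_sum[OF k] sum_distrib_left sum_distrib_right sum_subtractf[symmetric] algebra_simps)
    then have "norm (s t x y * adapted_avg k y - ?a * (s t x y * b y)) \<le> (\<Sum>j\<in>{k..N}. norm (s t x y * (adapted_diff j y - adapted_diff j x) * b y))"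
      by (simp add: norm_sum)
    then have "ennreal (norm (s t x y * adapted_avg k y - ?a * (s t x y * b y))) \<le> (\<Sum>j\<in>{k..N}. ennreal (norm (s t x y * (adapted_diff j y - adapted_diff j x) * b y)))"
      by (simp add: ennreal_leI)
    also have "\<dots> \<le> (\<Sum>j\<in>{k..N}. ennreal M * (far_kernel (rho j k) t x y * ennreal (norm (adapted_diff j y))
       + ennreal (norm (adapted_diff j x)) * far_kernel (rho j k) t x y))"
    proof (rule sum_mono)
      fix j assume j: "j \<in> {k..N}"
      show "ennreal (norm (s t x y * (adapted_diff j y - adapted_diff j x) * b y)) \<le> ennreal M * (far_kernel (rho j k) t x y * ennreal (norm (adapted_diff j y))
       + ennreal (norm (adapted_diff j x)) * far_kernel (rho j k) t x y)"
      proof (cases "idx j x = idx j y")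
        case True
        then show ?thesis using adapted_diff_cong[OF True] by simp
      next
        case False
        then have far: "far_kernel (rho j k) t x y = ennreal (norm (s t x y))"
          using good_separates[OF x j] by (simp add: far_kernel_def)
        have "norm (s t x y * (adapted_diff j y - adapted_diff j x) * b y) = norm (s t x y) * norm (adapted_diff j y - adapted_diff j x) * norm (b y)"
          by (simp add: norm_mult)
        also have "\<dots> \<le> norm (s t x y) * (norm (adapted_diff j y) + norm (adapted_diff j x)) * M"
          using y by (intro mult_mono mult_left_mono norm_triangle_ineq4) auto
        also have "\<dots> = M * (norm (s t x y) * norm (adapted_diff j y) + norm (adapted_diff j x) * norm (s t x y))"
          by (simp add: algebra_simps)
        finally have "ennreal (norm (s t x y * (adapted_diff j y - adapted_diff j x) * b y))
            \<le> ennreal (M * (norm (s t x y) * norm (adapted_diff j y) + norm (adapted_diff j x) * norm (s t x y)))"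
          by (rule ennreal_leI)
        then show ?thesis unfolding far using M_pos by (simp add: ennreal_mult)
      qed
    qed
    finally show "ennreal (norm (s t x y * adapted_avg k y - ?a * (s t x y * b y))) \<le> (\<Sum>j\<in>{k..N}. ennreal M * (far_kernel (rho j k) t x y * ennreal (norm (adapted_diff j y))
       + ennreal (norm (adapted_diff j x)) * far_kernel (rho j k) t x y))" .
  qed
  also have "\<dots> = (\<Sum>j\<in>{k..N}. far_term k t j x)"
    by (simp add: nn_integral_sum nn_integral_cmult nn_integral_add far_term_def)
  finally show ?thesis .
qed

text \<open>Telescoping gives \<open>f = (f - adapted_avg 0) + (\<Sum>j<k. adapted_diff j * b) + adapted_avg k\<close>.  The first two parts
consist of functions with mean zero on cells smaller than \<open>t\<close>, and the last one is treated by \<open>coarse_remainder\<close>.\<close>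

theorem theta_decomposition:
  assumes x: "x \<in> good \<tau> h N sep k" and k: "k \<le> N" and t: "h * 4 ^ k < t"
  shows "ennreal (norm (theta \<mu> s t f x))
    \<le> ennreal (norm (coef k b f (idx k x)) * norm (theta \<mu> s t b x)) + (\<Sum>i\<le>Suc N. rem_term k t i x)"
proof -
  have t0: "t > 0" using t side_pos[of k] by linarith
  have fine_t: "h * 4 ^ i < t" if "i \<le> k" for i
  proof -
    have "h * 4 ^ i \<le> h * 4 ^ k" using h_pos that by (intro mult_left_mono power_increasing) auto
    then show ?thesis using t by linarith
  qed
  have int0: "integrable \<mu> (\<lambda>y. s t x y * (f y - adapted_avg 0 y))"
    by (rule integrable_kernel_L2[OF t0 _ f_minus_adapted_avg_fin]) measurable
  have intd: "integrable \<mu> (\<lambda>y. s t x y * (adapted_diff j y * b y))" if "j < k" for j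
    using that k by (intro integrable_kernel_L2[OF t0 _ adapted_diff_b_fin]) auto
  have intE: "integrable \<mu> (\<lambda>y. s t x y * adapted_avg k y)" by (rule integrable_kernel_L2[OF t0 adapted_avg_meas adapted_avg_fin])
  have "f y = (f y - adapted_avg 0 y) + (\<Sum>j<k. adapted_diff j y * b y) + adapted_avg k y" for y
  proof -
    have "(\<Sum>j<k. adapted_diff j y * b y) = (\<Sum>j<k. adapted_avg j y - adapted_avg (Suc j) y)"
      using k by (intro sum.cong) (auto simp: adapted_diff_mult_b)
    also have "\<dots> = adapted_avg 0 y - adapted_avg k y" by (rule sum_lessThan_telescope')
    finally show ?thesis by simp
  qed
  then have "s t x y * f y = s t x y * (f y - adapted_avg 0 y) + (\<Sum>j<k. s t x y * (adapted_diff j y * b y)) + s t x y * adapted_avg k y" for y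
    by (metis distrib_left sum_distrib_left)
  then have "theta \<mu> s t f x = (LINT y|\<mu>. s t x y * (f y - adapted_avg 0 y) + (\<Sum>j<k. s t x y * (adapted_diff j y * b y)) + s t x y * adapted_avg k y)"
    unfolding theta_def by presburger
  also have "\<dots> = theta \<mu> s t (\<lambda>y. f y - adapted_avg 0 y) x + (\<Sum>j<k. theta \<mu> s t (\<lambda>y. adapted_diff j y * b y) x) + theta \<mu> s t (adapted_avg k) x"
  proof -
    have ints: "integrable \<mu> (\<lambda>y. \<Sum>j<k. s t x y * (adapted_diff j y * b y))"
      by (intro Bochner_Integration.integrable_sum intd) simp
    have "(LINT y|\<mu>. (\<Sum>j<k. s t x y * (adapted_diff j y * b y))) = (\<Sum>j<k. (LINT y|\<mu>. s t x y * (adapted_diff j y * b y)))"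
      by (intro Bochner_Integration.integral_sum intd) simp
    then show ?thesis
      unfolding theta_def Bochner_Integration.integral_add[OF Bochner_Integration.integrable_add[OF int0 ints] intE]
        Bochner_Integration.integral_add[OF int0 ints] by simp
  qed
  finally have eq: "theta \<mu> s t f x = theta \<mu> s t (\<lambda>y. f y - adapted_avg 0 y) x + (\<Sum>j<k. theta \<mu> s t (\<lambda>y. adapted_diff j y * b y) x) + theta \<mu> s t (adapted_avg k) x" .
  have "norm (theta \<mu> s t (adapted_avg k) x) \<le> norm (theta \<mu> s t (adapted_avg k) x - coef k b f (idx k x) * theta \<mu> s t b x) + norm (coef k b f (idx k x)) * norm (theta \<mu> s t b x)"
    using norm_triangle_ineq[of "theta \<mu> s t (adapted_avg k) x - coef k b f (idx k x) * theta \<mu> s t b x" "coef k b f (idx k x) * theta \<mu> s t b x"]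
    by (simp add: norm_mult)
  moreover have "norm (\<Sum>j<k. theta \<mu> s t (\<lambda>y. adapted_diff j y * b y) x) \<le> (\<Sum>j<k. norm (theta \<mu> s t (\<lambda>y. adapted_diff j y * b y) x))"
    by (rule norm_sum)
  moreover have "norm (theta \<mu> s t f x) \<le> norm (theta \<mu> s t (\<lambda>y. f y - adapted_avg 0 y) x) + norm (\<Sum>j<k. theta \<mu> s t (\<lambda>y. adapted_diff j y * b y) x) + norm (theta \<mu> s t (adapted_avg k) x)"
    unfolding eq by (rule order_trans[OF norm_triangle_ineq add_right_mono[OF norm_triangle_ineq]])
  ultimately have "norm (theta \<mu> s t f x) \<le> norm (theta \<mu> s t (\<lambda>y. f y - adapted_avg 0 y) x) + (\<Sum>j<k. norm (theta \<mu> s t (\<lambda>y. adapted_diff j y * b y) x))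
     + (norm (theta \<mu> s t (adapted_avg k) x - coef k b f (idx k x) * theta \<mu> s t b x) + norm (coef k b f (idx k x)) * norm (theta \<mu> s t b x))"
    by linarith
  then have "ennreal (norm (theta \<mu> s t f x)) \<le> ennreal (norm (theta \<mu> s t (\<lambda>y. f y - adapted_avg 0 y) x)) + (\<Sum>j<k. ennreal (norm (theta \<mu> s t (\<lambda>y. adapted_diff j y * b y) x)))
     + (ennreal (norm (theta \<mu> s t (adapted_avg k) x - coef k b f (idx k x) * theta \<mu> s t b x)) + ennreal (norm (coef k b f (idx k x)) * norm (theta \<mu> s t b x)))"
    by (simp add: ennreal_plus[symmetric] sum_nonneg ennreal_leI del: ennreal_plus)
  also have "\<dots> \<le> rem_term k t 0 x + (\<Sum>j<k. rem_term k t (Suc j) x)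
     + ((\<Sum>j\<in>{k..N}. rem_term k t (Suc j) x) + ennreal (norm (coef k b f (idx k x)) * norm (theta \<mu> s t b x)))"
  proof (intro add_mono sum_mono order_refl)
    show "ennreal (norm (theta \<mu> s t (\<lambda>y. f y - adapted_avg 0 y) x)) \<le> rem_term k t 0 x"
      unfolding rem_term_def nat.case
      by (rule theta_mean_zero_le[OF fine_t _ f_minus_adapted_avg_fin mean_zero]) auto
    show "ennreal (norm (theta \<mu> s t (\<lambda>y. adapted_diff j y * b y) x)) \<le> rem_term k t (Suc j) x" if "j \<in> {..<k}" for j
    proof -
      have "ennreal (norm (theta \<mu> s t (\<lambda>y. adapted_diff j y * b y) x)) \<le> (\<integral>\<^sup>+y. fine_kernel (Suc j) t x y * ennreal (norm (adapted_diff j y * b y)) \<partial>\<mu>)"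
        using that k by (intro theta_mean_zero_le[OF fine_t _ adapted_diff_b_fin mean_zero_adapted_diff]) auto
      then show ?thesis using that by (simp add: rem_term_def)
    qed
    have "(\<Sum>j\<in>{k..N}. far_term k t j x) = (\<Sum>j\<in>{k..N}. rem_term k t (Suc j) x)"
      by (intro sum.cong) (auto simp: rem_term_def)
    then show "ennreal (norm (theta \<mu> s t (adapted_avg k) x - coef k b f (idx k x) * theta \<mu> s t b x)) \<le> (\<Sum>j\<in>{k..N}. rem_term k t (Suc j) x)"
      using coarse_remainder[OF x k t0] by simp
  qed
  also have "\<dots> = ennreal (norm (coef k b f (idx k x)) * norm (theta \<mu> s t b x)) + (\<Sum>i\<le>Suc N. rem_term k t i x)"
  proof -
    have "{..N} = {..<k} \<union> {k..N}" using k by auto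
    then have "(\<Sum>j\<le>N. rem_term k t (Suc j) x) = (\<Sum>j<k. rem_term k t (Suc j) x) + (\<Sum>j\<in>{k..N}. rem_term k t (Suc j) x)"
      by (simp add: sum.union_disjoint ivl_disj_int)
    then show ?thesis unfolding sum.atMost_Suc_shift by (simp only: ac_simps)
  qed
  finally show ?thesis .
qed

definition weight :: "nat \<Rightarrow> nat \<Rightarrow> real" where
  "weight k i = (case i of 0 \<Rightarrow> q ^ k | Suc j \<Rightarrow> q ^ (if j < k then k - j else j - k))"
definition energy :: "nat \<Rightarrow> ennreal" where
  "energy i = (case i of 0 \<Rightarrow> (\<integral>\<^sup>+x. sqnorm (f x - adapted_avg 0 x) \<partial>\<mu>) | Suc j \<Rightarrow> (sqint \<mu> (adapted_diff j)))"
lemma weight_pos: "weight k i > 0" using q by (simp add: weight_def split: nat.split)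

lemma fine_kernel_int_meas:
  assumes "t > 0" and [measurable]: "g \<in> borel_measurable borel"
  shows "(\<lambda>x. \<integral>\<^sup>+y. fine_kernel i t x y * ennreal (norm (g y)) \<partial>\<mu>) \<in> borel_measurable borel"
proof -
  note [measurable] = fine_kernel_meas[OF assms(1)]
  have "(\<lambda>x. \<integral>\<^sup>+y. fine_kernel i t x y * ennreal (norm (g y)) \<partial>\<mu>) \<in> borel_measurable \<mu>"
    by (rule SF.borel_measurable_nn_integral) measurable
  then show ?thesis by simp
qed

lemma far_kernel_int_meas:
  assumes "t > 0" and [measurable]: "g \<in> borel_measurable borel"
  shows "(\<lambda>x. \<integral>\<^sup>+y. far_kernel \<rho> t x y * ennreal (norm (g y)) \<partial>\<mu>) \<in> borel_measurable borel"
    and "(\<lambda>x. \<integral>\<^sup>+y. far_kernel \<rho> t x y \<partial>\<mu>) \<in> borel_measurable borel"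
proof -
  note [measurable] = far_kernel_meas[OF assms(1)]
  have "(\<lambda>x. \<integral>\<^sup>+y. far_kernel \<rho> t x y * ennreal (norm (g y)) \<partial>\<mu>) \<in> borel_measurable \<mu>"
    by (rule SF.borel_measurable_nn_integral) measurable
  then show "(\<lambda>x. \<integral>\<^sup>+y. far_kernel \<rho> t x y * ennreal (norm (g y)) \<partial>\<mu>) \<in> borel_measurable borel" by simp
  have "(\<lambda>x. \<integral>\<^sup>+y. far_kernel \<rho> t x y \<partial>\<mu>) \<in> borel_measurable \<mu>"
    by (rule SF.borel_measurable_nn_integral) measurable
  then show "(\<lambda>x. \<integral>\<^sup>+y. far_kernel \<rho> t x y \<partial>\<mu>) \<in> borel_measurable borel" by simp
qed

lemma rem_term_meas:
  assumes t: "t > 0"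
  shows "rem_term k t i \<in> borel_measurable borel"
proof (cases i)
  case 0
  have "(\<lambda>x. \<integral>\<^sup>+y. fine_kernel 0 t x y * ennreal (norm (f y - adapted_avg 0 y)) \<partial>\<mu>) \<in> borel_measurable borel"
    by (rule fine_kernel_int_meas[OF t]) measurable
  then show ?thesis using 0 by (simp add: rem_term_def[abs_def])
next
  case (Suc j)
  note [measurable] = far_kernel_int_meas[OF t]
  have "(\<lambda>x. \<integral>\<^sup>+y. fine_kernel (Suc j) t x y * ennreal (norm (adapted_diff j y * b y)) \<partial>\<mu>) \<in> borel_measurable borel"
    by (rule fine_kernel_int_meas[OF t]) measurable
  moreover have "far_term k t j \<in> borel_measurable borel" unfolding far_term_def[abs_def] by measurable
  ultimately show ?thesis using Suc by (simp add: rem_term_def[abs_def])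
qed

lemma scale_assoc: "ennreal (a\<^sup>2) * (ennreal (c\<^sup>2) * X) = ennreal ((c * a)\<^sup>2) * X"
  by (simp add: power_mult_distrib ennreal_mult mult_ac)

lemma scale_bound:
  assumes "0 \<le> r" "r \<le> R"
  shows "ennreal (r\<^sup>2) * X \<le> ennreal (R\<^sup>2) * X"
  using assms by (intro mult_right_mono ennreal_leI power_mono) auto

text \<open>Schur's test with the gains \<open>(h 4\<^bsup>j+1\<^esup> / t)\<^sup>\<alpha>\<close> below the scale \<open>t\<close> and \<open>(t / rho j k)\<^sup>\<alpha>\<close> above it.\<close>

lemma rem_term_L2:
  assumes i: "i \<le> Suc N" and k: "k \<le> N" and t: "h * 4 ^ k < t" "t \<le> h * 4 ^ Suc k"
  shows "(\<integral>\<^sup>+x. (rem_term k t i x)\<^sup>2 \<partial>\<mu>) \<le> ennreal ((remainder_const * weight k i)\<^sup>2) * energy i"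
proof -
  have t0: "t > 0" using t side_pos[of k] by linarith
  have s4: "4 / sep \<ge> 4" using sep by (simp add: field_simps)
  have fine_t: "h * 4 ^ i < t" if "i \<le> k" for i
  proof -
    have "h * 4 ^ i \<le> h * 4 ^ k" using h_pos that by (intro mult_left_mono power_increasing) auto
    then show ?thesis using t by linarith
  qed
  have fine_decay: "(h * 4 ^ i / t) powr \<alpha> \<le> (4 / sep) powr \<alpha> * q ^ m" if "i + m \<le> Suc k" "i \<le> k" for i m
  proof (rule decay_powr)
    show "0 \<le> h * 4 ^ i / t" using h_pos t0 by simp
    have "h * 4 ^ i / t \<le> h * 4 ^ i / (h * 4 ^ k)"
      using t side_pos[of k] side_pos[of i] t0 by (intro divide_left_mono) (auto intro: less_imp_le)
    also have "\<dots> = 1 / 4 ^ (k - i)" using h_pos that(2) by (simp add: power_diff)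
    also have "\<dots> \<le> 4 * (1 / 2) ^ m"
    proof -
      have "(2::real) ^ m \<le> 2 ^ Suc (k - i)" using that by (intro power_increasing) auto
      also have "\<dots> \<le> 4 * 2 ^ (k - i)" by simp
      also have "\<dots> \<le> 4 * 4 ^ (k - i)" by (intro mult_left_mono power_mono) auto
      finally have "2 ^ m / (4 ^ (k - i) * 2 ^ m) \<le> 4 * 4 ^ (k - i) / (4 ^ (k - i) * (2::real) ^ m)"
        by (intro divide_right_mono) auto
      then show ?thesis by (simp add: power_divide)
    qed
    also have "\<dots> \<le> 4 / sep * (1 / 2) ^ m" using s4 by (intro mult_right_mono) auto
    finally show "h * 4 ^ i / t \<le> 4 / sep * (1 / 2) ^ m" .
  qed
  have B1: "schur_const * p \<le> remainder_const * w" "M * (schur_const * p) \<le> remainder_const * w" "2 * (M * (schur_const * p)) \<le> remainder_const * w"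
    if p: "0 \<le> p" "p \<le> (4 / sep) powr \<alpha> * w" "w \<ge> 0" for p w
  proof -
    have a: "schur_const * p \<le> schur_const * ((4 / sep) powr \<alpha> * w)" using p schur_const_nonneg by (intro mult_left_mono) auto
    define X where "X = schur_const * ((4 / sep) powr \<alpha> * w)"
    have X: "X \<ge> 0" using schur_const_nonneg p by (simp add: X_def)
    have BX: "remainder_const * w = 2 * (M * X) + 2 * X" by (simp add: remainder_const_def X_def algebra_simps)
    have mx: "M * (schur_const * p) \<le> M * X" using a M_pos by (intro mult_left_mono) (auto simp: X_def)
    have MX: "0 \<le> M * X" using X M_pos by simp
    show "schur_const * p \<le> remainder_const * w" "M * (schur_const * p) \<le> remainder_const * w" "2 * (M * (schur_const * p)) \<le> remainder_const * w"
      unfolding BX using a[folded X_def] mx X MX by linarith+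
  qed
  show ?thesis
  proof (cases i)
    case 0
    have "(\<integral>\<^sup>+x. (rem_term k t 0 x)\<^sup>2 \<partial>\<mu>) \<le> ennreal ((schur_const * (h * 4 ^ 0 / t) powr \<alpha>)\<^sup>2) * energy 0"
      unfolding rem_term_def energy_def nat.case by (rule fine_kernel_L2[OF fine_t]) auto
    also have "\<dots> \<le> ennreal ((remainder_const * weight k 0)\<^sup>2) * energy 0"
      using fine_decay[of 0 k] q schur_const_nonneg by (intro scale_bound B1) (auto simp: weight_def)
    finally show ?thesis by (simp add: 0)
  next
    case (Suc j)
    show ?thesis
    proof (cases "j < k")
      case True
      have "(\<integral>\<^sup>+x. (rem_term k t (Suc j) x)\<^sup>2 \<partial>\<mu>)
          \<le> ennreal ((schur_const * (h * 4 ^ Suc j / t) powr \<alpha>)\<^sup>2) * (\<integral>\<^sup>+x. sqnorm (adapted_diff j x * b x) \<partial>\<mu>)"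
        using True unfolding rem_term_def nat.case by (simp only: if_True) (rule fine_kernel_L2[OF fine_t], auto)
      also have "\<dots> \<le> ennreal ((schur_const * (h * 4 ^ Suc j / t) powr \<alpha>)\<^sup>2) * (ennreal (M\<^sup>2) * energy (Suc j))"
        unfolding energy_def nat.case by (intro mult_left_mono nn_integral_mult_b_sq) auto
      also have "\<dots> = ennreal ((M * (schur_const * (h * 4 ^ Suc j / t) powr \<alpha>))\<^sup>2) * energy (Suc j)"
        by (rule scale_assoc)
      also have "\<dots> \<le> ennreal ((remainder_const * weight k (Suc j))\<^sup>2) * energy (Suc j)"
        using fine_decay[of "Suc j" "k - j"] True q schur_const_nonneg M_pos
        by (intro scale_bound B1) (auto simp: weight_def)
      finally show ?thesis by (simp add: Suc)
    next
      case False
      define w where "w = schur_const * (t / rho j k) powr \<alpha>"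
      have w0: "w \<ge> 0" using schur_const_nonneg by (simp add: w_def)
      note far = far_kernel_L2[OF t0 rho_pos[of j k] adapted_diff_meas[of j], folded w_def]
        far_kernel_marginals(1)[OF t0 rho_pos[of j k], folded w_def]
      let ?U = "\<lambda>x. \<integral>\<^sup>+y. far_kernel (rho j k) t x y * ennreal (norm (adapted_diff j y)) \<partial>\<mu>"
      let ?D = "sqint \<mu> (adapted_diff j)"
      have [measurable]: "?U \<in> borel_measurable borel" by (rule far_kernel_int_meas[OF t0 adapted_diff_meas])
      have "(\<integral>\<^sup>+x. (rem_term k t (Suc j) x)\<^sup>2 \<partial>\<mu>)
        \<le> (\<integral>\<^sup>+x. ennreal (2 * M\<^sup>2) * (?U x)\<^sup>2 + ennreal (2 * M\<^sup>2 * w\<^sup>2) * sqnorm (adapted_diff j x) \<partial>\<mu>)"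
      proof (rule nn_integral_mono)
        fix x
        have "rem_term k t (Suc j) x \<le> ennreal M * (?U x + ennreal (norm (adapted_diff j x)) * ennreal w)"
          using False by (simp add: rem_term_def far_term_def, intro mult_left_mono add_left_mono far) auto
        then have "(rem_term k t (Suc j) x)\<^sup>2 \<le> (ennreal M)\<^sup>2 * (?U x + ennreal (norm (adapted_diff j x)) * ennreal w)\<^sup>2"
          by (subst power_mult_distrib[symmetric], intro power_mono) auto
        also have "\<dots> \<le> (ennreal M)\<^sup>2 * (2 * (?U x)\<^sup>2 + 2 * (ennreal (norm (adapted_diff j x)) * ennreal w)\<^sup>2)"
          by (intro mult_left_mono ennreal_square_sum_le) auto
        also have "\<dots> = ennreal (2 * M\<^sup>2) * (?U x)\<^sup>2 + ennreal (2 * M\<^sup>2 * w\<^sup>2) * sqnorm (adapted_diff j x)"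
        proof -
          have m: "(ennreal M)\<^sup>2 * 2 = ennreal (2 * M\<^sup>2)" using M_pos by (simp add: ennreal_power ennreal_mult mult.commute)
          have dw: "(ennreal (norm (adapted_diff j x)) * ennreal w)\<^sup>2 = ennreal (w\<^sup>2) * sqnorm (adapted_diff j x)"
            using w0 by (simp add: power_mult_distrib ennreal_power mult.commute)
          show ?thesis unfolding distrib_left dw mult.assoc[symmetric] m using w0 by (simp add: ennreal_mult)
        qed
        finally show "(rem_term k t (Suc j) x)\<^sup>2 \<le> ennreal (2 * M\<^sup>2) * (?U x)\<^sup>2 + ennreal (2 * M\<^sup>2 * w\<^sup>2) * sqnorm (adapted_diff j x)" .
      qed
      also have "\<dots> = ennreal (2 * M\<^sup>2) * (\<integral>\<^sup>+x. (?U x)\<^sup>2 \<partial>\<mu>) + ennreal (2 * M\<^sup>2 * w\<^sup>2) * ?D"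
        by (simp add: nn_integral_add nn_integral_cmult)
      also have "\<dots> \<le> ennreal (2 * M\<^sup>2) * (ennreal (w\<^sup>2) * ?D) + ennreal (2 * M\<^sup>2 * w\<^sup>2) * ?D"
        by (intro add_right_mono mult_left_mono far) auto
      also have "\<dots> = ennreal ((2 * (M * w))\<^sup>2) * energy (Suc j)"
      proof -
        have "ennreal (2 * M\<^sup>2) * (ennreal (w\<^sup>2) * ?D) = ennreal (2 * M\<^sup>2 * w\<^sup>2) * ?D"
          by (simp add: mult.assoc[symmetric] ennreal_mult[symmetric])
        moreover have "ennreal (2 * M\<^sup>2 * w\<^sup>2) * ?D + ennreal (2 * M\<^sup>2 * w\<^sup>2) * ?D = ennreal (2 * M\<^sup>2 * w\<^sup>2 + 2 * M\<^sup>2 * w\<^sup>2) * ?D"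
          by (subst ennreal_plus) (auto simp: distrib_right)
        moreover have "2 * M\<^sup>2 * w\<^sup>2 + 2 * M\<^sup>2 * w\<^sup>2 = (2 * (M * w))\<^sup>2" by (simp add: power2_eq_square)
        ultimately show ?thesis by (simp add: energy_def)
      qed
      also have "\<dots> \<le> ennreal ((remainder_const * weight k (Suc j))\<^sup>2) * energy (Suc j)"
      proof (rule scale_bound)
        show "0 \<le> 2 * (M * w)" using M_pos w0 by simp
        have "(t / rho j k) powr \<alpha> \<le> (4 / sep) powr \<alpha> * q ^ (j - k)"
        proof (rule decay_powr)
          show "0 \<le> t / rho j k" using t0 rho_pos[of j k] by simp
          have "t / rho j k \<le> h * 4 ^ Suc k / rho j k" using t rho_pos[of j k] by (intro divide_right_mono) auto
          also have "\<dots> = 4 / sep * (1 / 2) ^ (j - k)"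
          proof -
            obtain e where e: "j = k + e" using False by (metis le_Suc_ex not_less)
            have "(4::real) ^ k = 2 ^ k * 2 ^ k" by (simp add: power_mult_distrib[symmetric])
            then show ?thesis using h_pos sep by (simp add: e rho_def power_add power_divide)
          qed
          finally show "t / rho j k \<le> 4 / sep * (1 / 2) ^ (j - k)" .
        qed
        then show "2 * (M * w) \<le> remainder_const * weight k (Suc j)"
          unfolding w_def using q False by (intro B1) (auto simp: weight_def)
      qed
      finally show ?thesis by (simp add: Suc)
    qed
  qed
qed

end

section \<open>One grid: summing over the scales\<close>

lemma sum_geometric_inj_le:
  fixes q :: real
  assumes "0 < q" "q < 1" "finite S" "inj_on g S"
  shows "(\<Sum>j\<in>S. q ^ g j) \<le> 1 / (1 - q)"
proof -
  have "(\<Sum>j\<in>S. q ^ g j) = (\<Sum>m\<in>g ` S. q ^ m)" using assms(4) by (simp add: sum.reindex)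
  also have "\<dots> \<le> (\<Sum>m. q ^ m)" using assms by (intro sum_le_suminf summable_geometric) auto
  also have "\<dots> = 1 / (1 - q)" using assms by (intro suminf_geometric) auto
  finally show ?thesis .
qed

lemma sum_geometric_dist_le:
  fixes q :: real
  assumes q: "0 < q" "q < 1"
  shows "(\<Sum>j\<le>n. q ^ (if j < k then k - j else j - k)) \<le> 2 / (1 - q)"
proof -
  have "(\<Sum>j\<le>n. q ^ (if j < k then k - j else j - k))
    = (\<Sum>j\<in>{..n} \<inter> {..<k}. q ^ (k - j)) + (\<Sum>j\<in>{..n} - {..<k}. q ^ (j - k))"
    by (subst sum.Int_Diff[where B = "{..<k}"]) (auto intro!: arg_cong2[where f = "(+)"] sum.cong)
  also have "\<dots> \<le> 1 / (1 - q) + 1 / (1 - q)"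
    using q by (intro add_mono sum_geometric_inj_le) (auto simp: inj_on_def)
  finally show ?thesis by simp
qed

context tb_setting
begin

definition weight_const :: real where "weight_const = 3 / (1 - q)"
definition energy_const :: real where "energy_const = 2 + 2 * (M\<^sup>2 / c0\<^sup>2) + (3 / c0\<^sup>2 + 8 * M\<^sup>2 / c0 ^ 4)"
definition theta_b_const :: real where "theta_b_const = C1 * M * (1 + tail_const)"

text \<open>A good point over a cell that lies outside its Whitney region has \<open>t\<close> between \<open>eta\<close> times and four
times the side of the cell (\<open>good_slab_cases\<close>).\<close>

definition eta :: real where "eta = sep\<^sup>2 / 256"

text \<open>The Whitney region contributes the first term and the range where \<open>t\<close> is comparable to the side the second one; the
summand \<open>1\<close> makes the constant positive.\<close>

definition packing_const :: real where
  "packing_const = 63 ^ CARD('n) * C0 + 4 * theta_b_const\<^sup>2 / eta + 1"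

text \<open>The paraproduct contributes the first term and the remainder the second one.  No parameter of the
grid enters.\<close>

definition grid_const :: real where
  "grid_const = 2 / c0\<^sup>2 * (4 * packing_const) + 6 * (weight_const * remainder_const\<^sup>2 * weight_const * energy_const)"

lemma weight_const: "weight_const > 0" using q by (simp add: weight_const_def)

lemma energy_const_nonneg: "energy_const \<ge> 0" by (simp add: energy_const_def)

lemma eta_pos: "eta > 0" using sep by (simp add: eta_def)

lemma packing_const_pos: "packing_const > 0"
  using C0_nonneg eta_pos by (simp add: packing_const_def add_nonneg_pos)

lemma theta_b_le: "t > 0 \<Longrightarrow> norm (theta \<mu> s t b x) \<le> theta_b_const"
  unfolding theta_b_const_def by (rule kernel_bounded_integral(2)[OF _ b_meas _ b_bound]) (use M_pos in auto)

lemma density_b_le: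
  assumes t: "t > 0" and r: "0 < r" "r \<le> t"
  shows "density_at b x t \<le> ennreal (theta_b_const\<^sup>2 / r)"
proof -
  have "(norm (theta \<mu> s t b x))\<^sup>2 / t \<le> theta_b_const\<^sup>2 / r"
    using t r theta_b_le[OF t, of x] by (intro frac_le power_mono) auto
  then show ?thesis using t by (simp add: density_at_def ennreal_leI)
qed

lemma density_at_measurable':
  assumes "f \<in> borel_measurable borel"
  shows "(\<lambda>q. density_at f (fst q) (snd q)) \<in> borel_measurable (\<mu> \<Otimes>\<^sub>M lborel)"
  using density_at_measurable[OF assms] by (simp add: case_prod_beta)

lemma density_at_x:
  assumes "f \<in> borel_measurable borel"
  shows "(\<lambda>x. density_at f x t) \<in> borel_measurable borel"
proof -
  have "(\<lambda>x. (x, t)) \<in> borel \<rightarrow>\<^sub>M \<mu> \<Otimes>\<^sub>M lborel" by measurable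
  from measurable_compose[OF this density_at_measurable'[OF assms]] show ?thesis by simp
qed

lemma density_at_t:
  assumes "f \<in> borel_measurable borel"
  shows "(\<lambda>t. density_at f x t) \<in> borel_measurable borel"
proof -
  have "(\<lambda>t. (x, t)) \<in> borel \<rightarrow>\<^sub>M \<mu> \<Otimes>\<^sub>M lborel" by measurable
  from measurable_compose[OF this density_at_measurable'[OF assms]] show ?thesis by simp
qed

end

context grid_setting
begin

abbreviation "slab k \<equiv> {h * 4 ^ k <.. h * 4 ^ Suc k}"
abbreviation Good :: "nat \<Rightarrow> (real ^ 'n) set" where "Good k \<equiv> good \<tau> h N sep k"

lemma Good_sets [measurable]: "Good k \<in> sets borel" by (rule good_in_borel[OF h_pos])

lemma weight_sum_i: "(\<Sum>i\<le>Suc N. weight k i) \<le> weight_const"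
proof -
  have "(\<Sum>i\<le>Suc N. weight k i) = q ^ k + (\<Sum>j\<le>N. q ^ (if j < k then k - j else j - k))"
    unfolding sum.atMost_Suc_shift by (simp add: weight_def)
  also have "\<dots> \<le> 1 / (1 - q) + 2 / (1 - q)"
    using sum_geometric_inj_le[of q "{k}" id] q by (intro add_mono sum_geometric_dist_le) auto
  finally show ?thesis by (simp add: weight_const_def add_divide_distrib[symmetric])
qed

lemma weight_sum_k: "(\<Sum>k\<le>N. weight k i) \<le> weight_const"
proof (cases i)
  case 0
  have "(\<Sum>k\<le>N. q ^ k) \<le> 1 / (1 - q)" using q by (intro sum_geometric_inj_le[where g = "\<lambda>k. k"]) auto
  also have "\<dots> \<le> weight_const" unfolding weight_const_def using q by (intro divide_right_mono) auto
  finally show ?thesis using 0 by (simp add: weight_def)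
next
  case (Suc j)
  have "(\<Sum>k\<le>N. weight k i) = (\<Sum>k\<le>N. q ^ (if k < j then j - k else k - j))"
    using Suc by (intro sum.cong) (auto simp: weight_def)
  also have "\<dots> \<le> 2 / (1 - q)" by (rule sum_geometric_dist_le[OF q])
  also have "\<dots> \<le> weight_const" unfolding weight_const_def using q by (intro divide_right_mono) auto
  finally show ?thesis .
qed

definition rem_energy :: "nat \<Rightarrow> ennreal" where
  "rem_energy k = ennreal weight_const * (\<Sum>i\<le>Suc N. ennreal (remainder_const\<^sup>2 * weight k i) * energy i)"

text \<open>The weights are those of \<open>rem_term_L2\<close>: one factor \<open>weight k i\<close> of its square is spent in
\<open>weighted_sum_sq_le\<close> and the other one is kept for the summation over \<open>k\<close>.\<close>

lemma remainder_L2: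
  assumes k: "k \<le> N" and t: "t \<in> slab k"
  shows "(\<integral>\<^sup>+x. (\<Sum>i\<le>Suc N. rem_term k t i x)\<^sup>2 \<partial>\<mu>) \<le> rem_energy k"
proof -
  have t': "h * 4 ^ k < t" "t \<le> h * 4 ^ Suc k" using t by auto
  have t0: "t > 0" using t' side_pos[of k] by linarith
  note [measurable] = rem_term_meas[OF t0]
  have "(\<integral>\<^sup>+x. (\<Sum>i\<le>Suc N. rem_term k t i x)\<^sup>2 \<partial>\<mu>)
    \<le> (\<integral>\<^sup>+x. ennreal weight_const * (\<Sum>i\<le>Suc N. ennreal (1 / weight k i) * (rem_term k t i x)\<^sup>2) \<partial>\<mu>)"
  proof (rule nn_integral_mono)
    fix x
    have "(\<Sum>i\<le>Suc N. rem_term k t i x)\<^sup>2 \<le> ennreal (\<Sum>i\<le>Suc N. weight k i) * (\<Sum>i\<le>Suc N. ennreal (1 / weight k i) * (rem_term k t i x)\<^sup>2)"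
      by (rule weighted_sum_sq_le) (auto simp: weight_pos)
    also have "\<dots> \<le> ennreal weight_const * (\<Sum>i\<le>Suc N. ennreal (1 / weight k i) * (rem_term k t i x)\<^sup>2)"
      by (intro mult_right_mono ennreal_leI weight_sum_i) auto
    finally show "(\<Sum>i\<le>Suc N. rem_term k t i x)\<^sup>2 \<le> ennreal weight_const * (\<Sum>i\<le>Suc N. ennreal (1 / weight k i) * (rem_term k t i x)\<^sup>2)" .
  qed
  also have "\<dots> = ennreal weight_const * (\<Sum>i\<le>Suc N. ennreal (1 / weight k i) * (\<integral>\<^sup>+x. (rem_term k t i x)\<^sup>2 \<partial>\<mu>))"
    by (simp add: nn_integral_cmult nn_integral_sum del: sum.atMost_Suc)
  also have "\<dots> \<le> ennreal weight_const * (\<Sum>i\<le>Suc N. ennreal (remainder_const\<^sup>2 * weight k i) * energy i)"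
  proof (intro mult_left_mono sum_mono)
    fix i assume i: "i \<in> {..Suc N}"
    have "ennreal (1 / weight k i) * (\<integral>\<^sup>+x. (rem_term k t i x)\<^sup>2 \<partial>\<mu>) \<le> ennreal (1 / weight k i) * (ennreal ((remainder_const * weight k i)\<^sup>2) * energy i)"
      using i k t' by (intro mult_left_mono rem_term_L2) auto
    also have "\<dots> = ennreal (remainder_const\<^sup>2 * weight k i) * energy i"
    proof -
      have "1 / weight k i * (remainder_const * weight k i)\<^sup>2 = remainder_const\<^sup>2 * weight k i"
        using weight_pos[of k i] by (simp add: power2_eq_square)
      then have "ennreal (1 / weight k i) * ennreal ((remainder_const * weight k i)\<^sup>2) = ennreal (remainder_const\<^sup>2 * weight k i)"
        using weight_pos[of k i] by (subst ennreal_mult[symmetric]) auto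
      then show ?thesis by (simp add: mult.assoc[symmetric])
    qed
    finally show "ennreal (1 / weight k i) * (\<integral>\<^sup>+x. (rem_term k t i x)\<^sup>2 \<partial>\<mu>) \<le> ennreal (remainder_const\<^sup>2 * weight k i) * energy i" .
  qed auto
  finally show ?thesis by (simp only: rem_energy_def)
qed

lemma energy_sum: "(\<Sum>i\<le>Suc N. energy i) \<le> ennreal energy_const * F"
proof -
  have e0: "energy 0 \<le> ennreal (2 + 2 * (M\<^sup>2 / c0\<^sup>2)) * F"
  proof -
    have "energy 0 \<le> 2 * F + 2 * (sqint \<mu> (adapted_avg 0))"
      unfolding energy_def nat.case by (rule nn_integral_diff_square_le) auto
    also have "\<dots> \<le> 2 * F + 2 * (ennreal (M\<^sup>2 / c0\<^sup>2) * F)" by (intro add_left_mono mult_left_mono adapted_avg_L2) auto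
    also have "\<dots> = ennreal (2 + 2 * (M\<^sup>2 / c0\<^sup>2)) * F"
    proof -
      have "ennreal (2 + 2 * X) = 2 + 2 * ennreal X" if "X \<ge> 0" for X :: real
        using that by (simp add: ennreal_mult)
      from this[of "M\<^sup>2 / c0\<^sup>2"] show ?thesis by (simp add: distrib_right mult.assoc)
    qed
    finally show ?thesis .
  qed
  have "(\<Sum>i\<le>Suc N. energy i) = energy 0 + (\<integral>\<^sup>+x. (\<Sum>j\<le>N. sqnorm (adapted_diff j x)) \<partial>\<mu>)"
    unfolding sum.atMost_Suc_shift by (simp add: energy_def nn_integral_sum del: sum_ennreal)
  also have "\<dots> \<le> ennreal (2 + 2 * (M\<^sup>2 / c0\<^sup>2)) * F + ennreal (3 / c0\<^sup>2 + 8 * M\<^sup>2 / c0 ^ 4) * F"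
    unfolding adapted_diff_def
    by (intro add_mono e0 adapted_square_function[OF f_local b_local c0_pos M_pos accretive_cell b_sq])
  also have "\<dots> = ennreal energy_const * F"
    unfolding energy_const_def by (subst (2) ennreal_plus) (auto simp: distrib_right)
  finally show ?thesis .
qed

lemma rem_energy_sum: "(\<Sum>k\<le>N. rem_energy k) \<le> ennreal (weight_const * remainder_const\<^sup>2 * weight_const * energy_const) * F"
proof -
  have "(\<Sum>k\<le>N. rem_energy k) = ennreal weight_const * (\<Sum>i\<le>Suc N. (\<Sum>k\<le>N. ennreal (remainder_const\<^sup>2 * weight k i)) * energy i)"
    unfolding rem_energy_def sum_distrib_left[symmetric] sum_distrib_right by (subst sum.swap) simp
  also have "\<dots> \<le> ennreal weight_const * (\<Sum>i\<le>Suc N. ennreal (remainder_const\<^sup>2 * weight_const) * energy i)"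
  proof (intro mult_left_mono sum_mono mult_right_mono)
    fix i
    have "(\<Sum>k\<le>N. ennreal (remainder_const\<^sup>2 * weight k i)) = ennreal (remainder_const\<^sup>2 * (\<Sum>k\<le>N. weight k i))"
      using weight_pos by (subst sum_ennreal) (auto simp: sum_distrib_left less_imp_le)
    also have "\<dots> \<le> ennreal (remainder_const\<^sup>2 * weight_const)" by (intro ennreal_leI mult_left_mono weight_sum_k) auto
    finally show "(\<Sum>k\<le>N. ennreal (remainder_const\<^sup>2 * weight k i)) \<le> ennreal (remainder_const\<^sup>2 * weight_const)" .
  qed auto
  also have "\<dots> = ennreal weight_const * (ennreal (remainder_const\<^sup>2 * weight_const) * (\<Sum>i\<le>Suc N. energy i))"
    by (simp only: sum_distrib_left)
  also have "\<dots> \<le> ennreal weight_const * (ennreal (remainder_const\<^sup>2 * weight_const) * (ennreal energy_const * F))"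
    by (intro mult_left_mono energy_sum) auto
  also have "\<dots> = ennreal (weight_const * remainder_const\<^sup>2 * weight_const * energy_const) * F"
    using weight_const energy_const_nonneg by (simp add: ennreal_mult mult.assoc)
  finally show ?thesis .
qed

text \<open>The density of the Carleson measure of the paraproduct, restricted to good points.\<close>

definition carleson_density :: "nat \<Rightarrow> real ^ 'n \<Rightarrow> ennreal" where
  "carleson_density k x = (\<integral>\<^sup>+t\<in>slab k. density_at b x t \<partial>lborel) * indicator (Good k) x"

lemma density_slab_meas:
  assumes "g \<in> borel_measurable borel"
  shows "(\<lambda>x. \<integral>\<^sup>+t\<in>slab k. density_at g x t \<partial>lborel) \<in> borel_measurable borel"
proof -
  note [measurable] = density_at_measurable'[OF assms]
  have "(\<lambda>x. \<integral>\<^sup>+t\<in>slab k. density_at g x t \<partial>lborel) \<in> borel_measurable \<mu>"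
    by (rule lborel.borel_measurable_nn_integral) (simp add: case_prod_beta)
  then show ?thesis by simp
qed

lemma carleson_density_meas [measurable]: "carleson_density k \<in> borel_measurable borel"
  unfolding carleson_density_def[abs_def] using density_slab_meas[OF b_meas] by measurable

lemma slab_disjoint:
  assumes "t \<in> slab k" "t \<in> slab k'" shows "k = k'"
proof (rule ccontr)
  have *: False if "t \<in> slab i" "t \<in> slab j" "i < j" for i j
  proof -
    have "h * 4 ^ Suc i \<le> h * 4 ^ j" using that h_pos by (intro mult_left_mono power_increasing) auto
    then show False using that by auto
  qed
  assume "k \<noteq> k'"
  then show False using assms *[of k k'] *[of k' k] by (cases "k < k'") auto
qed

lemma sum_slab_le:
  fixes a :: "nat \<Rightarrow> ennreal"
  assumes "\<And>k. k \<le> m \<Longrightarrow> t \<in> slab k \<Longrightarrow> a k \<le> z"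
  shows "(\<Sum>k\<le>m. a k * indicator (slab k) t) \<le> z"
proof (cases "\<exists>k\<le>m. t \<in> slab k")
  case True
  then obtain k where k: "k \<le> m" "t \<in> slab k" by blast
  have "(\<Sum>i\<le>m. a i * indicator (slab i) t) = (\<Sum>i\<in>{k}. a i * indicator (slab i) t)"
  proof (intro sum.mono_neutral_right ballI)
    fix i assume "i \<in> {..m} - {k}"
    then have "t \<notin> slab i" using slab_disjoint[OF k(2), of i] by blast
    then show "a i * indicator (slab i) t = 0" by (simp only: indicator_simps mult_zero_right not_False_eq_True)
  qed (use k in auto)
  also have "\<dots> = a k * indicator (slab k) t" by (simp only: sum.insert finite.emptyI empty_iff not_False_eq_True sum.empty add_0_right)
  also have "\<dots> = a k" by (simp only: indicator_simps(1)[OF k(2)] mult_1_right)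
  finally show ?thesis using assms[OF k] by (simp only:)
next
  case False
  then have "a k * indicator (slab k) t = 0" if "k \<le> m" for k
    using that by (auto simp: indicator_def)
  then have "(\<Sum>k\<le>m. a k * indicator (slab k) t) = 0" by (intro sum.neutral) auto
  then show ?thesis by simp
qed

end

context grid_setting
begin

lemma carleson_b:
  assumes l: "l > 0"
  shows "(\<integral>\<^sup>+q\<in>carleson_box c l. density_at b (fst q) (snd q) \<partial>(\<mu> \<Otimes>\<^sub>M lborel)) \<le> ennreal C0 * emeasure \<mu> (cube c (3 * l))"
proof -
  have "square_integral \<mu> s b (carleson_box c l) = (\<integral>\<^sup>+q\<in>carleson_box c l. density_at b (fst q) (snd q) \<partial>(\<mu> \<Otimes>\<^sub>M lborel))"
    by (subst square_integral_eq) (auto simp: carleson_box_def case_prod_beta)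
  then show ?thesis using testing[OF l, of c] by simp
qed

definition whitney :: "nat \<Rightarrow> ('n \<Rightarrow> int) \<Rightarrow> ((real ^ 'n) \<times> real) set" where
  "whitney m v = {(x, t). 0 < t \<and> t \<le> (h * 4 ^ m / 2 - infnorm (x - centre m v)) / 4}"

lemma whitney_bound:
  "(\<integral>\<^sup>+q\<in>whitney m v. density_at b (fst q) (snd q) \<partial>(\<mu> \<Otimes>\<^sub>M lborel)) \<le> ennreal (63 ^ CARD('n) * C0) * ennreal (mass m v)"
  unfolding whitney_def emeasure_cell[symmetric] cell_eq_cube
  by (rule whitney_packing[OF borel_mu sigma_finite density_at_measurable'[OF b_meas] C0_nonneg carleson_b])

lemma whitney_sets [measurable]: "whitney m v \<in> sets (\<mu> \<Otimes>\<^sub>M (lborel :: real measure))"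
proof -
  have "{q \<in> space (\<mu> \<Otimes>\<^sub>M (lborel :: real measure)). 0 < snd q \<and> snd q \<le> (h * 4 ^ m / 2 - infnorm (fst q - centre m v)) / 4} \<in> sets (\<mu> \<Otimes>\<^sub>M (lborel :: real measure))"
    by measurable
  moreover have "space (\<mu> \<Otimes>\<^sub>M (lborel :: real measure)) = UNIV" by (simp add: space_pair_measure)
  moreover have "whitney m v = {q. 0 < snd q \<and> snd q \<le> (h * 4 ^ m / 2 - infnorm (fst q - centre m v)) / 4}"
    by (auto simp: whitney_def)
  ultimately show ?thesis by simp
qed

text \<open>Outside the Whitney region \<open>4 t\<close> exceeds the distance to the boundary, which for a good point is at least
\<open>sep h 2\<^bsup>m+k\<^esup>\<close>.  As \<open>t \<le> 4 h 4\<^sup>k\<close>, this forces \<open>2\<^sup>m\<close> and \<open>2\<^sup>k\<close> to be comparable.\<close>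

lemma good_slab_cases:
  assumes x: "x \<in> cell m v" "x \<in> Good k" and k: "k \<le> m" "m \<le> N" and t: "t \<in> slab k"
    and out: "(x, t) \<notin> whitney m v"
  shows "eta * (h * 4 ^ m) \<le> t" "t \<le> 4 * (h * 4 ^ m)"
proof -
  have t': "h * 4 ^ k < t" "t \<le> 4 * (h * 4 ^ k)" using t by auto
  have t0: "t > 0" using t' side_pos[of k] by linarith
  have "h * 4 ^ k \<le> h * 4 ^ m" using h_pos k by (intro mult_left_mono power_increasing) auto
  then show "t \<le> 4 * (h * 4 ^ m)" using t' by linarith
  have four: "(4::real) ^ i = (2 ^ i)\<^sup>2" for i
    by (simp add: power2_eq_square power_mult_distrib[symmetric])
  have "idx m x = v" using x(1) by (simp add: cell_def)
  then have "sep * h * 2 ^ (m + k) \<le> h * 4 ^ m / 2 - infnorm (x - centre m v)"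
    using x(2) k unfolding good_def by auto
  moreover have "(h * 4 ^ m / 2 - infnorm (x - centre m v)) / 4 < t"
    using out t0 by (auto simp: whitney_def)
  moreover have "a < 16 * w" if "a \<le> u" "u / 4 < r" "r \<le> 4 * w" for a u r w :: real
    using that by linarith
  ultimately have "sep * h * 2 ^ (m + k) < 16 * (h * 4 ^ k)" using t'(2) by blast
  then have "(sep * 2 ^ m) * (h * 2 ^ k) < (16 * 2 ^ k) * (h * 2 ^ k)"
    unfolding four by (simp add: power_add mult_ac power2_eq_square)
  then have "sep * 2 ^ m < 16 * 2 ^ k" using h_pos by (subst (asm) mult_less_cancel_right_pos) auto
  then have "(sep * 2 ^ m)\<^sup>2 \<le> (16 * 2 ^ k)\<^sup>2" using sep by (intro power_mono) auto
  then have "eta * 4 ^ m \<le> 4 ^ k" by (simp add: power_mult_distrib eta_def four)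
  then have "h * (eta * 4 ^ m) \<le> h * 4 ^ k" using h_pos by (intro mult_left_mono) auto
  then show "eta * (h * 4 ^ m) \<le> t" using t' by (simp add: mult_ac)
qed

text \<open>The slabs of different generations are disjoint, so that at each point at most one generation contributes.\<close>

lemma carleson_density_packing:
  assumes m: "m \<le> N"
  shows "(\<integral>\<^sup>+x\<in>cell m v. (\<Sum>k\<le>m. carleson_density k x) \<partial>\<mu>) \<le> ennreal (packing_const * mass m v)"
proof -
  let ?H = "h * 4 ^ m"
  let ?c = "theta_b_const\<^sup>2 / (eta * ?H)"
  note [measurable] = density_at_measurable'[OF b_meas] density_at_t[OF b_meas]
  have etaH: "eta * ?H > 0" using eta_pos side_pos[of m] by simp
  have H: "?H > 0" by (rule side_pos)
  have "(\<integral>\<^sup>+x\<in>cell m v. (\<Sum>k\<le>m. carleson_density k x) \<partial>\<mu>)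
    \<le> (\<integral>\<^sup>+x. (\<integral>\<^sup>+t. density_at b x t * indicator (whitney m v) (x, t) \<partial>lborel) + ennreal (4 * ?H * ?c) * indicator (cell m v) x \<partial>\<mu>)"
  proof (rule nn_integral_mono)
    fix x
    have [measurable]: "(\<lambda>t. indicator (whitney m v) (x, t) :: ennreal) \<in> borel_measurable borel"
      using measurable_compose[OF measurable_Pair1'[of x \<mu> "lborel :: real measure"] borel_measurable_indicator[OF whitney_sets[of m v]]] by simp
    show "(\<Sum>k\<le>m. carleson_density k x) * indicator (cell m v) x
      \<le> (\<integral>\<^sup>+t. density_at b x t * indicator (whitney m v) (x, t) \<partial>lborel) + ennreal (4 * ?H * ?c) * indicator (cell m v) x"
    proof (cases "x \<in> cell m v")
      case True
      have "(\<Sum>k\<le>m. carleson_density k x) = (\<Sum>k\<le>m. (\<integral>\<^sup>+t. (density_at b x t * indicator (Good k) x) * indicator (slab k) t \<partial>lborel))"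
        unfolding carleson_density_def by (intro sum.cong refl, subst nn_integral_multc[symmetric]) (auto simp: mult_ac)
      also have "\<dots> = (\<integral>\<^sup>+t. (\<Sum>k\<le>m. (density_at b x t * indicator (Good k) x) * indicator (slab k) t) \<partial>lborel)"
        by (rule nn_integral_sum[symmetric]) measurable
      also have "\<dots> \<le> (\<integral>\<^sup>+t. density_at b x t * indicator (whitney m v) (x, t) + ennreal ?c * indicator {0..4 * ?H} t \<partial>lborel)"
      proof (intro nn_integral_mono sum_slab_le)
        fix t k assume k: "k \<le> m" and t: "t \<in> slab k"
        have t0: "t > 0" using t side_pos[of k] by auto
        show "density_at b x t * indicator (Good k) x \<le> density_at b x t * indicator (whitney m v) (x, t) + ennreal ?c * indicator {0..4 * ?H} t"
        proof (cases "x \<in> Good k \<and> (x, t) \<notin> whitney m v")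
          case g: True
          have tt: "eta * ?H \<le> t" "t \<le> 4 * ?H"
            using good_slab_cases[OF True _ k m t] g by auto
          have "density_at b x t \<le> ennreal ?c" by (rule density_b_le[OF t0 etaH tt(1)])
          then show ?thesis using tt t0 g by simp
        qed (auto simp: indicator_def)
      qed
      also have "\<dots> = (\<integral>\<^sup>+t. density_at b x t * indicator (whitney m v) (x, t) \<partial>lborel) + ennreal ?c * ennreal (4 * ?H)"
        using H by (subst nn_integral_add) (auto simp: nn_integral_cmult_indicator)
      also have "ennreal ?c * ennreal (4 * ?H) = ennreal (4 * ?H * ?c)"
        using etaH H by (subst ennreal_mult[symmetric]) (auto simp: mult.commute)
      finally show ?thesis using True by simp
    qed simp
  qed
  also have "\<dots> = (\<integral>\<^sup>+x. (\<integral>\<^sup>+t. density_at b x t * indicator (whitney m v) (x, t) \<partial>lborel) \<partial>\<mu>) + ennreal (4 * ?H * ?c) * ennreal (mass m v)"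
  proof -
    have meas: "(\<lambda>x. \<integral>\<^sup>+t. density_at b x t * indicator (whitney m v) (x, t) \<partial>lborel) \<in> borel_measurable \<mu>"
      by (rule lborel.borel_measurable_nn_integral) (simp add: case_prod_beta)
    show ?thesis
      by (subst nn_integral_add[OF meas]) (auto simp: nn_integral_cmult_indicator emeasure_cell)
  qed
  also have "(\<integral>\<^sup>+x. (\<integral>\<^sup>+t. density_at b x t * indicator (whitney m v) (x, t) \<partial>lborel) \<partial>\<mu>)
    = (\<integral>\<^sup>+q\<in>whitney m v. density_at b (fst q) (snd q) \<partial>(\<mu> \<Otimes>\<^sub>M lborel))"
    by (subst lborel.nn_integral_fst[symmetric]) auto
  also have "\<dots> + ennreal (4 * ?H * ?c) * ennreal (mass m v)
      \<le> ennreal (63 ^ CARD('n) * C0) * ennreal (mass m v) + ennreal (4 * ?H * ?c) * ennreal (mass m v)"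
    by (intro add_right_mono whitney_bound)
  also have "\<dots> = ennreal ((63 ^ CARD('n) * C0 + 4 * ?H * ?c) * mass m v)"
    using C0_nonneg H eta_pos by (simp add: ennreal_mult[symmetric] ennreal_plus[symmetric] distrib_right del: ennreal_plus)
  also have "\<dots> \<le> ennreal (packing_const * mass m v)"
  proof (intro ennreal_leI mult_right_mono)
    have "4 * ?H * ?c = 4 * theta_b_const\<^sup>2 / eta" using h_pos eta_pos by simp
    then show "63 ^ CARD('n) * C0 + 4 * ?H * ?c \<le> packing_const" by (simp add: packing_const_def)
  qed simp
  finally show ?thesis .
qed

lemma paraproduct_bound:
  "(\<integral>\<^sup>+x. (\<Sum>k\<le>N. carleson_density k x * sqnorm (coef k b f (idx k x))) \<partial>\<mu>) \<le> ennreal (1 / c0\<^sup>2 * (4 * packing_const)) * F"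
proof -
  let ?A = "\<lambda>k x. (cavg k (\<lambda>x. norm (f x)) (idx k x))\<^sup>2"
  have "(\<integral>\<^sup>+x. (\<Sum>k\<le>N. carleson_density k x * sqnorm (coef k b f (idx k x))) \<partial>\<mu>)
    \<le> (\<integral>\<^sup>+x. ennreal (1 / c0\<^sup>2) * (\<Sum>k\<le>N. carleson_density k x * ennreal (?A k x)) \<partial>\<mu>)"
  proof (rule nn_integral_mono)
    fix x
    have "sqnorm (coef k b f (idx k x)) \<le> ennreal (1 / c0\<^sup>2) * ennreal (?A k x)" for k
    proof -
      have "norm (coef k b f (idx k x)) \<le> norm (cavg k f (idx k x)) / c0"
        by (rule norm_coef_le[OF f_local b_local c0_pos M_pos accretive_cell b_sq])
      also have "\<dots> \<le> cavg k (\<lambda>x. norm (f x)) (idx k x) / c0"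
        using c0_pos by (intro divide_right_mono norm_cavg_le) auto
      finally have "(norm (coef k b f (idx k x)))\<^sup>2 \<le> (cavg k (\<lambda>x. norm (f x)) (idx k x) / c0)\<^sup>2"
        by (intro power_mono) auto
      then show ?thesis by (simp add: ennreal_mult[symmetric] power_divide ennreal_leI)
    qed
    then have "(\<Sum>k\<le>N. carleson_density k x * sqnorm (coef k b f (idx k x))) \<le> (\<Sum>k\<le>N. carleson_density k x * (ennreal (1 / c0\<^sup>2) * ennreal (?A k x)))"
      by (intro sum_mono mult_left_mono) auto
    then show "(\<Sum>k\<le>N. carleson_density k x * sqnorm (coef k b f (idx k x))) \<le> ennreal (1 / c0\<^sup>2) * (\<Sum>k\<le>N. carleson_density k x * ennreal (?A k x))"
      by (simp only: sum_distrib_left mult.left_commute)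
  qed
  also have "\<dots> = ennreal (1 / c0\<^sup>2) * (\<integral>\<^sup>+x. (\<Sum>k\<le>N. carleson_density k x * ennreal (?A k x)) \<partial>\<mu>)"
    by (rule nn_integral_cmult) simp
  also have "\<dots> \<le> ennreal (1 / c0\<^sup>2) * (ennreal (4 * packing_const) * (sqint \<mu> f))"
    by (intro mult_left_mono carleson_embedding[OF local_L2_norm[OF f_local] _ packing_const_pos carleson_density_packing]) auto
  also have "\<dots> = ennreal (1 / c0\<^sup>2 * (4 * packing_const)) * F"
    using packing_const_pos by (simp add: ennreal_mult'[symmetric] mult.assoc[symmetric])
  finally show ?thesis .
qed

text \<open>The estimate is made for each fixed \<open>t\<close>, with a bound for the remainder that does not depend on \<open>t\<close>; the slab has
\<open>dt/t\<close>-measure at most \<open>3\<close>.\<close>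

lemma slab_estimate:
  assumes k: "k \<le> N"
  shows "(\<integral>\<^sup>+t\<in>slab k. (\<integral>\<^sup>+x\<in>Good k. density_at f x t \<partial>\<mu>) \<partial>lborel)
    \<le> 2 * (\<integral>\<^sup>+x. carleson_density k x * sqnorm (coef k b f (idx k x)) \<partial>\<mu>) + 6 * rem_energy k"
proof -
  let ?S = "h * 4 ^ k"
  let ?G = "\<lambda>x t. sqnorm (coef k b f (idx k x)) * indicator (Good k) x * density_at b x t"
  note [measurable] = density_at_measurable'[OF b_meas] density_at_x[OF b_meas] density_at_t[OF b_meas]
  have S: "?S > 0" by (rule side_pos)
  have cm: "(\<lambda>q. coef k b f (idx k (fst q))) \<in> borel_measurable (\<mu> \<Otimes>\<^sub>M (lborel :: real measure))"
    by (rule measurable_compose[OF _ idx_compose_borel]) measurable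
  note [measurable] = cm
  have G_meas [measurable]: "(\<lambda>q. ?G (fst q) (snd q)) \<in> borel_measurable (\<mu> \<Otimes>\<^sub>M lborel)"
    by measurable
  have "(\<integral>\<^sup>+t\<in>slab k. (\<integral>\<^sup>+x\<in>Good k. density_at f x t \<partial>\<mu>) \<partial>lborel)
    \<le> (\<integral>\<^sup>+t. 2 * ((\<integral>\<^sup>+x. ?G x t \<partial>\<mu>) * indicator (slab k) t) + ennreal (2 / ?S) * rem_energy k * indicator (slab k) t \<partial>lborel)"
  proof (rule nn_integral_mono)
    fix t
    show "(\<integral>\<^sup>+x\<in>Good k. density_at f x t \<partial>\<mu>) * indicator (slab k) t
       \<le> 2 * ((\<integral>\<^sup>+x. ?G x t \<partial>\<mu>) * indicator (slab k) t) + ennreal (2 / ?S) * rem_energy k * indicator (slab k) t"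
    proof (cases "t \<in> slab k")
      case True
      then have t: "?S < t" "t > 0" using S by auto
      note [measurable] = rem_term_meas[OF t(2)]
      let ?R = "\<lambda>x. (\<Sum>i\<le>Suc N. rem_term k t i x)"
      have "(\<integral>\<^sup>+x\<in>Good k. density_at f x t \<partial>\<mu>) \<le> (\<integral>\<^sup>+x. 2 * ?G x t + ennreal (2 / ?S) * (?R x)\<^sup>2 \<partial>\<mu>)"
      proof (rule nn_integral_mono)
        fix x
        show "density_at f x t * indicator (Good k) x \<le> 2 * ?G x t + ennreal (2 / ?S) * (?R x)\<^sup>2"
        proof (cases "x \<in> Good k")
          case x: True
          let ?P = "norm (coef k b f (idx k x)) * norm (theta \<mu> s t b x)"
          have "density_at f x t = ennreal (1 / t) * (ennreal (norm (theta \<mu> s t f x)))\<^sup>2"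
            using t by (simp add: density_at_def ennreal_power ennreal_mult[symmetric])
          also have "\<dots> \<le> ennreal (1 / t) * (ennreal ?P + ?R x)\<^sup>2"
            by (intro mult_left_mono power_mono theta_decomposition[OF x k t(1)]) auto
          also have "\<dots> \<le> ennreal (1 / t) * (2 * (ennreal ?P)\<^sup>2 + 2 * (?R x)\<^sup>2)"
            by (intro mult_left_mono ennreal_square_sum_le) auto
          also have "\<dots> = 2 * (ennreal (1 / t) * (ennreal ?P)\<^sup>2) + ennreal (1 / t) * 2 * (?R x)\<^sup>2"
            by (simp only: distrib_left mult_ac)
          also have "ennreal (1 / t) * (ennreal ?P)\<^sup>2 = ?G x t"
            using t x by (simp add: density_at_def ennreal_power ennreal_mult[symmetric] power_mult_distrib)
          also have "2 * ?G x t + ennreal (1 / t) * 2 * (?R x)\<^sup>2 \<le> 2 * ?G x t + ennreal (2 / ?S) * (?R x)\<^sup>2"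
          proof (intro add_left_mono mult_right_mono)
            have "ennreal (1 / t) * 2 = ennreal (2 / t)" using t by (simp add: ennreal_mult'[symmetric] mult.commute[of _ 2] ennreal_numeral[symmetric] del: ennreal_numeral)
            also have "\<dots> \<le> ennreal (2 / ?S)" using t S by (intro ennreal_leI divide_left_mono) auto
            finally show "ennreal (1 / t) * 2 \<le> ennreal (2 / ?S)" .
          qed simp
          finally show ?thesis using x by simp
        qed simp
      qed
      also have "\<dots> = 2 * (\<integral>\<^sup>+x. ?G x t \<partial>\<mu>) + ennreal (2 / ?S) * (\<integral>\<^sup>+x. (?R x)\<^sup>2 \<partial>\<mu>)"
        by (simp add: nn_integral_add nn_integral_cmult del: sum.atMost_Suc)
      also have "\<dots> \<le> 2 * (\<integral>\<^sup>+x. ?G x t \<partial>\<mu>) + ennreal (2 / ?S) * rem_energy k"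
        by (intro add_left_mono mult_left_mono remainder_L2[OF k True]) auto
      finally show ?thesis using True by simp
    qed simp
  qed
  also have "\<dots> = 2 * (\<integral>\<^sup>+t\<in>slab k. (\<integral>\<^sup>+x. ?G x t \<partial>\<mu>) \<partial>lborel) + ennreal (2 / ?S) * rem_energy k * emeasure lborel (slab k)"
  proof -
    have [measurable]: "(\<lambda>t. \<integral>\<^sup>+x. ?G x t \<partial>\<mu>) \<in> borel_measurable borel"
    proof -
      have "(\<lambda>q. ?G (snd q) (fst q)) \<in> borel_measurable ((lborel :: real measure) \<Otimes>\<^sub>M \<mu>)"
        using measurable_compose[OF measurable_pair_swap' G_meas] by (simp add: case_prod_beta)
      then have "(\<lambda>t. \<integral>\<^sup>+x. ?G x t \<partial>\<mu>) \<in> borel_measurable (lborel :: real measure)"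
        by (intro SF.borel_measurable_nn_integral) (simp add: case_prod_beta)
      then show ?thesis by simp
    qed
    show ?thesis by (subst nn_integral_add) (auto simp: nn_integral_cmult nn_integral_cmult_indicator)
  qed
  also have "ennreal (2 / ?S) * rem_energy k * emeasure lborel (slab k) = 6 * rem_energy k"
  proof -
    have "emeasure lborel (slab k) = ennreal (3 * ?S)" using S by (subst emeasure_lborel_Ioc) auto
    moreover have "ennreal (2 / ?S) * ennreal (3 * ?S) = ennreal 6"
      using S by (subst ennreal_mult[symmetric]) auto
    ultimately show ?thesis by (metis ennreal_numeral mult.assoc mult.commute zero_le_numeral)
  qed
  also have "(\<integral>\<^sup>+t\<in>slab k. (\<integral>\<^sup>+x. ?G x t \<partial>\<mu>) \<partial>lborel) = (\<integral>\<^sup>+x. carleson_density k x * sqnorm (coef k b f (idx k x)) \<partial>\<mu>)"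
  proof -
    have "(\<integral>\<^sup>+t\<in>slab k. (\<integral>\<^sup>+x. ?G x t \<partial>\<mu>) \<partial>lborel) = (\<integral>\<^sup>+t. (\<integral>\<^sup>+x. ?G x t * indicator (slab k) t \<partial>\<mu>) \<partial>lborel)"
      by (intro nn_integral_cong nn_integral_multc[symmetric]) simp
    also have "\<dots> = (\<integral>\<^sup>+x. (\<integral>\<^sup>+t. ?G x t * indicator (slab k) t \<partial>lborel) \<partial>\<mu>)"
      by (rule MT.Fubini') (simp add: case_prod_beta)
    also have "\<dots> = (\<integral>\<^sup>+x. carleson_density k x * sqnorm (coef k b f (idx k x)) \<partial>\<mu>)"
    proof (rule nn_integral_cong)
      fix x
      have "(\<integral>\<^sup>+t. ?G x t * indicator (slab k) t \<partial>lborel)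
         = (\<integral>\<^sup>+t. (sqnorm (coef k b f (idx k x)) * indicator (Good k) x) * (density_at b x t * indicator (slab k) t) \<partial>lborel)"
        by (simp only: mult.assoc)
      also have "\<dots> = carleson_density k x * sqnorm (coef k b f (idx k x))"
        by (subst nn_integral_cmult) (auto simp: carleson_density_def mult_ac)
      finally show "(\<integral>\<^sup>+t. ?G x t * indicator (slab k) t \<partial>lborel) = carleson_density k x * sqnorm (coef k b f (idx k x))" .
    qed
    finally show ?thesis .
  qed
  finally show ?thesis .
qed

theorem grid_estimate:
  "(\<Sum>k\<le>N. (\<integral>\<^sup>+t\<in>slab k. (\<integral>\<^sup>+x\<in>Good k. density_at f x t \<partial>\<mu>) \<partial>lborel)) \<le> ennreal grid_const * F"
proof -
  let ?X = "weight_const * remainder_const\<^sup>2 * weight_const * energy_const"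
  have X: "?X \<ge> 0" using weight_const energy_const_nonneg by simp
  have "(\<Sum>k\<le>N. (\<integral>\<^sup>+t\<in>slab k. (\<integral>\<^sup>+x\<in>Good k. density_at f x t \<partial>\<mu>) \<partial>lborel))
    \<le> (\<Sum>k\<le>N. 2 * (\<integral>\<^sup>+x. carleson_density k x * sqnorm (coef k b f (idx k x)) \<partial>\<mu>) + 6 * rem_energy k)"
    by (intro sum_mono slab_estimate) auto
  also have "\<dots> = 2 * (\<integral>\<^sup>+x. (\<Sum>k\<le>N. carleson_density k x * sqnorm (coef k b f (idx k x))) \<partial>\<mu>) + 6 * (\<Sum>k\<le>N. rem_energy k)"
    by (simp add: nn_integral_sum sum.distrib sum_distrib_left)
  also have "\<dots> \<le> 2 * (ennreal (1 / c0\<^sup>2 * (4 * packing_const)) * F) + 6 * (ennreal ?X * F)"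
    by (intro add_mono mult_left_mono paraproduct_bound rem_energy_sum) auto
  also have "\<dots> = ennreal grid_const * F"
  proof -
    have "2 * ennreal Y + 6 * ennreal Z = ennreal (2 * Y + 6 * Z)" if "Y \<ge> 0" "Z \<ge> 0" for Y Z
      using that by (simp add: ennreal_mult)
    from this[of "1 / c0\<^sup>2 * (4 * packing_const)" ?X] X packing_const_pos
    have "ennreal grid_const = 2 * ennreal (1 / c0\<^sup>2 * (4 * packing_const)) + 6 * ennreal ?X"
      by (simp add: grid_const_def)
    then show ?thesis by (simp only: distrib_right mult.assoc)
  qed
  finally show ?thesis .
qed

end

section \<open>Averaging over the shifts\<close>

context tb_setting
begin

lemma x_integral_measurable:
  assumes f: "f \<in> borel_measurable borel" and A [measurable]: "A \<in> sets borel"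
  shows "(\<lambda>t. \<integral>\<^sup>+x\<in>A. density_at f x t \<partial>\<mu>) \<in> borel_measurable borel"
proof -
  have [measurable]: "(\<lambda>q. density_at f (snd q) (fst q)) \<in> borel_measurable ((lborel :: real measure) \<Otimes>\<^sub>M \<mu>)"
    using measurable_compose[OF measurable_pair_swap' density_at_measurable'[OF f]] by (simp add: case_prod_beta)
  have [measurable]: "snd \<in> (lborel :: real measure) \<Otimes>\<^sub>M \<mu> \<rightarrow>\<^sub>M borel"
    using measurable_snd[of "lborel :: real measure" \<mu>] borel_mu measurable_cong_sets by blast
  have "(\<lambda>q. density_at f (snd q) (fst q) * indicator A (snd q)) \<in> borel_measurable ((lborel :: real measure) \<Otimes>\<^sub>M \<mu>)"
    by measurable
  then have "(\<lambda>t. \<integral>\<^sup>+x\<in>A. density_at f x t \<partial>\<mu>) \<in> borel_measurable (lborel :: real measure)"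
    by (intro SF.borel_measurable_nn_integral) (simp add: case_prod_beta)
  then show ?thesis by simp
qed

lemma indicator_slabs_le:
  fixes h t :: real
  assumes "h > 0"
  shows "(indicator {h <.. h * 4 ^ Suc N} t :: ennreal) \<le> (\<Sum>k\<le>N. indicator {h * 4 ^ k <.. h * 4 ^ Suc k} t)"
proof (induction N)
  case (Suc N)
  have "(indicator {h <.. h * 4 ^ Suc (Suc N)} t :: ennreal)
      \<le> indicator {h <.. h * 4 ^ Suc N} t + indicator {h * 4 ^ Suc N <.. h * 4 ^ Suc (Suc N)} t"
    by (auto simp: indicator_def)
  also have "\<dots> \<le> (\<Sum>k\<le>N. indicator {h * 4 ^ k <.. h * 4 ^ Suc k} t) + indicator {h * 4 ^ Suc N <.. h * 4 ^ Suc (Suc N)} t"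
    by (intro add_right_mono Suc.IH)
  finally show ?case by (simp only: sum.atMost_Suc)
qed (simp add: indicator_def)

lemma good_shift_average:
  assumes h: "h > 0" and k: "k \<le> N" and Mn: "Mn = 36 * CARD('n) * 4 ^ N"
  shows "ennreal (real Mn / 2) \<le> (\<Sum>m<Mn. indicator (good (real m * (sep * h)) h N sep k) (x :: real ^ 'n))"
proof -
  let ?bad = "{m. m < Mn \<and> x \<notin> good (real m * (sep * h)) h N sep k}"
  let ?ok = "{m. m < Mn \<and> x \<in> good (real m * (sep * h)) h N sep k}"
  have "2 * card ?bad \<le> Mn" by (rule few_bad_shifts[OF h k sep_def Mn])
  moreover have "card ?bad + card ?ok = Mn"
  proof -
    have "card ?bad + card ?ok = card (?bad \<union> ?ok)" by (intro card_Un_disjoint[symmetric]) auto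
    also have "?bad \<union> ?ok = {..<Mn}" by auto
    finally show ?thesis by simp
  qed
  ultimately have "real Mn / 2 \<le> real (card ?ok)" by linarith
  then have "ennreal (real Mn / 2) \<le> of_nat (card ?ok)"
    unfolding ennreal_of_nat_eq_real_of_nat by (rule ennreal_leI)
  also have "\<dots> = (\<Sum>m\<in>?ok. 1)" by simp
  also have "\<dots> = (\<Sum>m\<in>?ok. indicator (good (real m * (sep * h)) h N sep k) x)" by (intro sum.cong) auto
  also have "\<dots> = (\<Sum>m<Mn. indicator (good (real m * (sep * h)) h N sep k) x)"
    by (intro sum.mono_neutral_left) (auto simp: indicator_def)
  finally show ?thesis .
qed

text \<open>Every \<open>x\<close> is good for at least half of the shifts, so half of the unrestricted integral is at most the average of the
integrals over the good sets.\<close>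

theorem truncated_estimate:
  assumes h: "h > 0" and f: "f \<in> borel_measurable borel"
    and fin: "sqint \<mu> f < \<infinity>"
  shows "(\<integral>\<^sup>+t\<in>{h <.. h * 4 ^ Suc N}. (\<integral>\<^sup>+x. density_at f x t \<partial>\<mu>) \<partial>lborel)
    \<le> ennreal (2 * grid_const) * (sqint \<mu> f)"
proof -
  let ?F = "sqint \<mu> f"
  let ?slab = "\<lambda>k. {h * 4 ^ k <.. h * 4 ^ Suc k}"
  define Mn where "Mn = 36 * CARD('n) * 4 ^ N"
  have Mn0: "Mn > 0" by (simp add: Mn_def)
  define G :: "nat \<Rightarrow> nat \<Rightarrow> (real ^ 'n) set" where "G m k = good (real m * (sep * h)) h N sep k" for m k
  have [measurable]: "G m k \<in> sets borel" for m k unfolding G_def by (rule good_in_borel[OF h])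
  have est: "(\<Sum>k\<le>N. (\<integral>\<^sup>+t\<in>?slab k. (\<integral>\<^sup>+x\<in>G m k. density_at f x t \<partial>\<mu>) \<partial>lborel)) \<le> ennreal grid_const * ?F" for m
  proof -
    interpret grid_setting \<mu> lam C_lam \<alpha> s C1 b c0 C0 M "real m * (sep * h)" h N f
      by unfold_locales (use h f fin in auto)
    show ?thesis unfolding G_def by (rule grid_estimate)
  qed
  define J where "J k = (\<integral>\<^sup>+t\<in>?slab k. (\<integral>\<^sup>+x. density_at f x t \<partial>\<mu>) \<partial>lborel)" for k
  have gm [measurable]: "(\<lambda>t. \<integral>\<^sup>+x. density_at f x t \<partial>\<mu>) \<in> borel_measurable borel"
    using x_integral_measurable[OF f, of UNIV] by simp
  have avg: "ennreal (real Mn / 2) * J k \<le> (\<Sum>m<Mn. (\<integral>\<^sup>+t\<in>?slab k. (\<integral>\<^sup>+x\<in>G m k. density_at f x t \<partial>\<mu>) \<partial>lborel))"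
    if k: "k \<le> N" for k
  proof -
    note [measurable] = density_at_x[OF f] x_integral_measurable[OF f]
    have "ennreal (real Mn / 2) * J k = (\<integral>\<^sup>+t\<in>?slab k. (ennreal (real Mn / 2) * (\<integral>\<^sup>+x. density_at f x t \<partial>\<mu>)) \<partial>lborel)"
      unfolding J_def mult.assoc by (rule nn_integral_cmult[symmetric]) measurable
    also have "\<dots> \<le> (\<integral>\<^sup>+t\<in>?slab k. (\<Sum>m<Mn. (\<integral>\<^sup>+x\<in>G m k. density_at f x t \<partial>\<mu>)) \<partial>lborel)"
    proof (intro nn_integral_mono mult_right_mono)
      fix t
      have "ennreal (real Mn / 2) * (\<integral>\<^sup>+x. density_at f x t \<partial>\<mu>) = (\<integral>\<^sup>+x. ennreal (real Mn / 2) * density_at f x t \<partial>\<mu>)"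
        by (rule nn_integral_cmult[symmetric]) simp
      also have "\<dots> \<le> (\<integral>\<^sup>+x. (\<Sum>m<Mn. indicator (G m k) x) * density_at f x t \<partial>\<mu>)"
        unfolding G_def by (intro nn_integral_mono mult_right_mono good_shift_average[OF h k Mn_def]) simp
      also have "\<dots> = (\<integral>\<^sup>+x. (\<Sum>m<Mn. density_at f x t * indicator (G m k) x) \<partial>\<mu>)"
        by (intro nn_integral_cong, subst sum_distrib_right, intro sum.cong refl mult.commute)
      also have "\<dots> = (\<Sum>m<Mn. (\<integral>\<^sup>+x\<in>G m k. density_at f x t \<partial>\<mu>))"
        by (rule nn_integral_sum) simp
      finally show "ennreal (real Mn / 2) * (\<integral>\<^sup>+x. density_at f x t \<partial>\<mu>) \<le> (\<Sum>m<Mn. (\<integral>\<^sup>+x\<in>G m k. density_at f x t \<partial>\<mu>))" .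
    qed simp
    also have "\<dots> = (\<Sum>m<Mn. (\<integral>\<^sup>+t\<in>?slab k. (\<integral>\<^sup>+x\<in>G m k. density_at f x t \<partial>\<mu>) \<partial>lborel))"
      unfolding sum_distrib_right by (rule nn_integral_sum) measurable
    finally show ?thesis .
  qed
  have "ennreal (real Mn / 2) * (\<Sum>k\<le>N. J k) \<le> (\<Sum>k\<le>N. \<Sum>m<Mn. (\<integral>\<^sup>+t\<in>?slab k. (\<integral>\<^sup>+x\<in>G m k. density_at f x t \<partial>\<mu>) \<partial>lborel))"
    unfolding sum_distrib_left by (intro sum_mono avg) auto
  also have "\<dots> = (\<Sum>m<Mn. \<Sum>k\<le>N. (\<integral>\<^sup>+t\<in>?slab k. (\<integral>\<^sup>+x\<in>G m k. density_at f x t \<partial>\<mu>) \<partial>lborel))"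
    by (rule sum.swap)
  also have "\<dots> \<le> (\<Sum>m<Mn. ennreal grid_const * ?F)" by (intro sum_mono est)
  also have "\<dots> = ennreal (real Mn) * (ennreal grid_const * ?F)"
    by (simp add: ennreal_of_nat_eq_real_of_nat)
  finally have "ennreal (2 / real Mn) * (ennreal (real Mn / 2) * (\<Sum>k\<le>N. J k)) \<le> ennreal (2 / real Mn) * (ennreal (real Mn) * (ennreal grid_const * ?F))"
    by (intro mult_left_mono) auto
  moreover have "ennreal (2 / real Mn) * ennreal (real Mn / 2) = 1"
    using Mn0 by (subst ennreal_mult[symmetric]) auto
  moreover have "ennreal (2 / real Mn) * ennreal (real Mn) = 2"
    using Mn0 by (subst ennreal_mult[symmetric]) auto
  ultimately have "(\<Sum>k\<le>N. J k) \<le> 2 * ennreal grid_const * ?F"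
    by (simp only: mult.assoc[symmetric] mult_1_left)
  also have "2 * ennreal grid_const = ennreal (2 * grid_const)" by (simp add: ennreal_mult')
  finally have J: "(\<Sum>k\<le>N. J k) \<le> ennreal (2 * grid_const) * ?F" .
  have "(\<integral>\<^sup>+t\<in>{h <.. h * 4 ^ Suc N}. (\<integral>\<^sup>+x. density_at f x t \<partial>\<mu>) \<partial>lborel)
    \<le> (\<integral>\<^sup>+t. (\<Sum>k\<le>N. (\<integral>\<^sup>+x. density_at f x t \<partial>\<mu>) * indicator (?slab k) t) \<partial>lborel)"
    unfolding sum_distrib_left[symmetric]
    by (intro nn_integral_mono mult_left_mono indicator_slabs_le[OF h]) simp
  also have "\<dots> = (\<Sum>k\<le>N. J k)" unfolding J_def by (rule nn_integral_sum) measurable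
  finally show ?thesis using J by (rule order_trans)
qed

text \<open>Monotone convergence along \<open>h = 4\<^bsup>-p\<^esup>\<close> and \<open>N = 2 p\<close>, for which the slabs cover \<open>4\<^bsup>-p\<^esup> < t \<le> 4\<^bsup>p+1\<^esup>\<close>.\<close>

theorem full_estimate:
  assumes f: "f \<in> borel_measurable borel" and fin: "sqint \<mu> f < \<infinity>"
  shows "square_integral \<mu> s f upper_half_space \<le> ennreal (2 * grid_const) * (sqint \<mu> f)"
proof -
  define g where "g t = (\<integral>\<^sup>+x. density_at f x t \<partial>\<mu>)" for t
  have [measurable]: "g \<in> borel_measurable borel"
    unfolding g_def using x_integral_measurable[OF f, of UNIV] by simp
  define A :: "nat \<Rightarrow> real set" where "A p = {1 / 4 ^ p <.. 4 ^ Suc p}" for p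
  have incA: "A p \<subseteq> A p'" if "p \<le> p'" for p p'
  proof -
    have "1 / (4::real) ^ p' \<le> 1 / 4 ^ p" using that by (intro divide_left_mono power_increasing) auto
    moreover have "(4::real) ^ Suc p \<le> 4 ^ Suc p'" using that by (intro power_increasing) auto
    ultimately show ?thesis unfolding A_def Ioc_subset_iff by blast
  qed
  have g_sup: "g t = (SUP p. g t * indicator (A p) t)" for t
  proof (cases "t > 0")
    case True
    obtain p1 :: nat where p1: "1 / t < 4 ^ p1" using real_arch_pow[of 4 "1 / t"] by auto
    obtain p2 :: nat where p2: "t < 4 ^ p2" using real_arch_pow[of 4 t] by auto
    define p where "p = max p1 p2"
    have "(4::real) ^ p1 \<le> 4 ^ p" "(4::real) ^ p2 \<le> 4 ^ Suc p" by (rule power_increasing; simp add: p_def)+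
    then have "1 / t < 4 ^ p" "t \<le> 4 ^ Suc p" using p1 p2 by linarith+
    then have "1 < 4 ^ p * t" using True by (simp only: pos_divide_less_eq)
    then have "1 / 4 ^ p < t" by (simp add: pos_divide_less_eq mult.commute)
    then have "t \<in> A p" using \<open>t \<le> 4 ^ Suc p\<close> by (simp add: A_def)
    then have "g t * indicator (A p) t = g t" by simp
    then have "g t \<le> (SUP p. g t * indicator (A p) t)" by (metis SUP_upper UNIV_I)
    moreover have "(SUP p. g t * indicator (A p) t) \<le> g t" by (intro SUP_least) (auto simp: indicator_def)
    ultimately show ?thesis by (rule antisym)
  next
    case False
    then show ?thesis by (simp add: g_def density_at_def)
  qed
  have "square_integral \<mu> s f upper_half_space = (\<integral>\<^sup>+q. density_at f (fst q) (snd q) \<partial>(\<mu> \<Otimes>\<^sub>M lborel))"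
    by (subst square_integral_eq) (auto simp: upper_half_space_def indicator_def density_at_def intro!: nn_integral_cong)
  also have "\<dots> = (\<integral>\<^sup>+t. g t \<partial>lborel)"
    unfolding g_def using MT.nn_integral_snd[OF density_at_measurable'[OF f]] by simp
  also have "\<dots> = (\<integral>\<^sup>+t. (SUP p. g t * indicator (A p) t) \<partial>lborel)" using g_sup by simp
  also have "\<dots> = (SUP p. \<integral>\<^sup>+t. g t * indicator (A p) t \<partial>lborel)"
  proof (rule nn_integral_monotone_convergence_SUP)
    show "incseq (\<lambda>p t. g t * indicator (A p) t)"
      using incA by (auto simp: incseq_def le_fun_def indicator_def intro!: mult_left_mono)
    show "(\<lambda>t. g t * indicator (A p) t) \<in> borel_measurable lborel" for p
      unfolding A_def by measurable
  qed
  also have "\<dots> \<le> ennreal (2 * grid_const) * (sqint \<mu> f)"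
  proof (rule SUP_least)
    fix p :: nat
    have "1 / 4 ^ p * 4 ^ Suc (2 * p) = (4::real) ^ Suc p" by (simp add: mult_2 power_add)
    then have "A p = {1 / 4 ^ p <.. 1 / 4 ^ p * 4 ^ Suc (2 * p)}" unfolding A_def by (simp only:)
    then show "(\<integral>\<^sup>+t. g t * indicator (A p) t \<partial>lborel) \<le> ennreal (2 * grid_const) * (sqint \<mu> f)"
      unfolding g_def using truncated_estimate[OF _ f fin, of "1 / 4 ^ p" "2 * p"] by simp
  qed
  finally show ?thesis .
qed

end

lemma square_integral_null_measure:
  assumes "emeasure \<mu> (space \<mu>) = 0"
  shows "square_integral \<mu> s f A = 0"
proof -
  have "emeasure (\<mu> \<Otimes>\<^sub>M lborel) (space \<mu> \<times> space (lborel :: real measure)) = 0"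
    using assms by (subst lborel.emeasure_pair_measure_Times) auto
  then have "AE p in \<mu> \<Otimes>\<^sub>M (lborel :: real measure). False"
    by (intro AE_I[where N = "space \<mu> \<times> space (lborel :: real measure)"]) (auto simp: space_pair_measure)
  then have "(\<integral>\<^sup>+p\<in>A. ennreal ((norm (theta \<mu> s (snd p) f (fst p)))\<^sup>2 / snd p) \<partial>(\<mu> \<Otimes>\<^sub>M lborel)) = (\<integral>\<^sup>+p. 0 \<partial>(\<mu> \<Otimes>\<^sub>M (lborel :: real measure)))"
    by (intro nn_integral_cong_AE) auto
  then show ?thesis by (simp add: square_integral_def)
qed

theorem theorem1p1:
  fixes \<mu> :: "(real ^ 'n) measure"
    and lam :: "real ^ 'n \<Rightarrow> real \<Rightarrow> real"
    and s :: "real \<Rightarrow> real ^ 'n \<Rightarrow> real ^ 'n \<Rightarrow> complex"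
    and b :: "real ^ 'n \<Rightarrow> complex"
    and C_lam \<alpha> C\<^sub>1 c\<^sub>0 C\<^sub>0 :: real
  assumes borel_\<mu>: "sets \<mu> = sets borel"
    and doubling: "upper_doubling \<mu> lam C_lam"
    and \<alpha>_pos: "\<alpha> > 0"
    and kernel: "square_function_kernel lam \<alpha> C\<^sub>1 s"
    and b: "b \<in> L_infinity \<mu>"
    and c\<^sub>0_pos: "c\<^sub>0 > 0"
    and accretive: "\<And>c l. l > 0 \<Longrightarrow>
          norm (\<integral>x\<in>cube c l. b x \<partial>\<mu>) \<ge> c\<^sub>0 * measure \<mu> (cube c l)"
    and testing: "\<And>c l. l > 0 \<Longrightarrow>
          square_integral \<mu> s b (carleson_box c l) \<le> ennreal C\<^sub>0 * emeasure \<mu> (cube c (3 * l))"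
  shows "\<exists>C::real. \<forall>f \<in> L_two \<mu>.
           square_integral \<mu> s f upper_half_space \<le> ennreal C * L2_norm_sq \<mu> f"
proof (cases "emeasure \<mu> UNIV = 0")
  case True
  (* For the zero measure reg_lam may vanish, but both sides of the estimate are 0. *)
  have "space \<mu> = UNIV" using borel_\<mu> by (metis sets_eq_imp_space_eq space_borel)
  then have "square_integral \<mu> s f upper_half_space = 0" for f
    using True by (intro square_integral_null_measure) simp
  then show ?thesis by auto
next
  case False
  obtain M0 where M0: "AE x in \<mu>. norm (b x) \<le> M0" and b_meas: "b \<in> borel_measurable \<mu>"
    using b by (auto simp: L_infinity_def)
  have meas_eq: "borel_measurable \<mu> = (borel_measurable borel :: (real ^ 'n \<Rightarrow> complex) set)"
    by (rule measurable_cong_sets) (auto simp: borel_\<mu>)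
  (* Taking maxima makes the bound for b positive and the other two constants nonnegative. *)
  interpret tb_setting \<mu> "reg_lam lam" C_lam \<alpha> s "max 0 C\<^sub>1" b c\<^sub>0 "max 0 C\<^sub>0" "max 1 M0"
  proof
    show "upper_doubling \<mu> (reg_lam lam) C_lam" by (rule upper_doubling_reg_lam[OF borel_\<mu> doubling False])
    show "reg_lam lam x r \<le> reg_lam lam y (r + infnorm (x - y))" if "0 < r" for x y r
      by (rule reg_lam_shift[OF borel_\<mu> doubling that])
    show "square_function_kernel (reg_lam lam) \<alpha> (max 0 C\<^sub>1) s" by (rule kernel_reg_lam[OF borel_\<mu> doubling False kernel])
    show "AE x in \<mu>. norm (b x) \<le> max 1 M0" using M0 by eventually_elim auto
    show "b \<in> borel_measurable borel" using b_meas by (simp add: meas_eq)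
    have "ennreal (max 0 C\<^sub>0) = ennreal C\<^sub>0" by (simp add: max_def ennreal_neg)
    then show "square_integral \<mu> s b (carleson_box c l) \<le> ennreal (max 0 C\<^sub>0) * emeasure \<mu> (cube c (3 * l))" if "l > 0" for c l
      using testing[OF that, of c] by simp
  qed (use borel_\<mu> \<alpha>_pos c\<^sub>0_pos accretive in auto)
  show ?thesis
  proof (intro exI ballI)
    fix f assume "f \<in> L_two \<mu>"
    then have "f \<in> borel_measurable borel" "sqint \<mu> f < \<infinity>"
      unfolding L_two_def L2_norm_sq_def by (auto simp: meas_eq)
    then show "square_integral \<mu> s f upper_half_space \<le> ennreal (2 * grid_const) * L2_norm_sq \<mu> f"
      unfolding L2_norm_sq_def by (rule full_estimate)
  qed
qed

end
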